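(* Let $F \subseteq K$ be differential fields with the same constants, let $\theta \in K$ be an exponential over $F$ (i.e. $\theta \neq 0$ and $D\theta/\theta = Du$ for some $u \in F$), and suppose that $K$ is algebraic over $F(\theta)$. Let $f \in F$ and suppose that $f$, as an element of $K$, has integral with polylog terms defined over $K$. Then there is a differential field $F'$ which is an algebraic extension of $F$ such that $f$, as an element of $F'$, has integral with polylog terms defined over $F'$.
   Context: All fields have characteristic $0$; $D$ denotes the derivation of every differential field considered; a constant is an element $c$ with $Dc=0$. Algebraic extensions of differential fields carry the unique extension of the derivation. Logarithms: for a nonzero element $a$ of a differential field, $\log(a)$ denotes an element of some differential extension field with $D\log(a) = Da/a$ (determined up to an additive constant). Extensions by logarithms are assumed not to add new constants. Elementary extension: a differential field $L$ is an elementary extension of a differential field $F_0$ if $L = F_0(\theta_1,\dots,\theta_n)$ where, for each $i$, with $F_i = F_0(\theta_1,\dots,\theta_{i-1})$, one of the following holds: (1) $\theta_i$ is algebraic over $F_i$; (2) $\theta_i\ne 0$ and $D\theta_i/\theta_i = Du$ for some $u \in F_i$; (3) $D\theta_i = Du/u$ for some nonzero $u \in F_i$. An element is elementary over $F_0$ if it lies in an elementary extension of $F_0$. Integral with polylog terms: let $K_0$ be a differential field and $F_0$ a differential subfield of $K_0$ ($F_0 = K_0$ allowed). An element $f \in K_0$ has integral with polylog terms defined over $F_0$ if there is an extension $L$ of $K_0$ by finitely many logarithms of elements of $K_0$, finitely many $h_i \in F_0\setminus\{0,1\}$ with $\log(h_i)\in L$, constants $d_i$, positive integers $k_i$, and an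 element $E$ elementary over $K_0$ (in an elementary extension of $K_0$ containing $L$) such that $$f = DE + \sum_i d_i \frac{D(1-h_i)}{1-h_i}\log(h_i)^{k_i}.$$ *)

theory Defs
  imports "HOL-Algebra.Algebra"
begin

locale differential_field = field K for K (structure) +
  fixes D :: "'a \<Rightarrow> 'a"
  assumes char_zero: "\<And>n::nat. n > 0 \<Longrightarrow> [n] \<cdot> \<one> \<noteq> \<zero>"
    and D_closed: "x \<in> carrier K \<Longrightarrow> D x \<in> carrier K"
    and D_add: "\<lbrakk>x \<in> carrier K; y \<in> carrier K\<rbrakk> \<Longrightarrow> D (x \<oplus> y) = D x \<oplus> D y"
    and D_mult: "\<lbrakk>x \<in> carrier K; y \<in> carrier K\<rbrakk> \<Longrightarrow> D (x \<otimes> y) = D x \<otimes> y \<oplus> x \<otimes> D y"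

definition differential_subfield :: "'a set \<Rightarrow> ('a, 'm) ring_scheme \<Rightarrow> ('a \<Rightarrow> 'a) \<Rightarrow> bool" where
  "differential_subfield F K D \<longleftrightarrow> subfield F K \<and> (\<forall>x\<in>F. D x \<in> F)"

(* Ring homomorphisms preserve 1, so a differential homomorphism between fields is injective. *)
definition differential_hom ::
  "('a, 'm) ring_scheme \<Rightarrow> ('a \<Rightarrow> 'a) \<Rightarrow> ('b, 'n) ring_scheme \<Rightarrow> ('b \<Rightarrow> 'b) \<Rightarrow> ('a \<Rightarrow> 'b) \<Rightarrow> bool" where
  "differential_hom K D M D' \<phi> \<longleftrightarrow>
     \<phi> \<in> ring_hom K M \<and> (\<forall>x\<in>carrier K. \<phi> (D x) = D' (\<phi> x))"

definition constants_in :: "('a, 'm) ring_scheme \<Rightarrow> ('a \<Rightarrow> 'a) \<Rightarrow> 'a set \<Rightarrow> 'a set" where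
  "constants_in K D F = {c \<in> F. D c = \<zero>\<^bsub>K\<^esub>}"

definition log_deriv :: "('a, 'm) ring_scheme \<Rightarrow> ('a \<Rightarrow> 'a) \<Rightarrow> 'a \<Rightarrow> 'a" where
  "log_deriv K D a = D a \<otimes>\<^bsub>K\<^esub> inv\<^bsub>K\<^esub> a"

definition is_log :: "('a, 'm) ring_scheme \<Rightarrow> ('a \<Rightarrow> 'a) \<Rightarrow> 'a \<Rightarrow> 'a \<Rightarrow> bool" where
  "is_log K D a l \<longleftrightarrow>
     a \<in> carrier K - {\<zero>\<^bsub>K\<^esub>} \<and> l \<in> carrier K \<and> D l = log_deriv K D a"

definition exponential_over ::
  "('a, 'm) ring_scheme \<Rightarrow> ('a \<Rightarrow> 'a) \<Rightarrow> 'a set \<Rightarrow> 'a \<Rightarrow> bool" where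
  "exponential_over K D F \<theta> \<longleftrightarrow>
     \<theta> \<in> carrier K - {\<zero>\<^bsub>K\<^esub>} \<and> (\<exists>u\<in>F. log_deriv K D \<theta> = D u)"

definition logarithmic_over ::
  "('a, 'm) ring_scheme \<Rightarrow> ('a \<Rightarrow> 'a) \<Rightarrow> 'a set \<Rightarrow> 'a \<Rightarrow> bool" where
  "logarithmic_over K D F \<theta> \<longleftrightarrow> (\<exists>u\<in>F. is_log K D u \<theta>)"

definition algebraic_over :: "('a, 'm) ring_scheme \<Rightarrow> 'a set \<Rightarrow> 'a \<Rightarrow> bool" where
  "algebraic_over K F x \<longleftrightarrow> x \<in> carrier K \<and> ring.algebraic K F x"

(* elementary_ext M D F L: the subfield L of M is an elementary extension of the subfield F. *)
inductive elementary_ext ::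
  "('a, 'm) ring_scheme \<Rightarrow> ('a \<Rightarrow> 'a) \<Rightarrow> 'a set \<Rightarrow> 'a set \<Rightarrow> bool"
  for M D F where
  base: "elementary_ext M D F F"
| step: "\<lbrakk>elementary_ext M D F L;
          algebraic_over M L \<theta> \<or> exponential_over M D L \<theta> \<or> logarithmic_over M D L \<theta>\<rbrakk>
         \<Longrightarrow> elementary_ext M D F (generate_field M (insert \<theta> L))"

(* Extension by finitely many logarithms of elements of F, adding no new constants. *)
definition log_ext ::
  "('a, 'm) ring_scheme \<Rightarrow> ('a \<Rightarrow> 'a) \<Rightarrow> 'a set \<Rightarrow> 'a set \<Rightarrow> bool" where
  "log_ext M D F L \<longleftrightarrow>
     (\<exists>S. finite S \<and> (\<forall>l\<in>S. logarithmic_over M D F l) \<and> L = generate_field M (F \<union> S)) \<and>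
     constants_in M D L = constants_in M D F"

(* f in K has integral with polylog terms defined over the differential subfield F of K.
   M is the elementary extension of K containing L and E, with K embedded in it by phi.
   Letting M range over structures on the element type of K loses no generality: K is infinite
   (characteristic 0) and M is finitely generated over K, hence equipotent to K, so every
   elementary extension of K has an isomorphic copy over K on that type. *)
definition has_polylog_integral ::
  "'a ring \<Rightarrow> ('a \<Rightarrow> 'a) \<Rightarrow> 'a set \<Rightarrow> 'a \<Rightarrow> bool" where
  "has_polylog_integral K D F f \<longleftrightarrow>
     (\<exists>(M :: 'a ring) D' \<phi> L E (n::nat) h l d (k :: nat \<Rightarrow> nat).
        differential_field M D' \<and> differential_hom K D M D' \<phi> \<and>
        elementary_ext M D' (\<phi> ` carrier K) (carrier M) \<and>
        log_ext M D' (\<phi> ` carrier K) L \<and>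
        E \<in> carrier M \<and>
        (\<forall>i<n. h i \<in> F - {\<zero>\<^bsub>K\<^esub>, \<one>\<^bsub>K\<^esub>} \<and>
               l i \<in> L \<and> is_log M D' (\<phi> (h i)) (l i) \<and>
               d i \<in> constants_in M D' L \<and> k i > 0) \<and>
        \<phi> f = D' E \<oplus>\<^bsub>M\<^esub>
          (\<Oplus>\<^bsub>M\<^esub>i\<in>{..<n}. d i \<otimes>\<^bsub>M\<^esub> log_deriv M D' (\<one>\<^bsub>M\<^esub> \<ominus>\<^bsub>M\<^esub> \<phi> (h i)) \<otimes>\<^bsub>M\<^esub> (l i [^]\<^bsub>M\<^esub> k i)))"

end

theory Submission
  imports Defs "HOL-Algebra.Algebraic_Closure_Type" "HOL-Library.Poly_Mapping"
begin

text \<open>The idea is to compare constant terms of Laurent series in the exponential. Let \<open>F'\<close> be the algebraic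
  closure of \<open>F\<close>. If \<open>\<theta>\<close> is algebraic over \<open>F\<close>, then \<open>K\<close> itself will do. Otherwise, by the
  Newton--Puiseux theorem, \<open>K\<close> embeds differentially into the Laurent series over \<open>F'\<close> in a root of
  \<open>\<theta>\<close>, and this embedding extends to the given logarithms and, once exponentials are eliminated from
  it, to the elementary tower: the logarithm of a series is the logarithm of its leading coefficient
  plus a multiple of the logarithm \<open>u\<close> of \<open>\<theta>\<close> plus a power series. The derivation acts on each power of
  \<open>\<theta>\<close> separately, so taking constant terms commutes with it. This turns the given
  identity for \<open>f\<close> into one whose polylogarithmic arguments are the constant terms of the
  \<open>h\<^sub>i\<close> that are units different from 1 at \<open>\<theta> = 0\<close>; the remaining summands become elementary.\<close>

section \<open>Subfields, polynomials and extension of homomorphisms\<close>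

text \<open>Everything happens inside one algebraically closed field type \<open>'u\<close> that is
  larger than the given type, with subfields as sets. A logarithm missing from the target is a fresh
  transcendental of \<open>'u\<close>, and the derivation is redefined outside the field built so
  far; hence the proof carries a chain of derivations that agree only on earlier fields. The
  obstacle is the ban on new constants. The logarithms of the polylogarithmic arguments must lie in
  an extension without new constants, whereas the elementary part may bring in any. So those
  logarithms are expanded under the invariant \<open>tame\<close>: one is adjoined to the target
  only if no antiderivative is there yet, and its expansion has no polar part, so that constant
  terms of the summands factor. Only then is the tower of the elementary part expanded, with a fresh
  logarithm for each transcendental one. Exponentials of that tower have to go beforehand, because
  the exponential of a series with a pole is not a Laurent series. Removing one is the same
  constant-term argument, with that exponential in place of \<open>\<theta>\<close>.\<close>

definition field_set :: "'a::field set \<Rightarrow> bool" where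
  "field_set H \<longleftrightarrow> 1 \<in> H \<and> (\<forall>x\<in>H. \<forall>y\<in>H. x - y \<in> H \<and> x * y \<in> H) \<and> (\<forall>x\<in>H. inverse x \<in> H)"

definition gen :: "'a::field set \<Rightarrow> 'a set" where
  "gen A = \<Inter>{H. field_set H \<and> A \<subseteq> H}"

definition poly_over :: "'a::zero set \<Rightarrow> 'a poly \<Rightarrow> bool" where
  "poly_over H p \<longleftrightarrow> (\<forall>i. coeff p i \<in> H)"

definition algebraic_elt :: "'a::field set \<Rightarrow> 'a \<Rightarrow> bool" where
  "algebraic_elt H x \<longleftrightarrow> (\<exists>p. poly_over H p \<and> p \<noteq> 0 \<and> poly p x = 0)"

text \<open>Polynomials have coefficients in the ambient field, so divisibility over
  \<open>H\<close> is recorded with a quotient that is again over \<open>H\<close>.\<close>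

definition minimal_poly :: "'a::field set \<Rightarrow> 'a \<Rightarrow> 'a poly \<Rightarrow> bool" where
  "minimal_poly H x P \<longleftrightarrow> poly_over H P \<and> degree P > 0 \<and> poly P x = 0 \<and> lead_coeff P = 1 \<and>
     (\<forall>q. poly_over H q \<longrightarrow> poly q x = 0 \<longrightarrow> degree q < degree P \<longrightarrow> q = 0) \<and>
     (\<forall>q. poly_over H q \<longrightarrow> poly q x = 0 \<longrightarrow> (\<exists>r. poly_over H r \<and> q = P * r))"

lemma minimal_polyD:
  assumes "minimal_poly H x P"
  shows "poly_over H P" "degree P > 0" "poly P x = 0"
    "\<And>q. poly_over H q \<Longrightarrow> poly q x = 0 \<Longrightarrow> degree q < degree P \<Longrightarrow> q = 0"
    "\<And>q. poly_over H q \<Longrightarrow> poly q x = 0 \<Longrightarrow> \<exists>r. poly_over H r \<and> q = P * r" "lead_coeff P = 1"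
  using assms by (auto simp: minimal_poly_def)

definition hom_on :: "'a::comm_ring_1 set \<Rightarrow> ('a \<Rightarrow> 'b::comm_ring_1) \<Rightarrow> bool" where
  "hom_on H f \<longleftrightarrow> f 1 = 1 \<and> (\<forall>x\<in>H. \<forall>y\<in>H. f (x + y) = f x + f y \<and> f (x * y) = f x * f y)"

context
  fixes H :: "'a::field set"
  assumes H: "field_set H"
begin

lemma fs_1: "1 \<in> H"
  and fs_diff: "x \<in> H \<Longrightarrow> y \<in> H \<Longrightarrow> x - y \<in> H"
  and fs_mult: "x \<in> H \<Longrightarrow> y \<in> H \<Longrightarrow> x * y \<in> H"
  and fs_inverse: "x \<in> H \<Longrightarrow> inverse x \<in> H"
  using H unfolding field_set_def by auto

lemma fs_0: "0 \<in> H"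
  using fs_diff[OF fs_1 fs_1] by simp

lemma fs_uminus: "x \<in> H \<Longrightarrow> - x \<in> H"
  using fs_diff[OF fs_0] by fastforce

lemma fs_add: "x \<in> H \<Longrightarrow> y \<in> H \<Longrightarrow> x + y \<in> H"
  using fs_diff[of x "- y"] fs_uminus by simp

lemma fs_divide: "x \<in> H \<Longrightarrow> y \<in> H \<Longrightarrow> x / y \<in> H"
  using fs_mult fs_inverse by (simp add: divide_inverse)

lemma fs_power: "x \<in> H \<Longrightarrow> x ^ n \<in> H"
  by (induction n) (auto simp: fs_1 fs_mult)

lemma fs_sum: "(\<And>i. i \<in> A \<Longrightarrow> f i \<in> H) \<Longrightarrow> sum f A \<in> H"
  by (induction A rule: infinite_finite_induct) (auto simp: fs_0 fs_add)

lemma fs_of_nat: "of_nat n \<in> H"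
  by (induction n) (auto simp: fs_0 fs_add fs_1)

lemma fs_of_int: "of_int n \<in> H"
  by (cases n) (simp_all only: of_int_of_nat_eq of_int_minus fs_of_nat fs_uminus)

lemma poly_over_0: "poly_over H 0"
  and poly_over_1: "poly_over H 1"
  by (auto simp: poly_over_def fs_0 fs_1 coeff_1)

lemma poly_over_add: "poly_over H p \<Longrightarrow> poly_over H q \<Longrightarrow> poly_over H (p + q)"
  and poly_over_diff: "poly_over H p \<Longrightarrow> poly_over H q \<Longrightarrow> poly_over H (p - q)"
  and poly_over_mult: "poly_over H p \<Longrightarrow> poly_over H q \<Longrightarrow> poly_over H (p * q)"
  and poly_over_smult: "c \<in> H \<Longrightarrow> poly_over H p \<Longrightarrow> poly_over H (smult c p)"
  and poly_over_monom: "c \<in> H \<Longrightarrow> poly_over H (monom c n)"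
  and poly_over_pCons: "c \<in> H \<Longrightarrow> poly_over H p \<Longrightarrow> poly_over H (pCons c p)"
  and poly_over_pderiv: "poly_over H p \<Longrightarrow> poly_over H (pderiv p)"
  by (auto simp: poly_over_def coeff_mult coeff_pCons coeff_pderiv fs_0 fs_add fs_diff fs_mult
      fs_1 fs_of_nat simp del: of_nat_Suc intro!: fs_sum fs_mult fs_of_nat split: nat.splits)

lemma poly_over_map:
  "poly_over H p \<Longrightarrow> (\<And>x. x \<in> H \<Longrightarrow> d x \<in> H) \<Longrightarrow> d 0 = 0 \<Longrightarrow> poly_over H (map_poly d p)"
  by (auto simp: poly_over_def coeff_map_poly)

lemma poly_over_eval: "poly_over H p \<Longrightarrow> x \<in> H \<Longrightarrow> poly p x \<in> H"
  by (auto simp: poly_altdef poly_over_def intro!: fs_sum fs_mult fs_power)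

lemma minimal_poly_exists:
  assumes "algebraic_elt H x"
  obtains P where "minimal_poly H x P"
proof -
  define A where "A = {p. poly_over H p \<and> p \<noteq> 0 \<and> poly p x = 0}"
  obtain p0 where p0: "p0 \<in> A" using assms by (auto simp: algebraic_elt_def A_def)
  obtain p where p: "p \<in> A" "\<And>q. q \<in> A \<Longrightarrow> degree p \<le> degree q"
    using ex_has_least_nat[of "\<lambda>p. p \<in> A", OF p0, of degree] by blast
  define P where "P = smult (inverse (lead_coeff p)) p"
  have lc: "lead_coeff p \<noteq> 0" using p by (auto simp: A_def)
  have P: "poly_over H P" "lead_coeff P = 1" "poly P x = 0" "degree P = degree p"
    using p lc by (auto simp: A_def P_def poly_over_def intro!: fs_mult fs_inverse)
  have min: "q = 0" if "poly_over H q" "poly q x = 0" "degree q < degree P" for q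
    using p(2)[of q] that P(4) by (force simp: A_def)
  have pos: "degree P > 0"
  proof (rule ccontr)
    assume "\<not> degree P > 0"
    then have "P = 1" using P(2) by (metis degree_eq_zeroE gr0I lead_coeff_pCons(2) one_pCons)
    then show False using P(3) by simp
  qed
  \<comment> \<open>Long division by the monic \<open>P\<close>, one leading term \<open>m\<close>
    at a time, which keeps quotient and remainder over \<open>H\<close>.\<close>
  have dv: "\<exists>r. poly_over H r \<and> q = P * r" if "poly_over H q" "poly q x = 0" for q
    using that
  proof (induction "degree q" arbitrary: q rule: less_induct)
    case less
    show ?case
    proof (cases "degree q < degree P")
      case True
      then show ?thesis using min[OF less.prems] poly_over_0 by (intro exI[of _ 0]) auto
    next
      case False
      define m where "m = monom (lead_coeff q) (degree q - degree P)"
      have q0: "q \<noteq> 0" using False pos by auto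
      have m: "poly_over H m" using less.prems(1) by (auto simp: m_def poly_over_def fs_0)
      define q' where "q' = q - P * m"
      have q': "poly_over H q'" "poly q' x = 0"
        using less.prems m P by (auto simp: q'_def intro!: poly_over_diff poly_over_mult)
      have dm: "degree (P * m) = degree q" "m \<noteq> 0"
      proof -
        have "P \<noteq> 0" "m \<noteq> 0" using P(2) q0 by (auto simp: m_def)
        then show "degree (P * m) = degree q" "m \<noteq> 0"
          using False q0 by (simp_all add: degree_mult_eq m_def degree_monom_eq)
      qed
      have "lead_coeff (P * m) = lead_coeff q"
        unfolding lead_coeff_mult using P(2) q0 by (simp add: m_def degree_monom_eq)
      then have "coeff q' (degree q) = 0" "degree q' \<le> degree q"
        unfolding q'_def using dm(1) by (auto intro: degree_diff_le)
      then have "degree q' < degree q"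
        using False pos by (metis degree_0 leading_coeff_0_iff le_neq_implies_less leI less_le_trans)
      from less.hyps[OF this q'] obtain r where "poly_over H r" "q' = P * r" by blast
      then have "q = P * (r + m)" "poly_over H (r + m)"
        using m by (auto simp: q'_def algebra_simps intro: poly_over_add)
      then show ?thesis by blast
    qed
  qed
  show ?thesis by (rule that) (use P pos min dv in \<open>auto simp: minimal_poly_def\<close>)
qed

lemma hom_on_0: "hom_on H f \<Longrightarrow> f 0 = 0"
  unfolding hom_on_def using fs_0 by (metis add_cancel_right_right add.right_neutral)

lemma hom_on_uminus: "hom_on H f \<Longrightarrow> x \<in> H \<Longrightarrow> f (- x) = - f x"
  using hom_on_0[of f] fs_uminus unfolding hom_on_def
  by (metis add.commute add_eq_0_iff)

lemma hom_on_diff: "hom_on H f \<Longrightarrow> x \<in> H \<Longrightarrow> y \<in> H \<Longrightarrow> f (x - y) = f x - f y"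
  using hom_on_uminus[of f y] fs_uminus[of y] unfolding hom_on_def
  by (metis add_uminus_conv_diff)

lemma hom_on_sum: "hom_on H f \<Longrightarrow> (\<And>i. i \<in> A \<Longrightarrow> g i \<in> H) \<Longrightarrow> f (sum g A) = (\<Sum>i\<in>A. f (g i))"
  by (induction A rule: infinite_finite_induct) (auto simp: hom_on_0 hom_on_def fs_sum)

lemma hom_on_power: "hom_on H f \<Longrightarrow> x \<in> H \<Longrightarrow> f (x ^ n) = f x ^ n"
  by (induction n) (auto simp: hom_on_def fs_power)

lemma hom_on_map_poly_add:
  "hom_on H f \<Longrightarrow> poly_over H p \<Longrightarrow> poly_over H q \<Longrightarrow> map_poly f (p + q) = map_poly f p + map_poly f q"
  by (rule poly_eqI) (auto simp: coeff_map_poly hom_on_0 hom_on_def poly_over_def)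

lemma hom_on_map_poly_diff:
  "hom_on H f \<Longrightarrow> poly_over H p \<Longrightarrow> poly_over H q \<Longrightarrow> map_poly f (p - q) = map_poly f p - map_poly f q"
  by (rule poly_eqI) (auto simp: coeff_map_poly hom_on_0 hom_on_diff poly_over_def)

lemma hom_on_map_poly_mult:
  assumes "hom_on H f" "poly_over H p" "poly_over H q"
  shows "map_poly f (p * q) = map_poly f p * map_poly f q"
proof (rule poly_eqI)
  fix n
  have "f (\<Sum>i\<le>n. coeff p i * coeff q (n - i)) = (\<Sum>i\<le>n. f (coeff p i) * f (coeff q (n - i)))"
    using assms by (subst hom_on_sum) (auto simp: poly_over_def hom_on_def fs_mult)
  then show "coeff (map_poly f (p * q)) n = coeff (map_poly f p * map_poly f q) n"
    using assms by (simp add: coeff_map_poly hom_on_0 coeff_mult)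
qed

end

lemma hom_on_inverse:
  fixes f :: "'a::field \<Rightarrow> 'b::field"
  assumes "field_set H" "hom_on H f" "x \<in> H"
  shows "f (inverse x) = inverse (f x)"
proof (cases "x = 0")
  case False
  then have "f x * f (inverse x) = 1"
    using assms fs_inverse unfolding hom_on_def by (metis right_inverse)
  then show ?thesis by (metis inverse_unique)
qed (use hom_on_0[OF assms(1,2)] in auto)

lemma hom_on_eq_0_iff:
  fixes f :: "'a::field \<Rightarrow> 'b::field"
  assumes "field_set H" "hom_on H f" "x \<in> H"
  shows "f x = 0 \<longleftrightarrow> x = 0"
proof
  assume "f x = 0"
  show "x = 0"
  proof (rule ccontr)
    assume "x \<noteq> 0"
    then have "f x * f (inverse x) = 1"
      using assms fs_inverse unfolding hom_on_def by (metis right_inverse)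
    then show False using \<open>f x = 0\<close> by simp
  qed
qed (use hom_on_0[OF assms(1,2)] in auto)

lemma hom_on_divide:
  fixes f :: "'a::field \<Rightarrow> 'b::field"
  assumes "field_set H" "hom_on H f" "x \<in> H" "y \<in> H"
  shows "f (x / y) = f x / f y"
  using assms hom_on_inverse[OF assms(1,2,4)] fs_inverse[OF assms(1,4)]
  by (auto simp: divide_inverse hom_on_def)

lemma field_set_image:
  fixes f :: "'a::field \<Rightarrow> 'b::field"
  assumes "field_set H" "hom_on H f"
  shows "field_set (f ` H)"
proof -
  have "f x - f y = f (x - y)" "f x * f y = f (x * y)" if "x \<in> H" "y \<in> H" for x y
    using hom_on_diff[OF assms that] assms that by (auto simp: hom_on_def)
  moreover have "inverse (f x) = f (inverse x)" if "x \<in> H" for x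
    using hom_on_inverse[OF assms that] by simp
  moreover have "1 = f 1" using assms by (simp add: hom_on_def)
  ultimately show ?thesis
    unfolding field_set_def using fs_1[OF assms(1)] fs_diff[OF assms(1)] fs_mult[OF assms(1)]
      fs_inverse[OF assms(1)] by (auto simp: image_iff)
qed

lemma gen_field_set: "field_set (gen A)"
  unfolding gen_def field_set_def by auto

lemma gen_superset: "A \<subseteq> gen A"
  by (auto simp: gen_def)

lemma gen_least: "field_set H \<Longrightarrow> A \<subseteq> H \<Longrightarrow> gen A \<subseteq> H"
  by (auto simp: gen_def)

lemma gen_mono: "A \<subseteq> B \<Longrightarrow> gen A \<subseteq> gen B"
  by (meson gen_field_set gen_least gen_superset order_trans)

lemma gen_id: "field_set H \<Longrightarrow> gen H = H"
  by (simp add: gen_least gen_superset subset_antisym)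

text \<open>Quotients of polynomial values at \<open>x\<close> are already closed under the field
  operations, the inverse of 0 being 0.\<close>

lemma gen_insert_eq:
  assumes H: "field_set H"
  shows "gen (insert x H) = {poly p x / poly q x |p q. poly_over H p \<and> poly_over H q \<and> poly q x \<noteq> 0}"
    (is "_ = ?R")
proof
  have R: "field_set ?R"
    unfolding field_set_def
  proof (intro conjI ballI)
    show "1 \<in> ?R" using poly_over_1[OF H] by (auto intro!: exI[of _ 1])
  next
    fix y z assume "y \<in> ?R" "z \<in> ?R"
    then obtain p q r s where *: "y = poly p x / poly q x" "z = poly r x / poly s x" "poly q x \<noteq> 0"
      "poly s x \<noteq> 0" and o: "poly_over H p" "poly_over H q" "poly_over H r" "poly_over H s" by blast
    have "y - z = poly (p * s - q * r) x / poly (q * s) x"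
      "y * z = poly (p * r) x / poly (q * s) x" "poly (q * s) x \<noteq> 0"
      using *(3,4) unfolding *(1,2) by (simp_all add: field_simps)
    moreover have "poly_over H (p * s - q * r)" "poly_over H (p * r)" "poly_over H (q * s)"
      using o by (auto intro!: poly_over_mult poly_over_diff H)
    ultimately show "y - z \<in> ?R" "y * z \<in> ?R" by blast+
  next
    fix y assume "y \<in> ?R"
    then obtain p q where *: "y = poly p x / poly q x" "poly q x \<noteq> 0"
       "poly_over H p" "poly_over H q" by blast
    show "inverse y \<in> ?R"
    proof (cases "poly p x = 0")
      case True
      then have "inverse y = poly 0 x / poly 1 x" "poly 1 x \<noteq> 0" using * by auto
      then show ?thesis using poly_over_0[OF H] poly_over_1[OF H] by blast
    next
      case False
      then have "inverse y = poly q x / poly p x" using * by simp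
      then show ?thesis using * False by blast
    qed
  qed
  have "poly_over H [:0, 1:]" "x = poly [:0, 1:] x / poly 1 x" "poly 1 x \<noteq> 0"
    by (auto intro!: poly_over_pCons H poly_over_0 fs_0 fs_1)
  then have 1: "x \<in> ?R" using poly_over_1[OF H] by blast
  have 2: "h \<in> ?R" if "h \<in> H" for h
  proof -
    have "poly_over H [:h:]" "h = poly [:h:] x / poly 1 x" "poly 1 x \<noteq> 0"
      using that by (auto intro!: poly_over_pCons H poly_over_0)
    then show ?thesis using poly_over_1[OF H] by blast
  qed
  show "gen (insert x H) \<subseteq> ?R"
    by (rule gen_least[OF R]) (use 1 2 in auto)
  show "?R \<subseteq> gen (insert x H)"
  proof
    fix y assume "y \<in> ?R"
    then obtain p q where *: "y = poly p x / poly q x" "poly_over H p" "poly_over H q" by blast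
    let ?G = "gen (insert x H)"
    have "poly_over ?G p" "poly_over ?G q" "x \<in> ?G"
      using * gen_superset[of "insert x H"] by (auto simp: poly_over_def)
    then show "y \<in> ?G" using * by (auto intro!: fs_divide gen_field_set poly_over_eval)
  qed
qed

text \<open>The target is only a ring because the lemma is also applied to dual numbers, where it
  extends derivations; so denominators have to be assumed to go to units. Together,
  \<open>zero\<close> and \<open>unit\<close> make the value at a quotient of polynomials in
  \<open>x\<close> well defined.\<close>

lemma hom_on_extend:
  fixes f :: "'a::field \<Rightarrow> 'b::comm_ring_1"
  assumes H: "field_set H" and f: "hom_on H f"
    and zero: "\<And>p. poly_over H p \<Longrightarrow> poly p x = 0 \<Longrightarrow> poly (map_poly f p) c = 0"
    and unit: "\<And>p. poly_over H p \<Longrightarrow> poly p x \<noteq> 0 \<Longrightarrow> poly (map_poly f p) c dvd 1"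
  obtains g where "hom_on (gen (insert x H)) g" "\<And>h. h \<in> H \<Longrightarrow> g h = f h" "g x = c"
proof -
  define ev where "ev p = poly (map_poly f p) c" for p
  have ev: "ev (p + q) = ev p + ev q" "ev (p - q) = ev p - ev q" "ev (p * q) = ev p * ev q"
    if "poly_over H p" "poly_over H q" for p q
    using that H f by (auto simp: ev_def hom_on_map_poly_add hom_on_map_poly_mult hom_on_map_poly_diff)
  \<comment> \<open>\<open>R y z\<close> says that \<open>z\<close> is a possible value at
    \<open>y\<close>, expressed without division in the target.\<close>
  define R where "R y z \<longleftrightarrow> (\<exists>p q. poly_over H p \<and> poly_over H q \<and> poly q x \<noteq> 0
     \<and> y = poly p x / poly q x \<and> z * ev q = ev p)" for y z
  have uniq: "z = z'" if R: "R y z" "R y z'" for y z z'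
  proof -
    obtain p q where pq: "poly_over H p" "poly_over H q" "poly q x \<noteq> 0"
       "y = poly p x / poly q x" "z * ev q = ev p" using R(1) by (auto simp: R_def)
    obtain r s where rs: "poly_over H r" "poly_over H s" "poly s x \<noteq> 0"
       "y = poly r x / poly s x" "z' * ev s = ev r" using R(2) by (auto simp: R_def)
    have "poly (p * s - q * r) x = 0" using pq rs by (auto simp: field_simps)
    then have "ev (p * s - q * r) = 0"
      unfolding ev_def by (intro zero) (auto intro!: poly_over_mult poly_over_diff H pq rs)
    then have "ev p * ev s = ev q * ev r"
      using pq rs by (simp add: ev poly_over_mult H)
    then have "(z - z') * (ev q * ev s) = 0"
      using pq(5) rs(5) by (simp add: algebra_simps) (metis mult.commute mult.assoc)
    moreover obtain u v where "ev q * u = 1" "ev s * v = 1"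
      using unit[of q] unit[of s] pq rs unfolding ev_def[symmetric] by (metis dvdE)
    ultimately show ?thesis
      by (metis (no_types, lifting) diff_eq_eq add_0 mult.assoc mult.commute mult.right_neutral
          mult_zero_left)
  qed
  define g where "g y = (SOME z. R y z)" for y
  have geq: "g y = z" if "R y z" for y z
    unfolding g_def by (rule some_equality) (use that uniq in auto)
  have ex: "\<exists>z. R y z" if y: "y \<in> gen (insert x H)" for y
  proof -
    obtain p q where pq: "poly_over H p" "poly_over H q" "poly q x \<noteq> 0"
       "y = poly p x / poly q x" using y by (auto simp: gen_insert_eq[OF H])
    obtain u where "ev q * u = 1" using unit[of q] pq unfolding ev_def[symmetric] by (metis dvdE)
    then have "(ev p * u) * ev q = ev p" by (metis mult.assoc mult.commute mult.right_neutral)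
    then show ?thesis using pq by (auto simp: R_def)
  qed
  have ev1: "ev 1 = 1" using f by (auto simp: ev_def hom_on_def)
  have Rh: "R h (f h)" if "h \<in> H" for h
    using that poly_over_1[OF H] poly_over_pCons[OF H that poly_over_0[OF H]] ev1
    unfolding R_def
    by (intro exI[of _ "[:h:]"] exI[of _ 1]) (auto simp: ev_def map_poly_pCons hom_on_0[OF H f])
  have Rx: "R x c"
    using poly_over_1[OF H] poly_over_pCons[OF H fs_0[OF H] poly_over_1[OF H]] ev1 f
    unfolding R_def
    by (intro exI[of _ "[:0,1:]"] exI[of _ 1])
       (auto simp: ev_def map_poly_pCons hom_on_0[OF H f] hom_on_def one_pCons)
  have RR: "R (y + y') (z + z') \<and> R (y * y') (z * z')" if R: "R y z" "R y' z'" for y y' z z'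
  proof -
    obtain p q where pq: "poly_over H p" "poly_over H q" "poly q x \<noteq> 0"
       "y = poly p x / poly q x" "z * ev q = ev p" using R(1) by (auto simp: R_def)
    obtain r s where rs: "poly_over H r" "poly_over H s" "poly s x \<noteq> 0"
       "y' = poly r x / poly s x" "z' * ev s = ev r" using R(2) by (auto simp: R_def)
    have "y + y' = poly (p * s + q * r) x / poly (q * s) x"
      "y * y' = poly (p * r) x / poly (q * s) x" "poly (q * s) x \<noteq> 0"
      using pq(3) rs(3) unfolding pq(4) rs(4) by (simp_all add: field_simps)
    moreover have o: "poly_over H (p * s + q * r)" "poly_over H (p * r)" "poly_over H (q * s)"
      "poly_over H (p * s)" "poly_over H (q * r)"
      using pq rs by (auto intro!: poly_over_mult poly_over_add H)
    moreover have "(z + z') * ev (q * s) = ev (p * s + q * r)" "(z * z') * ev (q * s) = ev (p * r)"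
      using pq rs o by (simp_all add: ev flip: pq(5) rs(5)) (simp_all add: algebra_simps)
    ultimately show ?thesis unfolding R_def by blast
  qed
  show ?thesis
  proof (rule that)
    show "hom_on (gen (insert x H)) g"
      unfolding hom_on_def
    proof (intro conjI ballI)
      show "g 1 = 1" using geq[OF Rh[OF fs_1[OF H]]] f by (simp add: hom_on_def)
    next
      fix y y' assume "y \<in> gen (insert x H)" "y' \<in> gen (insert x H)"
      then obtain z z' where "R y z" "R y' z'" using ex by blast
      then show "g (y + y') = g y + g y'" "g (y * y') = g y * g y'"
        using RR geq by metis+
    qed
  qed (use geq Rh Rx in auto)
qed

section \<open>Derivations and algebraic closure\<close>

text \<open>The dual numbers \<open>a + b * eps\<close> with \<open>eps\<close> of square 0. A map
  \<open>d\<close> is a derivation exactly when sending \<open>x\<close> to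
  \<open>Dual x (d x)\<close> is a ring homomorphism, so extending derivations reduces to
  \<open>hom_on_extend\<close>.\<close>

datatype 'a dual = Dual (re: 'a) (du: 'a)

instantiation dual :: (comm_ring_1) comm_ring_1
begin

definition "0 = Dual 0 0"
definition "1 = Dual 1 0"
definition "x + y = Dual (re x + re y) (du x + du y)"
definition "x - y = Dual (re x - re y) (du x - du y)"
definition "- x = Dual (- re x) (- du x)"
definition "x * y = Dual (re x * re y) (du x * re y + re x * du y)"

instance
  by standard (auto simp: zero_dual_def one_dual_def plus_dual_def minus_dual_def uminus_dual_def
      times_dual_def algebra_simps)

end

definition derivation :: "('a::comm_ring_1 \<Rightarrow> 'a) \<Rightarrow> bool" where
  "derivation d \<longleftrightarrow> (\<forall>x y. d (x + y) = d x + d y \<and> d (x * y) = d x * y + x * d y)"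

definition derivation_on :: "'a::comm_ring_1 set \<Rightarrow> ('a \<Rightarrow> 'a) \<Rightarrow> bool" where
  "derivation_on H d \<longleftrightarrow>
     (\<forall>x\<in>H. \<forall>y\<in>H. d (x + y) = d x + d y \<and> d (x * y) = d x * y + x * d y)"

lemma derivation_on_UNIV: "derivation_on UNIV d \<longleftrightarrow> derivation d"
  by (simp add: derivation_on_def derivation_def)

context
  fixes d :: "'a::field \<Rightarrow> 'a" and H
  assumes H: "field_set H" and d: "derivation_on H d"
begin

lemma der_on_0: "d 0 = 0"
  using d fs_0[OF H] unfolding derivation_on_def by (metis add_cancel_left_left)

lemma der_on_1: "d 1 = 0"
  using d fs_1[OF H] unfolding derivation_on_def by (metis add_cancel_left_left mult_1 mult_1_right)

lemma der_on_dual: "hom_on H (\<lambda>x. Dual x (d x))"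
  using d der_on_1 unfolding hom_on_def derivation_on_def
  by (auto simp: one_dual_def plus_dual_def times_dual_def)

text \<open>First-order Taylor expansion: the dual part is the formal derivative of
  \<open>p(x)\<close> when \<open>x\<close> is given the derivative \<open>y\<close>.\<close>

lemma map_dual_poly:
  assumes p: "poly_over H p"
  shows "poly (map_poly (\<lambda>x. Dual x (d x)) p) (Dual x y) =
    Dual (poly p x) (poly (map_poly d p) x + y * poly (pderiv p) x)"
proof -
  have z: "Dual 0 (d 0) = 0" by (simp add: der_on_0 zero_dual_def)
  show ?thesis using p
  proof (induction p)
    case 0
    then show ?case by (simp add: zero_dual_def)
  next
    case (pCons a p)
    have "poly_over H p" using pCons.prems by (auto simp: poly_over_def coeff_pCons split: nat.splits)
    then show ?case
      using pCons.IH z der_on_0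
      by (simp add: map_poly_pCons plus_dual_def times_dual_def pderiv_pCons algebra_simps)
  qed
qed

lemma derivation_extend_compat:
  assumes compat: "\<And>p. poly_over H p \<Longrightarrow> poly p x = 0 \<Longrightarrow> poly (map_poly d p) x + y * poly (pderiv p) x = 0"
  obtains d' where "derivation_on (gen (insert x H)) d'" "\<And>h. h \<in> H \<Longrightarrow> d' h = d h" "d' x = y"
proof -
  let ?f = "\<lambda>x. Dual x (d x)"
  have unit: "Dual a b dvd 1" if "a \<noteq> 0" for a b :: 'a
  proof
    show "1 = Dual a b * Dual (1 / a) (- b / a\<^sup>2)"
      using that by (simp add: one_dual_def times_dual_def power2_eq_square)
  qed
  obtain g where g: "hom_on (gen (insert x H)) g" "\<And>h. h \<in> H \<Longrightarrow> g h = ?f h" "g x = Dual x y"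
    by (rule hom_on_extend[OF H der_on_dual, of x "Dual x y"])
       (use compat unit in \<open>auto simp: map_dual_poly zero_dual_def\<close>)
  note G = gen_field_set[of "insert x H"]
  \<comment> \<open>The first component of \<open>g\<close> is the identity on \<open>H\<close> and
    at \<open>x\<close>, hence on the field they generate; multiplicativity of \<open>g\<close> then
    becomes the Leibniz rule for its second component.\<close>
  have re: "re (g z) = z" if z: "z \<in> gen (insert x H)" for z
  proof -
    let ?K = "{z \<in> gen (insert x H). re (g z) = z}"
    have "field_set ?K"
      unfolding field_set_def
    proof (intro conjI ballI)
      show "1 \<in> ?K" using g(1) fs_1[OF G] by (auto simp: hom_on_def one_dual_def)
    next
      fix u v assume "u \<in> ?K" "v \<in> ?K"
      then show "u - v \<in> ?K" "u * v \<in> ?K"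
        using hom_on_diff[OF G g(1)] g(1) fs_diff[OF G] fs_mult[OF G]
        by (auto simp: minus_dual_def hom_on_def times_dual_def)
    next
      fix u assume u: "u \<in> ?K"
      show "inverse u \<in> ?K"
      proof (cases "u = 0")
        case False
        have "g u * g (inverse u) = 1"
          using u g(1) fs_inverse[OF G, of u] False by (auto simp: hom_on_def) (metis right_inverse)
        then have "u * re (g (inverse u)) = 1"
          using u by (auto simp: times_dual_def one_dual_def)
        then show ?thesis using u fs_inverse[OF G, of u] by (auto dest: inverse_unique)
      qed (use u in auto)
    qed
    moreover have "insert x H \<subseteq> ?K" using g gen_superset[of "insert x H"] by auto
    ultimately show ?thesis using gen_least z by blast
  qed
  show ?thesis
  proof (rule that[of "\<lambda>z. du (g z)"])
    show "derivation_on (gen (insert x H)) (\<lambda>z. du (g z))"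
      using g(1) re by (auto simp: derivation_on_def hom_on_def plus_dual_def times_dual_def algebra_simps)
  qed (use g in auto)
qed

end

text \<open>Separability: the derivative of the minimal polynomial has smaller degree and, in
  characteristic 0, is not 0.\<close>

lemma pderiv_minimal_ne_0:
  fixes x :: "'a::field_char_0"
  assumes "field_set H" "poly_over H P" "degree P > 0"
    "\<And>q. poly_over H q \<Longrightarrow> poly q x = 0 \<Longrightarrow> degree q < degree P \<Longrightarrow> q = 0"
  shows "poly (pderiv P) x \<noteq> 0"
proof
  assume 0: "poly (pderiv P) x = 0"
  have "degree (pderiv P) < degree P" using assms(3) by (simp add: degree_pderiv)
  from assms(4)[OF poly_over_pderiv[OF assms(1,2)] 0 this] have "pderiv P = 0" .
  then show False using assms(3) by (simp add: pderiv_eq_0_iff)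
qed

lemma derivation_on_extend_one:
  fixes d :: "'a::field_char_0 \<Rightarrow> 'a"
  assumes H: "field_set H" and d: "derivation_on H d"
  obtains d' where "derivation_on (gen (insert x H)) d'" "\<And>h. h \<in> H \<Longrightarrow> d' h = d h"
    "\<not> algebraic_elt H x \<Longrightarrow> d' x = y"
proof (cases "algebraic_elt H x")
  case True
  obtain P where "minimal_poly H x P"
    by (rule minimal_poly_exists[OF H True])
  note P = minimal_polyD[OF this]
  have nz: "poly (pderiv P) x \<noteq> 0" by (rule pderiv_minimal_ne_0[OF H P(1,2,4)])
  \<comment> \<open>The only possible derivative of \<open>x\<close>, obtained by differentiating
    \<open>P(x) = 0\<close>.\<close>
  define c where "c = - poly (map_poly d P) x / poly (pderiv P) x"
  let ?f = "\<lambda>x. Dual x (d x)"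
  have "poly (map_poly d p) x + c * poly (pderiv p) x = 0" if p: "poly_over H p" "poly p x = 0" for p
  proof -
    obtain r where r: "poly_over H r" "p = P * r" using P(5)[OF p] by blast
    have "poly (map_poly ?f p) (Dual x c) = poly (map_poly ?f P) (Dual x c) * poly (map_poly ?f r) (Dual x c)"
      using hom_on_map_poly_mult[OF H der_on_dual[OF H d] P(1) r(1)] r(2) by simp
    also have "poly (map_poly ?f P) (Dual x c) = 0"
      using nz P(3) by (simp add: map_dual_poly[OF H d P(1)] zero_dual_def c_def)
    finally show ?thesis by (simp add: map_dual_poly[OF H d p(1)] zero_dual_def times_dual_def)
  qed
  from derivation_extend_compat[OF H d this] show ?thesis using that True by blast
next
  case False
  then have "poly (map_poly d p) x + y * poly (pderiv p) x = 0" if "poly_over H p" "poly p x = 0" for p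
    using that by (auto simp: algebraic_elt_def)
  from derivation_extend_compat[OF H d this] show ?thesis using that by metis
qed

text \<open>Zorn's lemma on graphs of derivations. With graphs, inclusion means extension, values
  outside the field are forgotten, and the union of a chain is its upper bound.\<close>

theorem derivation_extend:
  fixes d :: "'a::field_char_0 \<Rightarrow> 'a"
  assumes H: "field_set H" and d: "derivation_on H d"
  obtains d' where "derivation d'" "\<And>h. h \<in> H \<Longrightarrow> d' h = d h"
proof -
  define ok where "ok \<Gamma> \<longleftrightarrow> (\<exists>G e. field_set G \<and> derivation_on G e \<and> \<Gamma> = (\<lambda>x. (x, e x)) ` G)"
    for \<Gamma> :: "('a \<times> 'a) set"
  define \<Gamma>0 where "\<Gamma>0 = (\<lambda>x. (x, d x)) ` H"
  define A where "A = {\<Gamma>. ok \<Gamma> \<and> \<Gamma>0 \<subseteq> \<Gamma>}"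
  have "\<exists>M\<in>A. \<forall>Y\<in>A. M \<subseteq> Y \<longrightarrow> Y = M"
  proof (rule subset_Zorn_nonempty)
    show "A \<noteq> {}" using H d unfolding A_def ok_def \<Gamma>0_def by blast
  next
    fix C assume C: "C \<noteq> {}" "subset.chain A C"
    have chain: "V \<subseteq> Y \<or> Y \<subseteq> V" if "V \<in> C" "Y \<in> C" for V Y
      using C(2) that by (auto simp: subset.chain_def)
    have CA: "ok V" "\<Gamma>0 \<subseteq> V" if "V \<in> C" for V
      using C(2) that by (auto simp: subset.chain_def A_def)
    define G where "G = fst ` (\<Union>C)"
    define e where "e x = (THE y. (x, y) \<in> \<Union>C)" for x
    have sv: "y = z" if xyz: "(x, y) \<in> \<Union>C" "(x, z) \<in> \<Union>C" for x y z
    proof -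
      obtain V1 V2 where "V1 \<in> C" "V2 \<in> C" "(x, y) \<in> V1" "(x, z) \<in> V2" using xyz by blast
      then obtain V where "V \<in> C" "(x, y) \<in> V" "(x, z) \<in> V"
        using chain[of V1 V2] by (metis subsetD)
      then show ?thesis using CA(1)[of V] by (auto simp: ok_def)
    qed
    have e: "e x = y" if "(x, y) \<in> \<Union>C" for x y
      unfolding e_def by (rule the_equality) (use that sv in auto)
    have graph: "\<Union>C = (\<lambda>x. (x, e x)) ` G"
      unfolding G_def using e by force
    \<comment> \<open>Any two elements of the union lie in a single member of the chain, which
      settles all field and derivation laws.\<close>
    have two: "\<exists>K k. field_set K \<and> derivation_on K k \<and> K \<subseteq> G \<and> x \<in> K \<and> y \<in> K \<and> (\<forall>z\<in>K. e z = k z)"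
      if "x \<in> G" "y \<in> G" for x y
    proof -
      have "(x, e x) \<in> \<Union>C" "(y, e y) \<in> \<Union>C" using that graph by auto
      then obtain V1 V2 where "V1 \<in> C" "V2 \<in> C" "(x, e x) \<in> V1" "(y, e y) \<in> V2" by blast
      then obtain V where V: "V \<in> C" "(x, e x) \<in> V" "(y, e y) \<in> V"
        using chain[of V1 V2] by (metis subsetD)
      from CA(1)[OF V(1)] obtain K k where K: "field_set K" "derivation_on K k"
        "V = (\<lambda>x. (x, k x)) ` K" by (auto simp: ok_def)
      have "e z = k z \<and> z \<in> G" if "z \<in> K" for z
      proof -
        have "(z, k z) \<in> \<Union>C" using that K V by blast
        then show ?thesis using e by (force simp: G_def)
      qed
      then show ?thesis using K V by (intro exI[of _ K] exI[of _ k]) auto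
    qed
    have "field_set G"
      unfolding field_set_def
    proof (intro conjI ballI)
      obtain V where V: "V \<in> C" using C(1) by blast
      from CA(2)[OF V] have "H \<subseteq> G" unfolding \<Gamma>0_def G_def using V by force
      then show "1 \<in> G" using fs_1[OF H] by blast
    next
      fix x y assume "x \<in> G" "y \<in> G"
      from two[OF this] show "x - y \<in> G" "x * y \<in> G" using fs_diff fs_mult by blast+
    next
      fix x assume "x \<in> G"
      from two[OF this this] show "inverse x \<in> G" using fs_inverse by blast
    qed
    moreover have "derivation_on G e"
      unfolding derivation_on_def
    proof (intro ballI)
      fix x y assume "x \<in> G" "y \<in> G"
      from two[OF this] obtain K k where K: "field_set K" "derivation_on K k" "x \<in> K" "y \<in> K"
        "\<forall>z\<in>K. e z = k z" by blast
      then show "e (x + y) = e x + e y \<and> e (x * y) = e x * y + x * e y"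
        using fs_add[OF K(1,3,4)] fs_mult[OF K(1,3,4)] by (auto simp: derivation_on_def)
    qed
    ultimately have "ok (\<Union>C)" using graph by (auto simp: ok_def)
    moreover have "\<Gamma>0 \<subseteq> \<Union>C" using C(1) CA(2) by blast
    ultimately show "\<Union>C \<in> A" by (simp add: A_def)
  qed
  then obtain M where MA: "M \<in> A" and max: "\<forall>Y\<in>A. M \<subseteq> Y \<longrightarrow> Y = M" by blast
  then have M: "ok M" "\<Gamma>0 \<subseteq> M" by (simp_all add: A_def)
  have M3: "V = M" if "ok V" "M \<subseteq> V" for V
  proof -
    have "V \<in> A" using that M(2) by (simp add: A_def order_trans[of \<Gamma>0 M V])
    then show ?thesis using max that(2) by simp
  qed
  from M(1) obtain G e where G: "field_set G" "derivation_on G e" "M = (\<lambda>x. (x, e x)) ` G"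
    by (auto simp: ok_def)
  have "x \<in> G" for x
  proof -
    obtain e' where e': "derivation_on (gen (insert x G)) e'" "\<And>h. h \<in> G \<Longrightarrow> e' h = e h"
      using derivation_on_extend_one[OF G(1,2)] by metis
    let ?V = "(\<lambda>x. (x, e' x)) ` gen (insert x G)"
    have "ok ?V" using e' gen_field_set by (auto simp: ok_def)
    moreover have "M \<subseteq> ?V" using G(3) e'(2) gen_superset[of "insert x G"] by force
    ultimately have "?V = M" by (rule M3)
    then show ?thesis using gen_superset[of "insert x G"] G(3) by force
  qed
  then have "G = UNIV" by auto
  show ?thesis
  proof (rule that)
    show "derivation e" using G(2) \<open>G = UNIV\<close> by (simp add: derivation_on_UNIV)
    show "e h = d h" if "h \<in> H" for h using M(2) that G(3) by (auto simp: \<Gamma>0_def)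
  qed
qed

section \<open>Calculus of a derivation, and the closure operator defined by derivations\<close>

context
  fixes d :: "'a::field \<Rightarrow> 'a"
  assumes d: "derivation d"
begin

lemma der_add: "d (x + y) = d x + d y"
  and der_mult: "d (x * y) = d x * y + x * d y"
  using d by (auto simp: derivation_def)

lemma der_0: "d 0 = 0"
  using der_add by (metis add_cancel_left_left)

lemma der_1: "d 1 = 0"
  using der_mult by (metis add_cancel_left_left mult_1 mult_1_right)

lemma der_uminus: "d (- x) = - d x"
  using der_add[of x "- x"] der_0 by (simp add: eq_neg_iff_add_eq_0 add.commute)

lemma der_diff: "d (x - y) = d x - d y"
  using der_add[of x "- y"] der_uminus by simp

lemma der_sum: "d (sum f A) = (\<Sum>i\<in>A. d (f i))"
  by (induction A rule: infinite_finite_induct) (auto simp: der_0 der_add)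

lemma der_of_nat: "d (of_nat n) = 0"
  by (induction n) (auto simp: der_0 der_1 der_add)

lemma der_of_int: "d (of_int n) = 0"
  by (cases n) (simp_all only: of_int_of_nat_eq of_int_minus der_of_nat der_uminus minus_zero)

lemma der_power: "d (x ^ n) = of_nat n * x ^ (n - 1) * d x"
proof (induction n)
  case (Suc n)
  then show ?case by (cases n) (auto simp: der_mult algebra_simps)
qed (simp add: der_1)

lemma der_inverse: "d (inverse x) = - d x / x\<^sup>2"
proof (cases "x = 0")
  case False
  then have "d x * inverse x + x * d (inverse x) = 0"
    using der_mult[of x "inverse x"] der_1 by simp
  then have "x * d (inverse x) = - (d x * inverse x)" by (simp add: eq_neg_iff_add_eq_0 add.commute)
  then have "inverse x * (x * d (inverse x)) = - (inverse x * d x * inverse x)" by simp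
  then show ?thesis using False by (simp add: field_simps power2_eq_square)
qed (simp add: der_0)

lemma der_divide:
  assumes "y \<noteq> 0"
  shows "d (x / y) = (d x * y - x * d y) / y\<^sup>2"
proof -
  have "d (x / y) = (d x - x / y * d y) / y"
    using der_mult[of "x / y" y] assms by (simp add: eq_divide_eq)
  also have "\<dots> = (d x * y - x * d y) / y\<^sup>2"
    using assms by (simp add: field_split_simps power2_eq_square)
  finally show ?thesis .
qed

lemma der_poly: "d (poly p x) = poly (map_poly d p) x + poly (pderiv p) x * d x"
  by (induction p) (auto simp: der_0 der_add der_mult map_poly_pCons pderiv_pCons algebra_simps)

lemma field_set_kernel: "field_set {x. d x = 0}"
  unfolding field_set_def by (auto simp: der_1 der_diff der_mult der_inverse)

lemma field_set_derivation_closed: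
  assumes "field_set H"
  shows "field_set {x \<in> H. d x \<in> H}"
proof -
  have "d (inverse x) = - d x * inverse x * inverse x" for x
    unfolding der_inverse power2_eq_square divide_inverse inverse_mult_distrib by (simp only: mult.assoc)
  then show ?thesis
    using assms unfolding field_set_def
    by (auto simp: der_1 der_diff der_mult fs_0[OF assms] intro!: fs_add[OF assms] fs_mult[OF assms]
        fs_inverse[OF assms] fs_uminus[OF assms] fs_diff[OF assms])
qed

lemma gen_derivation_closed:
  assumes "\<And>a. a \<in> A \<Longrightarrow> d a \<in> gen A" "x \<in> gen A"
  shows "d x \<in> gen A"
proof -
  have "A \<subseteq> {x \<in> gen A. d x \<in> gen A}" using assms(1) gen_superset[of A] by auto
  from gen_least[OF field_set_derivation_closed[OF gen_field_set] this] show ?thesis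
    using assms(2) by auto
qed

end

text \<open>The relative algebraic closure of the field generated by \<open>A\<close>, by
  \<open>cl_eq_algebraic\<close>. Written as a common kernel of derivations it is a field and a
  closure operator without any work on polynomials.\<close>

definition cl :: "'a::field set \<Rightarrow> 'a set" where
  "cl A = {x. \<forall>d. derivation d \<longrightarrow> (\<forall>a\<in>A. d a = 0) \<longrightarrow> d x = 0}"

lemma clD: "x \<in> cl A \<Longrightarrow> derivation d \<Longrightarrow> (\<And>a. a \<in> A \<Longrightarrow> d a = 0) \<Longrightarrow> d x = 0"
  by (auto simp: cl_def)

lemma cl_superset: "A \<subseteq> cl A"
  by (auto simp: cl_def)

lemma cl_mono: "A \<subseteq> B \<Longrightarrow> cl A \<subseteq> cl B"
  unfolding cl_def by blast

lemma cl_cl [simp]: "cl (cl A) = cl A"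
  unfolding cl_def by blast

lemma cl_minimal: "A \<subseteq> cl B \<Longrightarrow> cl A \<subseteq> cl B"
  using cl_mono[of A "cl B"] by simp

lemma field_set_cl: "field_set (cl A)"
proof -
  have "cl A = \<Inter>{{x. d x = 0} |d. derivation d \<and> (\<forall>a\<in>A. d a = 0)}"
    unfolding cl_def by blast
  moreover have "field_set S" if "S \<in> {{x. d x = 0} |d. derivation d \<and> (\<forall>a\<in>A. d a = 0)}" for S
    using that field_set_kernel by blast
  ultimately show ?thesis unfolding field_set_def by auto
qed

lemma field_set_closed: "cl A = A \<Longrightarrow> field_set A"
  using field_set_cl[of A] by simp

lemma gen_subset_cl: "gen A \<subseteq> cl A"
  by (rule gen_least[OF field_set_cl cl_superset])

lemma cl_gen [simp]: "cl (gen A) = cl A"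
  by (simp add: cl_minimal cl_mono gen_subset_cl gen_superset subset_antisym)

lemma derivation_commutator:
  fixes d e :: "'a::field \<Rightarrow> 'a"
  assumes "derivation d" "derivation e"
  shows "derivation (\<lambda>x. d (e x) - e (d x))"
proof -
  note a = der_add[OF assms(1)] der_mult[OF assms(1)] der_add[OF assms(2)] der_mult[OF assms(2)]
  have "d (e (x + y)) - e (d (x + y)) = d (e x) - e (d x) + (d (e y) - e (d y))"
    "d (e (x * y)) - e (d (x * y)) = (d (e x) - e (d x)) * y + x * (d (e y) - e (d y))" for x y
    unfolding a by (simp_all add: ring_distribs)
  then show ?thesis unfolding derivation_def by blast
qed

text \<open>The commutator of \<open>D\<close> with a derivation killing \<open>A\<close> again kills \<open>A\<close>.\<close>
lemma cl_derivation_closed: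
  assumes D: "derivation D" and A: "\<And>a. a \<in> A \<Longrightarrow> D a \<in> cl A" and x: "x \<in> cl A"
  shows "D x \<in> cl A"
  unfolding cl_def
proof (intro CollectI allI impI)
  fix d assume d: "derivation d" "\<forall>a\<in>A. d a = 0"
  have "d (D x) - D (d x) = 0"
    by (rule clD[OF x derivation_commutator[OF d(1) D]])
       (use d clD[OF A d(1)] der_0[OF D] in auto)
  moreover have "d x = 0" using clD[OF x d(1)] d(2) by auto
  ultimately show "d (D x) = 0" using der_0[OF D] by simp
qed

text \<open>Differentiating the minimal polynomial relation leaves only
  \<open>P'(x) * d x = 0\<close>, and \<open>x\<close> is a simple root.\<close>

lemma derivation_algebraic_0:
  fixes d :: "'a::field_char_0 \<Rightarrow> 'a"
  assumes H: "field_set H" and d: "derivation d" "\<And>h. h \<in> H \<Longrightarrow> d h = 0" and x: "algebraic_elt H x"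
  shows "d x = 0"
proof -
  obtain P where "minimal_poly H x P"
    by (rule minimal_poly_exists[OF H x])
  note P = minimal_polyD[OF this]
  have "map_poly d P = 0"
    using P(1) d by (intro poly_eqI) (auto simp: coeff_map_poly poly_over_def der_0[OF d(1)])
  then have "poly (pderiv P) x * d x = 0"
    using der_poly[OF d(1), of P x] P(3) der_0[OF d(1)] by simp
  then show ?thesis using pderiv_minimal_ne_0[OF H P(1,2,4)] by simp
qed

text \<open>The partial derivative with respect to \<open>x\<close>, extended from
  \<open>H(x)\<close> to the whole field.\<close>

lemma derivation_transcendental:
  fixes x :: "'a::field_char_0"
  assumes H: "field_set H" and x: "\<not> algebraic_elt H x"
  obtains d where "derivation d" "\<And>h. h \<in> H \<Longrightarrow> d h = 0" "d x = 1"
proof -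
  have "derivation_on H (\<lambda>_. 0)" by (auto simp: derivation_on_def)
  then obtain d1 where d1: "derivation_on (gen (insert x H)) d1" "\<And>h. h \<in> H \<Longrightarrow> d1 h = 0" "d1 x = 1"
    using derivation_on_extend_one[OF H, of "\<lambda>_. 0" x 1] x by metis
  then obtain d where "derivation d" "\<And>h. h \<in> gen (insert x H) \<Longrightarrow> d h = d1 h"
    using derivation_extend[OF gen_field_set d1(1)] by metis
  then show ?thesis using that[of d] d1 gen_superset[of "insert x H"]
    by (metis insert_subset subsetD)
qed

text \<open>A transcendental element is kept out of \<open>cl H\<close> by a derivation that kills
  \<open>H\<close> and takes the value 1 there; on algebraic elements every such derivation
  vanishes.\<close>

lemma cl_eq_algebraic:
  fixes H :: "'a::field_char_0 set"
  assumes H: "field_set H"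
  shows "cl H = {x. algebraic_elt H x}"
proof (intro Set.set_eqI iffI)
  fix x assume "x \<in> cl H"
  then show "x \<in> {x. algebraic_elt H x}"
    using derivation_transcendental[OF H, of x] clD[of x H] by (metis mem_Collect_eq zero_neq_one)
next
  fix x assume "x \<in> {x. algebraic_elt H x}"
  then show "x \<in> cl H" unfolding cl_def using derivation_algebraic_0[OF H] by blast
qed

lemma closed_derivation:
  fixes x :: "'a::field_char_0"
  assumes "x \<notin> cl A"
  obtains d where "derivation d" "\<And>a. a \<in> cl A \<Longrightarrow> d a = 0" "d x = 1"
proof -
  have "\<not> algebraic_elt (cl A) x" using cl_eq_algebraic[OF field_set_cl, of A] assms by auto
  then show ?thesis using derivation_transcendental[OF field_set_cl] that by metis
qed

text \<open>A multiple of a derivation that kills \<open>cl A\<close> and is 1 at \<open>x\<close>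
  corrects the value at \<open>x\<close>. New logarithms are made in this way: an element outside a
  closed field can be given any derivative.\<close>

lemma derivation_redefine:
  fixes x :: "'a::field_char_0"
  assumes D: "derivation D" and x: "x \<notin> cl A"
  obtains D' where "derivation D'" "\<And>a. a \<in> cl A \<Longrightarrow> D' a = D a" "D' x = y"
proof -
  obtain d where d: "derivation d" "\<And>a. a \<in> cl A \<Longrightarrow> d a = 0" "d x = 1"
    using closed_derivation[OF x] by metis
  show ?thesis
    by (rule that[of "\<lambda>z. D z + (y - D x) * d z"])
       (use D d in \<open>auto simp: derivation_def algebra_simps\<close>)
qed

text \<open>Only the finitely many coefficients of an annihilating polynomial matter. Needed because
  towers are algebraically closed, while a series embedding reaches just finitely many algebraic
  elements.\<close>

lemma cl_finite_character:
  fixes x :: "'a::field_char_0"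
  assumes "x \<in> cl A"
  obtains B where "finite B" "B \<subseteq> A" "x \<in> cl B"
proof -
  let ?S = "{y. \<exists>B. finite B \<and> B \<subseteq> A \<and> y \<in> gen B}"
  have two: "\<exists>B. finite B \<and> B \<subseteq> A \<and> y \<in> gen B \<and> z \<in> gen B" if yz: "y \<in> ?S" "z \<in> ?S" for y z
  proof -
    from yz obtain B C where "finite B" "B \<subseteq> A" "y \<in> gen B" "finite C" "C \<subseteq> A" "z \<in> gen C" by blast
    then show ?thesis
      using gen_mono[of B "B \<union> C"] gen_mono[of C "B \<union> C"] by (intro exI[of _ "B \<union> C"]) auto
  qed
  have "field_set ?S"
    unfolding field_set_def
  proof (intro conjI ballI)
    show "1 \<in> ?S" using fs_1[OF gen_field_set[of "{}"]] by auto
  next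
    fix y z assume "y \<in> ?S" "z \<in> ?S"
    from two[OF this] obtain B where B: "finite B" "B \<subseteq> A" "y \<in> gen B" "z \<in> gen B" by blast
    then show "y - z \<in> ?S" "y * z \<in> ?S"
      using fs_diff[OF gen_field_set B(3,4)] fs_mult[OF gen_field_set B(3,4)] by auto
  next
    fix y assume "y \<in> ?S"
    then show "inverse y \<in> ?S" by (auto dest: fs_inverse[OF gen_field_set])
  qed
  moreover have "A \<subseteq> ?S"
  proof
    fix a assume "a \<in> A"
    then show "a \<in> ?S" using gen_superset[of "{a}"] by (intro CollectI exI[of _ "{a}"]) auto
  qed
  ultimately have S: "gen A \<subseteq> ?S" by (rule gen_least)
  have "algebraic_elt (gen A) x"
    using assms cl_eq_algebraic[OF gen_field_set, of A] by simp
  then obtain p where p: "poly_over (gen A) p" "p \<noteq> 0" "poly p x = 0" by (auto simp: algebraic_elt_def)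
  have "\<forall>i. \<exists>B. finite B \<and> B \<subseteq> A \<and> coeff p i \<in> gen B"
    using p(1) S unfolding poly_over_def by blast
  then obtain B where B: "\<And>i. finite (B i)" "\<And>i. B i \<subseteq> A" "\<And>i. coeff p i \<in> gen (B i)" by metis
  let ?B = "\<Union>i\<le>degree p. B i"
  have "coeff p i \<in> gen ?B" for i
  proof (cases "i \<le> degree p")
    case True
    then show ?thesis using B(3)[of i] gen_mono[of "B i" ?B] by blast
  next
    case False
    then show ?thesis using fs_0[OF gen_field_set] by (simp add: coeff_eq_0)
  qed
  then have "algebraic_elt (gen ?B) x" using p by (auto simp: algebraic_elt_def poly_over_def)
  then have "x \<in> cl ?B" using cl_eq_algebraic[OF gen_field_set, of ?B] by simp
  then show ?thesis by (rule that[rotated 2]) (use B in auto)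
qed

section \<open>Traces, norms and constants for elements algebraic over a differential field\<close>

context
  fixes d :: "'a::field_char_0 \<Rightarrow> 'a" and H :: "'a set" and x :: 'a
  assumes d: "derivation d" and H: "field_set H" and dH: "\<And>h. h \<in> H \<Longrightarrow> d h \<in> H"
    and x: "algebraic_elt H x"
begin

text \<open>A trace argument. Since \<open>P\<close> is monic, differentiating
  \<open>P(x) = 0\<close> gives a relation of lower degree, which is therefore identically 0. Its
  coefficient of degree \<open>degree P - 1\<close> says that the trace of \<open>x\<close>, divided
  by the degree, has the same derivative as \<open>x\<close>.\<close>

lemma algebraic_antiderivative:
  assumes "d x \<in> H"
  obtains b where "b \<in> H" "d b = d x"
proof -
  obtain P where "minimal_poly H x P"
    by (rule minimal_poly_exists[OF H x])
  note P = minimal_polyD[OF this]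
  define q where "q = map_poly d P + smult (d x) (pderiv P)"
  have "poly_over H q" unfolding q_def
    by (intro poly_over_add poly_over_smult poly_over_map poly_over_pderiv H P assms dH der_0 d)
  moreover have "poly q x = 0" using der_poly[OF d, of P x] P(3) der_0[OF d] by (simp add: q_def mult.commute)
  moreover have "degree q < degree P"
  proof -
    have "coeff q i = 0" if "i > degree P - 1" for i
    proof (cases "i = degree P")
      case True
      then show ?thesis using P(6) der_1[OF d] der_0[OF d]
        by (simp add: q_def coeff_map_poly coeff_pderiv coeff_eq_0)
    next
      case False
      then have "i > degree P" using that P(2) by linarith
      then show ?thesis using der_0[OF d] by (simp add: q_def coeff_map_poly coeff_pderiv coeff_eq_0)
    qed
    then have "degree q \<le> degree P - 1" by (intro degree_le) auto
    then show ?thesis using P(2) by linarith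
  qed
  ultimately have "q = 0" by (rule P(4))
  then have "coeff q (degree P - 1) = 0" by simp
  then have "d (coeff P (degree P - 1)) + d x * of_nat (degree P) = 0"
    using P(6,2) der_0[OF d] by (simp add: q_def coeff_map_poly coeff_pderiv)
  moreover define b where "b = - coeff P (degree P - 1) / of_nat (degree P)"
  ultimately have "d b = d x" "b \<in> H"
    using P(1,2) by (auto simp: der_divide[OF d] der_uminus[OF d] der_of_nat[OF d] power2_eq_square
        poly_over_def add_eq_0_iff2 intro!: fs_divide H fs_of_nat fs_uminus)
  then show ?thesis using that by blast
qed

text \<open>A norm argument. The subtracted multiple of \<open>P\<close> cancels the top
  coefficient, so the relation \<open>q\<close> vanishes identically. The constant coefficient of
  \<open>P\<close>, up to sign the norm of \<open>x\<close>, is then an exponential for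
  \<open>n * g\<close> with \<open>n\<close> the degree.\<close>

lemma algebraic_exponential:
  assumes g: "g \<in> H" "d x = g * x" and x0: "x \<noteq> 0"
  obtains n a where "n > 0" "a \<in> H" "a \<noteq> 0" "d a = of_nat n * g * a"
proof -
  obtain P where "minimal_poly H x P"
    by (rule minimal_poly_exists[OF H x])
  note P = minimal_polyD[OF this]
  define q where "q = map_poly d P + smult g (pCons 0 (pderiv P)) - smult (of_nat (degree P) * g) P"
  have "poly_over H q" unfolding q_def
    by (intro poly_over_add poly_over_diff poly_over_smult poly_over_map poly_over_pderiv poly_over_pCons
        H P dH der_0 d fs_mult fs_of_nat fs_0 g)
  moreover have "poly q x = 0" using der_poly[OF d, of P x] P(3) der_0[OF d] g(2)
    by (simp add: q_def mult_ac)
  moreover have "degree q < degree P"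
  proof -
    have "coeff q i = 0" if "i > degree P - 1" for i
    proof (cases "i = degree P")
      case True
      then obtain j where j: "degree P = Suc j" using P(2) gr0_implies_Suc by blast
      then show ?thesis using True P(6) der_1[OF d] der_0[OF d]
        by (simp add: q_def coeff_map_poly coeff_pderiv coeff_eq_0)
    next
      case False
      then have i: "i > degree P" using that P(2) by linarith
      then obtain j where "i = Suc j" using gr0_implies_Suc by (metis less_nat_zero_code neq0_conv)
      then show ?thesis using i der_0[OF d]
        by (simp add: q_def coeff_map_poly coeff_pderiv coeff_eq_0)
    qed
    then have "degree q \<le> degree P - 1" by (intro degree_le) auto
    then show ?thesis using P(2) by linarith
  qed
  ultimately have "q = 0" by (rule P(4))
  then have "coeff q 0 = 0" by simp
  then have 1: "d (coeff P 0) = of_nat (degree P) * g * coeff P 0"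
    using der_0[OF d] by (simp add: q_def coeff_map_poly)
  \<comment> \<open>If it were 0, the factor \<open>X\<close> could be split off \<open>P\<close>,
    against minimality, because \<open>x\<close> is not 0.\<close>
  have "coeff P 0 \<noteq> 0"
  proof
    assume "coeff P 0 = 0"
    then obtain R where R: "P = pCons 0 R" by (metis coeff_pCons_0 pCons_cases)
    then have "R \<noteq> 0" using P(2) by auto
    then have "degree R < degree P" "poly R x = 0" using R P(3) x0 by auto
    moreover have "poly_over H R"
      using P(1) R unfolding poly_over_def by (metis coeff_pCons_Suc)
    ultimately show False using P(4) \<open>R \<noteq> 0\<close> by blast
  qed
  then show ?thesis using that 1 P(1,2) by (auto simp: poly_over_def)
qed

text \<open>Differentiating the coefficients of the minimal polynomial of a constant gives a
  relation of lower degree, so these coefficients are themselves constants.\<close>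

lemma algebraic_constant:
  assumes "d x = 0"
  shows "x \<in> cl {h \<in> H. d h = 0}"
proof -
  obtain P where "minimal_poly H x P"
    by (rule minimal_poly_exists[OF H x])
  note P = minimal_polyD[OF this]
  have "poly_over H (map_poly d P)"
    by (intro poly_over_map H P dH der_0 d)
  moreover have "poly (map_poly d P) x = 0" using der_poly[OF d, of P x] P(3) der_0[OF d] assms by simp
  moreover have "degree (map_poly d P) < degree P"
  proof -
    have "coeff (map_poly d P) i = 0" if "i > degree P - 1" for i
    proof (cases "i = degree P")
      case True
      then show ?thesis using P(6) der_1[OF d] der_0[OF d] by (simp add: coeff_map_poly)
    next
      case False
      then have "i > degree P" using that P(2) by linarith
      then show ?thesis using der_0[OF d] by (simp add: coeff_map_poly coeff_eq_0)
    qed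
    then have "degree (map_poly d P) \<le> degree P - 1" by (intro degree_le) auto
    then show ?thesis using P(2) by linarith
  qed
  ultimately have "map_poly d P = 0" by (rule P(4))
  then have "d (coeff P i) = 0" for i
    using der_0[OF d] by (metis coeff_0 coeff_map_poly)
  then have "poly_over (gen {h \<in> H. d h = 0}) P"
    using P(1) gen_superset[of "{h \<in> H. d h = 0}"] by (auto simp: poly_over_def)
  moreover have "P \<noteq> 0" using P(2) by auto
  ultimately have "algebraic_elt (gen {h \<in> H. d h = 0}) x"
    using P(3) by (auto simp: algebraic_elt_def)
  then show ?thesis using cl_eq_algebraic[OF gen_field_set, of "{h \<in> H. d h = 0}"] by simp
qed

end

text \<open>If \<open>a + Y * R(Y)\<close> is the minimal polynomial of \<open>y = q(x)\<close>,
  then the inverse of \<open>y\<close> is \<open>- R(y) / a\<close>, again a polynomial in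
  \<open>x\<close>.\<close>

lemma algebraic_poly_inverse:
  fixes x :: "'a::field_char_0"
  assumes H: "field_set H" and x: "algebraic_elt H x" and q: "poly_over H q" "poly q x \<noteq> 0"
  obtains r where "poly_over H r" "poly q x * poly r x = 1"
proof -
  define y where "y = poly q x"
  have "x \<in> cl H" using x cl_eq_algebraic[OF H] by simp
  then have "y \<in> cl H"
    unfolding y_def using q(1) cl_superset[of H]
    by (intro poly_over_eval field_set_cl) (auto simp: poly_over_def)
  then have y: "algebraic_elt H y" using cl_eq_algebraic[OF H] by simp
  obtain P where "minimal_poly H y P"
    by (rule minimal_poly_exists[OF H y])
  note P = minimal_polyD[OF this]
  obtain a R where R: "P = pCons a R" by (cases P)
  then have R0: "R \<noteq> 0" using P(2) by auto
  have oR: "poly_over H R" "a \<in> H" using P(1) R unfolding poly_over_def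
    by (metis coeff_pCons_Suc) (metis P(1) R coeff_pCons_0 poly_over_def)
  have e: "a + y * poly R y = 0" using P(3) R by simp
  have "a \<noteq> 0"
  proof
    assume "a = 0"
    then have "poly R y = 0" using e q(2) by (simp add: y_def)
    then show False using P(4)[OF oR(1)] R R0 by simp
  qed
  have "poly_over H (pcompose R q)"
    using oR(1)
  proof (induction R)
    case (pCons b R)
    then have "poly_over H R" "b \<in> H"
      by (metis coeff_pCons_Suc poly_over_def, metis coeff_pCons_0 poly_over_def)
    then show ?case using pCons.IH
      by (auto simp: pcompose_pCons intro!: poly_over_add poly_over_mult poly_over_pCons poly_over_0 H q)
  qed (simp add: poly_over_0 H)
  then have "poly_over H (smult (- inverse a) (pcompose R q))"
    using oR(2) by (intro poly_over_smult H fs_uminus fs_inverse)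
  moreover have "poly q x * poly (smult (- inverse a) (pcompose R q)) x = 1"
  proof -
    have "y * poly R y = - a" using e by (simp add: add_eq_0_iff)
    then show ?thesis using \<open>a \<noteq> 0\<close> by (simp add: poly_pcompose flip: y_def) (simp add: field_simps)
  qed
  ultimately show ?thesis using that by blast
qed

section \<open>Newton--Puiseux\<close>

unbundle fps_syntax

text \<open>Multiply a Bezout identity for the power \<open>m\<close> by one for the linear factor
  itself, which exists since \<open>h - h(a)\<close> is divisible by \<open>X - a\<close>.\<close>

lemma bezout_power_linear:
  fixes h :: "'a::field poly"
  assumes "poly h a \<noteq> 0"
  shows "\<exists>s t. s * [:- a, 1:] ^ m + t * h = 1"
proof (induction m)
  case 0
  show ?case by (intro exI[of _ 1] exI[of _ 0]) simp
next
  case (Suc m)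
  define L where "L = [:- a, 1:]"
  have "L dvd h - [:poly h a:]" by (simp add: L_def poly_eq_0_iff_dvd[symmetric])
  then obtain r where r: "h - [:poly h a:] = L * r" by (auto elim: dvdE)
  define c where "c = [:inverse (poly h a):]"
  have "c * h - c * [:poly h a:] = c * (L * r)"
    by (simp only: r[symmetric] right_diff_distrib)
  moreover have "c * [:poly h a:] = 1" using assms by (simp add: c_def one_pCons)
  ultimately have 1: "- (c * r) * L + c * h = 1" by (simp add: algebra_simps)
  from Suc obtain s t where 2: "s * L ^ m + t * h = 1" unfolding L_def by blast
  have "(s * L ^ m + t * h) * (- (c * r) * L + c * h) = 1"
    unfolding 1 2 by simp
  then have "(s * - (c * r)) * L ^ Suc m + (t * (- (c * r) * L + c * h) + s * L ^ m * c) * h = 1"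
    by (simp only: ring_distribs power_Suc mult_ac add_ac)
  then have "\<exists>s t. s * L ^ Suc m + t * h = 1" by blast
  then show ?case unfolding L_def .
qed

text \<open>The cofactor \<open>t * R\<close> of \<open>h\<close> is reduced modulo
  \<open>g\<close>; comparing degrees then bounds the other cofactor.\<close>

lemma bezout_degree:
  fixes g h R :: "'a::field poly"
  assumes "s * g + t * h = 1" "g \<noteq> 0" "h \<noteq> 0" "degree g > 0" "degree h > 0" "degree R < degree g + degree h"
  shows "\<exists>A B. degree A < degree g \<and> degree B < degree h \<and> g * B + h * A = R"
proof -
  define A where "A = (t * R) mod g"
  have dA: "degree A < degree g" unfolding A_def using degree_mod_less'[of g "t * R"] assms(2,4) by force
  have "g dvd R - h * A"
  proof -
    have "R - h * A = (s * g + t * h) * R - h * (t * R - g * (t * R div g))"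
      using assms(1) by (simp add: A_def minus_mult_div_eq_mod)
    also have "\<dots> = g * (s * R + h * (t * R div g))" by (simp add: algebra_simps)
    finally show ?thesis by simp
  qed
  then obtain B where B: "R - h * A = g * B" by (auto elim: dvdE)
  have "degree B < degree h"
  proof (cases "B = 0")
    case False
    have "degree (h * A) < degree g + degree h"
      using degree_mult_le[of h A] dA by linarith
    then have "degree (g * B) < degree g + degree h"
      unfolding B[symmetric] using assms(6) by (intro degree_diff_less) auto
    then show ?thesis using False assms(2) by (simp add: degree_mult_eq)
  qed (use assms in simp)
  moreover have "g * B + h * A = R" using B by (simp add: algebra_simps)
  ultimately show ?thesis using dA by blast
qed

text \<open>Hensel lifting, with \<open>Q j\<close> the coefficient of the \<open>j\<close>-th power
  of the series variable. At order \<open>j\<close> the new unknowns enter only through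
  \<open>g * H j + h * G j\<close>, which Bezout solves in small degrees; so only \<open>G 0\<close>
  and \<open>H 0\<close> carry the full degrees.\<close>

lemma hensel_series:
  fixes Q :: "nat \<Rightarrow> 'a::field poly"
  assumes bez: "s * g + t * h = 1" and gh: "g \<noteq> 0" "h \<noteq> 0" "degree g > 0" "degree h > 0" "Q 0 = g * h"
    and Q: "\<And>j. j > 0 \<Longrightarrow> degree (Q j) < degree g + degree h"
  obtains G H where "G 0 = g" "H 0 = h" "\<And>j. j > 0 \<Longrightarrow> degree (G j) < degree g"
    "\<And>j. j > 0 \<Longrightarrow> degree (H j) < degree h" "\<And>j. Q j = (\<Sum>i\<le>j. G i * H (j - i))"
proof -
  \<comment> \<open>What earlier choices leave over of the equation at order \<open>j\<close>; the
    indices 0 and \<open>j\<close> are left out because they carry the unknowns.\<close>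
  define R where "R F j = Q j - (\<Sum>i\<in>{1..<j}. fst (F i) * snd (F (j - i)))" for F :: "nat \<Rightarrow> 'a poly \<times> 'a poly" and j
  define \<Phi> where "\<Phi> F j = (if j = 0 then (g, h) else
    SOME AB. degree (fst AB) < degree g \<and> degree (snd AB) < degree h \<and> g * snd AB + h * fst AB = R F j)" for F j
  define F where "F = wfrec less_than \<Phi>"
  \<comment> \<open>The choice at \<open>j\<close> depends only on values below \<open>j\<close>, so
    the recursion is well founded.\<close>
  have "adm_wf less_than \<Phi>"
    unfolding adm_wf_def
  proof (intro allI impI)
    fix F1 F2 :: "nat \<Rightarrow> 'a poly \<times> 'a poly" and j assume "\<forall>z. (z, j) \<in> less_than \<longrightarrow> F1 z = F2 z"
    then have "R F1 j = R F2 j" unfolding R_def by (auto intro!: sum.cong)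
    then show "\<Phi> F1 j = \<Phi> F2 j" unfolding \<Phi>_def by simp
  qed
  from wfrec_fixpoint[OF wf_less_than this] have F: "F = \<Phi> F" unfolding F_def .
  have F0: "F 0 = (g, h)" by (subst F) (simp add: \<Phi>_def)
  have step: "degree (fst (F j)) < degree g \<and> degree (snd (F j)) < degree h \<and> g * snd (F j) + h * fst (F j) = R F j"
    if "j > 0" for j
    using that
  proof (induction j rule: less_induct)
    case (less j)
    have "degree (fst (F i) * snd (F (j - i))) < degree g + degree h" if "i \<in> {1..<j}" for i
    proof -
      have "degree (fst (F i)) < degree g" "degree (snd (F (j - i))) < degree h"
        using less.IH[of i] less.IH[of "j - i"] that by auto
      then show ?thesis using degree_mult_le[of "fst (F i)" "snd (F (j - i))"] by linarith
    qed
    then have "degree (\<Sum>i\<in>{1..<j}. fst (F i) * snd (F (j - i))) < degree g + degree h"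
      using gh by (intro degree_sum_less) auto
    then have dR: "degree (R F j) < degree g + degree h"
      unfolding R_def using Q[OF less.prems] by (intro degree_diff_less)
    let ?P = "\<lambda>AB. degree (fst AB) < degree g \<and> degree (snd AB) < degree h \<and> g * snd AB + h * fst AB = R F j"
    from bezout_degree[OF bez gh(1-4) dR] obtain A B where "?P (A, B)" by auto
    then have "?P (SOME AB. ?P AB)" by (rule someI)
    moreover have "F j = (SOME AB. ?P AB)" using less.prems by (subst F) (simp add: \<Phi>_def)
    ultimately show ?case by simp
  qed
  show ?thesis
  proof (rule that[of "\<lambda>j. fst (F j)" "\<lambda>j. snd (F j)"])
    fix j
    show "Q j = (\<Sum>i\<le>j. fst (F i) * snd (F (j - i)))"
    proof (cases "j = 0")
      case True
      then show ?thesis using gh(5) F0 by simp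
    next
      case False
      then have "{..j} = insert 0 (insert j {1..<j})" by auto
      then have "(\<Sum>i\<le>j. fst (F i) * snd (F (j - i))) =
         g * snd (F j) + (fst (F j) * h + (\<Sum>i\<in>{1..<j}. fst (F i) * snd (F (j - i))))"
        using False F0 by simp
      also have "\<dots> = Q j" using step[of j] False by (simp add: R_def algebra_simps)
      finally show ?thesis ..
    qed
  qed (use F0 step in auto)
qed

lemma hensel:
  fixes q :: "'a::field fps poly"
  assumes q: "lead_coeff q = 1" "map_poly (\<lambda>f. f $ 0) q = g * h"
    and gh: "lead_coeff g = 1" "lead_coeff h = 1" "degree g > 0" "degree h > 0" and bez: "s * g + t * h = 1"
  obtains G H where "q = G * H" "lead_coeff G = 1" "degree G = degree g"
proof -
  define Q where "Q j = map_poly (\<lambda>f. f $ j) q" for j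
  have nz: "g \<noteq> 0" "h \<noteq> 0" using gh by auto
  have dq: "degree q = degree g + degree h"
  proof -
    have "coeff (Q 0) (degree q) = 1" using q(1) by (simp add: Q_def coeff_map_poly)
    then have "degree (Q 0) \<ge> degree q" by (intro le_degree) auto
    moreover have "degree (Q 0) \<le> degree q" unfolding Q_def by (rule map_poly_degree_leq)
    ultimately show ?thesis using q(2) nz by (simp add: Q_def degree_mult_eq)
  qed
  have Qj: "degree (Q j) < degree g + degree h" if "j > 0" for j
  proof -
    have "coeff (Q j) i = 0" if "i \<ge> degree q" for i
      using that q(1) \<open>j > 0\<close> by (cases "i = degree q") (auto simp: Q_def coeff_map_poly coeff_eq_0)
    then show ?thesis using dq gh by (intro degree_lessI) auto
  qed
  have Q0: "Q 0 = g * h" using q(2) by (simp add: Q_def)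
  obtain G H where GH: "G 0 = g" "H 0 = h" "\<And>j. j > 0 \<Longrightarrow> degree (G j) < degree g"
    "\<And>j. j > 0 \<Longrightarrow> degree (H j) < degree h" "\<And>j. Q j = (\<Sum>i\<le>j. G i * H (j - i))"
    using hensel_series[of s g t h Q, OF bez nz gh(3,4) Q0 Qj] by metis
  \<comment> \<open>Turns a sequence of polynomials of degree at most \<open>m\<close> into one
    polynomial with power series coefficients.\<close>
  define U where "U F m = (\<Sum>i\<le>m. monom (Abs_fps (\<lambda>j. coeff (F j) i)) i)"
    for F :: "nat \<Rightarrow> 'a poly" and m :: nat
  have U: "coeff (U F m) i $ j = coeff (F j) i" if "\<And>j. degree (F j) \<le> m" for F m i j
  proof -
    have "coeff (U F m) i = (if i \<le> m then Abs_fps (\<lambda>j. coeff (F j) i) else 0)"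
      by (simp add: U_def coeff_sum)
    then show ?thesis using that[of j] by (auto simp: coeff_eq_0)
  qed
  have dG: "degree (G j) \<le> degree g" "degree (H j) \<le> degree h" for j
    using GH(1,2) GH(3)[of j] GH(4)[of j] by (cases "j = 0"; force)+
  note UG = U[OF dG(1)] and UH = U[OF dG(2)]
  have "q = U G (degree g) * U H (degree h)"
  proof (rule poly_eqI, rule fps_ext)
    fix i j
    have "coeff (U G (degree g) * U H (degree h)) i $ j =
       (\<Sum>a\<le>i. \<Sum>b=0..j. coeff (G b) a * coeff (H (j - b)) (i - a))"
      by (simp add: coeff_mult fps_sum_nth fps_mult_nth UG UH)
    also have "\<dots> = (\<Sum>b=0..j. \<Sum>a\<le>i. coeff (G b) a * coeff (H (j - b)) (i - a))"
      by (rule sum.swap)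
    also have "\<dots> = coeff (Q j) i"
      by (simp add: GH(5) coeff_sum coeff_mult atMost_atLeast0)
    also have "\<dots> = coeff q i $ j" by (simp add: Q_def coeff_map_poly)
    finally show "coeff q i $ j = coeff (U G (degree g) * U H (degree h)) i $ j" ..
  qed
  moreover have lc: "coeff (U G (degree g)) (degree g) = 1"
  proof (rule fps_ext)
    fix j show "coeff (U G (degree g)) (degree g) $ j = 1 $ j"
      using GH(1) GH(3)[of j] gh(1) by (cases "j = 0") (auto simp: UG coeff_eq_0)
  qed
  moreover have "degree (U G (degree g)) = degree g"
  proof (rule antisym)
    have "coeff (U G (degree g)) i = 0" if "i > degree g" for i
    proof (rule fps_ext)
      fix j show "coeff (U G (degree g)) i $ j = 0 $ j"
        using that dG(1)[of j] by (simp add: UG coeff_eq_0)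
    qed
    then show "degree (U G (degree g)) \<le> degree g" by (intro degree_le) auto
    show "degree g \<le> degree (U G (degree g))" using lc by (intro le_degree) simp
  qed
  ultimately show ?thesis using that by metis
qed

text \<open>Serves to remove the second highest coefficient by a translation, and to read it off in
  a power of a linear polynomial.\<close>

lemma coeff_pcompose_shift:
  fixes p :: "'a::field poly"
  assumes "degree p \<le> Suc n"
  shows "coeff (pcompose p [:b, 1:]) (Suc n) = coeff p (Suc n) \<and>
    coeff (pcompose p [:b, 1:]) n = coeff p n + of_nat (Suc n) * b * coeff p (Suc n)"
  using assms
proof (induction p arbitrary: n)
  case (pCons a p)
  let ?P = "pcompose p [:b, 1:]"
  have e: "coeff (pcompose (pCons a p) [:b, 1:]) i = (if i = 0 then a else 0) + b * coeff ?P i + (case i of 0 \<Rightarrow> 0 | Suc j \<Rightarrow> coeff ?P j)" for i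
    by (auto simp: pcompose_pCons coeff_pCons split: nat.splits)
  have d: "degree p \<le> n" using pCons.prems pCons.hyps by (auto split: if_splits)
  then have z: "coeff ?P (Suc n) = 0" "coeff p (Suc n) = 0"
    using degree_pcompose_le[of p "[:b, 1:]"] by (auto intro!: coeff_eq_0)
  show ?case
  proof (cases n)
    case 0
    then obtain c where "p = [:c:]" using d by (metis degree_eq_zeroE le_zero_eq)
    then show ?thesis using 0 by (simp add: pcompose_pCons)
  next
    case (Suc m)
    have "degree p \<le> Suc m" using d Suc by simp
    from pCons.IH[OF this] show ?thesis using z Suc unfolding e by (simp add: algebra_simps)
  qed
qed simp

lemma pcompose_monom_1: "pcompose (monom 1 n) q = (q :: 'a::comm_ring_1 poly) ^ n"
  by (induction n) (simp_all add: monom_Suc pcompose_pCons pcompose_1)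

lemma fls_compose_power_compose:
  "k > 0 \<Longrightarrow> l > 0 \<Longrightarrow> fls_compose_power (fls_compose_power f k) l = fls_compose_power f (k * l)"
  by (rule fls_eqI) (auto simp: fls_nth_compose_power dvd_def mult.commute)

lemma hom_on_compose_power: "k > 0 \<Longrightarrow> hom_on H (\<lambda>f :: 'a::field fls. fls_compose_power f k)"
  by (auto simp: hom_on_def)

lemma fls_subdegree_compose_power:
  "k > 0 \<Longrightarrow> fls_subdegree (fls_compose_power f k) = int k * fls_subdegree f"
proof (cases "f = 0")
  case False
  assume k: "k > 0"
  show ?thesis
  proof (rule fls_subdegree_eqI)
    show "fls_compose_power f k $$ (int k * fls_subdegree f) \<noteq> 0"
      using k False by (simp add: fls_nth_compose_power)
    fix n assume n: "n < int k * fls_subdegree f"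
    have "f $$ j = 0" if "n = int k * j" for j
      using n k that by (intro fls_eq0_below_subdegree) simp
    then show "fls_compose_power f k $$ n = 0"
      using k by (auto simp: fls_nth_compose_power dvd_def)
  qed
qed simp

text \<open>Substituting \<open>t ^ k\<close> for the series variable \<open>t\<close> replaces the
  adjunction of a \<open>k\<close>-th root of \<open>t\<close>. Induction on the degree: after a
  translation and a rescaling the reduction at \<open>t = 0\<close> splits into coprime factors, and
  Hensel lifting leads to a factor of smaller degree.\<close>

theorem newton_puiseux:
  fixes p :: "'a::{alg_closed_field, field_char_0} fls poly"
  assumes "lead_coeff p = 1" "degree p > 0"
  shows "\<exists>k>0. \<exists>s. poly (map_poly (\<lambda>f. fls_compose_power f k) p) s = 0"
  using assms
proof (induction "degree p" arbitrary: p rule: less_induct)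
  case (less p)
  let ?S = "\<lambda>k f. fls_compose_power f k"
  let ?M = "\<lambda>k. map_poly (?S k)"
  have U: "field_set (UNIV :: 'a fls set)" by (simp add: field_set_def)
  have Mmult: "?M k (f * g) = ?M k f * ?M k g" if "k > 0" for k and f g :: "'a fls poly"
    using hom_on_map_poly_mult[OF U hom_on_compose_power[OF that]] by (simp add: poly_over_def)
  have Madd: "?M k (f + g) = ?M k f + ?M k g" for k and f g :: "'a fls poly"
    by (rule poly_eqI) (simp add: coeff_map_poly)
  have Mcomp: "?M k (pcompose f g) = pcompose (?M k f) (?M k g)" if "k > 0" for k and f g :: "'a fls poly"
    by (induction f) (simp_all add: map_poly_pCons pcompose_pCons Madd Mmult[OF that])
  have MM: "?M l (?M k f) = ?M (k * l) f" if "k > 0" "l > 0" for k l and f :: "'a fls poly"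
    by (rule poly_eqI) (simp add: coeff_map_poly fls_compose_power_compose that)
  define n where "n = degree p"
  have n: "n > 0" using less.prems by (simp add: n_def)
  \<comment> \<open>The translation that makes the coefficient of degree \<open>n - 1\<close>
    vanish.\<close>
  define b where "b = - coeff p (n - 1) / of_nat n"
  define p1 where "p1 = pcompose p [:b, 1:]"
  have dp1: "degree p1 = n" by (simp add: p1_def n_def degree_pcompose)
  have p1n: "coeff p1 n = 1" "coeff p1 (n - 1) = 0"
    using coeff_pcompose_shift[of p "n - 1" b] n less.prems(1) by (simp_all add: p1_def n_def[symmetric] b_def)
  have p_from_p1: "\<exists>k>0. \<exists>s. poly (?M k p) s = 0" if k: "k > 0" and s: "poly (?M k p1) s = 0" for k s
  proof -
    have "?M k p1 = pcompose (?M k p) [:?S k b, 1:]"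
      by (simp add: p1_def Mcomp[OF k] map_poly_pCons k)
    then have "poly (?M k p) (?S k b + s) = 0" using s by (simp add: poly_pcompose)
    then show ?thesis using k by blast
  qed
  \<comment> \<open>If there are no nonzero lower coefficients, \<open>p1\<close> is a pure power
    and 0 is a root.\<close>
  define I where "I = {i. i < n \<and> coeff p1 i \<noteq> 0}"
  show ?case
  proof (cases "I = {}")
    case True
    then have "coeff p1 0 = 0" using n by (auto simp: I_def)
    then have "poly (?M 1 p1) 0 = 0" by (simp add: poly_0_coeff_0 coeff_map_poly)
    then show ?thesis using p_from_p1[of 1] by simp
  next
    case False
    define v where "v i = fls_subdegree (coeff p1 i)" for i
    \<comment> \<open>Slopes of the Newton polygon seen from its vertex of degree \<open>n\<close>;
      the least one is attained at \<open>i0\<close>.\<close>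
    define \<mu> where "\<mu> i = (of_int (v i) / of_nat (n - i) :: rat)" for i
    have "finite I" by (simp add: I_def)
    then obtain i0 where i0: "i0 \<in> I" "\<And>i. i \<in> I \<Longrightarrow> \<mu> i0 \<le> \<mu> i"
      using False by (metis arg_min_if_finite(1) arg_min_if_finite(2) not_le)
    \<comment> \<open>The least slope is \<open>c / k\<close>. After substituting
      \<open>t ^ k\<close> it becomes the integer \<open>c\<close>, so that the unknown can be
      rescaled by \<open>t ^ c\<close>.\<close>
    define k where "k = n - i0"
    define c where "c = v i0"
    have k: "k > 0" using i0(1) by (auto simp: k_def I_def)
    have cmp: "c * int (n - i) \<le> v i * int k" if "i \<in> I" for i
    proof -
      have "of_int c / of_nat k \<le> (of_int (v i) / of_nat (n - i) :: rat)"
        using i0(2)[OF that] by (simp add: \<mu>_def c_def k_def)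
      moreover have "n - i > 0" using that by (auto simp: I_def)
      ultimately have "of_int c * of_nat (n - i) \<le> (of_int (v i) * of_nat k :: rat)"
        using k by (simp add: pos_divide_le_eq pos_le_divide_eq mult.commute divide_simps)
      then have "of_int (c * int (n - i)) \<le> (of_int (v i * int k) :: rat)" by simp
      then show ?thesis by (simp only: of_int_le_iff)
    qed
    define \<tau> :: "'a fls" where "\<tau> = fls_X_intpow c"
    \<comment> \<open>Monic again. By the choice of the slope its coefficients have nonnegative
      order, and the one at \<open>i0\<close> has order exactly 0.\<close>
    define q where "q = smult (fls_X_intpow (- (int n * c))) (pcompose (?M k p1) [:0, \<tau>:])"
    have cq: "coeff q i = fls_X_intpow (c * (int i - int n)) * ?S k (coeff p1 i)" for i
      by (simp add: q_def coeff_pcompose_linear coeff_map_poly \<tau>_def fls_X_intpow_power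
          flip: mult.assoc) (simp add: fls_shifted_times_simps algebra_simps)
    have S0: "?S k f = 0 \<longleftrightarrow> f = 0" for f :: "'a fls"
      using hom_on_eq_0_iff[OF U hom_on_compose_power[OF k]] by simp
    have sq: "fls_subdegree (coeff q i) = c * (int i - int n) + int k * v i" if "coeff p1 i \<noteq> 0" for i
      using that k
      by (subst cq, subst fls_subdegree_mult) (auto simp: fls_subdegree_compose_power v_def S0)
    have regular: "fls_subdegree (coeff q i) \<ge> 0" for i
    proof (cases "i \<in> I")
      case True
      then have "c * int (n - i) \<le> v i * int k" "i < n" "coeff p1 i \<noteq> 0" using cmp by (auto simp: I_def)
      then show ?thesis by (simp add: sq of_nat_diff algebra_simps)
    next
      case False
      then consider "i = n" | "coeff p1 i = 0" using dp1 by (auto simp: I_def) (metis coeff_eq_0 linorder_neqE_nat)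
      then show ?thesis
      proof cases
        case 1
        then show ?thesis using k by (simp add: cq p1n)
      next
        case 2
        then show ?thesis by (simp add: cq)
      qed
    qed
    have qn: "coeff q n = 1" "coeff q (n - 1) = 0" using k p1n by (simp_all add: cq)
    have dq: "degree q = n"
    proof (rule antisym)
      have "coeff q i = 0" if "i > n" for i using that dp1 by (simp add: cq coeff_eq_0)
      then show "degree q \<le> n" by (intro degree_le) auto
      show "n \<le> degree q" using qn by (intro le_degree) simp
    qed
    define q0 where "q0 = map_poly fls_regpart q"
    have cq0: "fps_to_fls (coeff q0 i) = coeff q i" for i
      using regular[of i] by (simp add: q0_def coeff_map_poly fls_regpart_to_fls_trivial)
    have q0: "q = map_poly fps_to_fls q0" by (rule poly_eqI) (simp add: coeff_map_poly cq0)
    have dq0: "degree q0 = n"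
      unfolding q0 using dq by (metis cq0 degree_map_poly fps_to_fls_eq_0_iff q0)
    have lq0: "lead_coeff q0 = 1" using cq0[of n] qn dq0 by (metis fps_one_to_fls fps_to_fls_eq_iff)
    define r where "r = map_poly (\<lambda>f. f $ 0) q0"
    have cr: "coeff r i = coeff q i $$ 0" for i
      by (simp add: r_def coeff_map_poly flip: cq0)
    have rn: "coeff r n = 1" "coeff r (n - 1) = 0" using qn n by (simp_all add: cr)
    have dr: "degree r = n"
    proof (rule antisym)
      show "degree r \<le> n" using dq0 unfolding r_def by (metis map_poly_degree_leq)
      show "n \<le> degree r" using rn by (intro le_degree) simp
    qed
    have ri0: "coeff r i0 \<noteq> 0"
    proof -
      have p: "coeff p1 i0 \<noteq> 0" "i0 < n" using i0 by (auto simp: I_def)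
      then have "fls_subdegree (coeff q i0) = 0"
        unfolding sq[OF p(1)] by (simp add: c_def[symmetric] k_def of_nat_diff algebra_simps)
      moreover have "coeff q i0 \<noteq> 0" using p k by (simp add: cq S0)
      ultimately show ?thesis unfolding cr by (metis nth_fls_subdegree_nonzero)
    qed
    obtain a where a: "poly r a = 0" using alg_closed_imp_poly_has_root[of r] dr n by auto
    have r0: "r \<noteq> 0" using rn by auto
    define m where "m = order a r"
    define g where "g = [:- a, 1:] ^ m"
    obtain h where h: "r = g * h" "\<not> [:- a, 1:] dvd h"
      using order_decomp[OF r0, of a] unfolding m_def g_def by blast
    have ha: "poly h a \<noteq> 0" using h(2) by (simp add: poly_eq_0_iff_dvd)
    have m0: "m > 0" using a r0 by (simp add: m_def order_gt_0_iff)
    have g: "lead_coeff g = 1" "degree g = m"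
      unfolding g_def lead_coeff_power by (simp_all add: degree_power_eq)
    then have lh: "lead_coeff h = 1" using rn dr h(1) by (metis lead_coeff_mult mult_1)
    have dh: "degree g + degree h = n"
      using h(1) dr r0 by (metis degree_mult_eq mult_zero_left mult_zero_right)
    \<comment> \<open>If \<open>a\<close> were the only root, \<open>r\<close> would be
      \<open>(X - a) ^ n\<close>; its vanishing coefficient of degree \<open>n - 1\<close> forces
      \<open>a = 0\<close>, against the nonzero coefficient at \<open>i0 < n\<close>.\<close>
    have "degree h > 0"
    proof (rule ccontr)
      assume "\<not> degree h > 0"
      then have "h = 1" using lh by (metis degree_eq_zeroE gr0I lead_coeff_pCons(2) one_pCons)
      then have re: "r = pcompose (monom 1 n) [:- a, 1:]" "m = n"
        using h(1) g dh by (simp_all add: g_def pcompose_monom_1)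
      have "coeff r (n - 1) = coeff (monom 1 n) (n - 1) + of_nat n * (- a)"
        using coeff_pcompose_shift[of "monom 1 n" "n - 1" "- a"] n unfolding re(1)
        by (simp add: degree_monom_eq)
      then have "a = 0" using rn n by (simp split: if_splits)
      then have "r = monom 1 n" using re by (simp add: pcompose_monom_1 monom_altdef)
      then show False using ri0 i0(1) by (auto simp: I_def)
    qed
    obtain s t where "s * g + t * h = 1" using bezout_power_linear[OF ha] unfolding g_def by blast
    then obtain G H where GH: "q0 = G * H" "lead_coeff G = 1" "degree G = m"
      using hensel[OF lq0 _ g(1) lh, of s t] h(1) g(2) m0 \<open>degree h > 0\<close> unfolding r_def by metis
    let ?G = "map_poly fps_to_fls G"
    have dG: "degree ?G = m" using GH(3) by (simp add: degree_map_poly)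
    have lG: "lead_coeff ?G = 1" using GH by (simp add: dG coeff_map_poly)
    have "degree ?G < degree p" using dG dh g(2) \<open>degree h > 0\<close> by (simp add: n_def[symmetric])
    from less.hyps[OF this lG] m0 dG obtain l s where l: "l > 0" "poly (?M l ?G) s = 0" by auto
    have fps_to_fls_sum: "fps_to_fls (sum f A) = (\<Sum>i\<in>A. fps_to_fls (f i))"
      for f :: "nat \<Rightarrow> 'a fps" and A
      by (induction A rule: infinite_finite_induct) auto
    have "q = ?G * map_poly fps_to_fls H"
      unfolding q0 GH(1)
      by (rule poly_eqI) (simp add: coeff_map_poly coeff_mult fls_times_fps_to_fls fps_to_fls_sum)
    then have "poly (?M l q) s = 0" using l by (simp add: Mmult)
    moreover have "?M l q = smult (?S l (fls_X_intpow (- (int n * c)))) (pcompose (?M (k * l) p1) [:0, ?S l \<tau>:])"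
    proof -
      have "?M l q = smult (?S l (fls_X_intpow (- (int n * c)))) (?M l (pcompose (?M k p1) [:0, \<tau>:]))"
        unfolding q_def by (rule poly_eqI) (simp add: coeff_map_poly)
      then show ?thesis by (simp only: Mcomp[OF l(1)] MM[OF k l(1)]) (simp add: map_poly_pCons)
    qed
    moreover have "?S l (fls_X_intpow (- (int n * c))) \<noteq> (0 :: 'a fls)"
      using l(1) by (simp add: fls_shift_eq0_iff)
    ultimately have "poly (?M (k * l) p1) (s * ?S l \<tau>) = 0" by (simp add: poly_pcompose mult.commute)
    then show ?thesis using p_from_p1[of "k * l"] k l(1) by simp
  qed
qed

section \<open>Derivations of Laurent series fields\<close>

lemma hom_on_poly:
  fixes f :: "'a::field \<Rightarrow> 'b::comm_ring_1"
  assumes "field_set H" "hom_on H f" "poly_over H p" "x \<in> H"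
  shows "f (poly p x) = poly (map_poly f p) (f x)"
proof -
  note f0 = hom_on_0[OF assms(1,2)]
  show ?thesis using assms(3)
  proof (induction p)
    case (pCons a p)
    have "poly_over H p" "a \<in> H"
      using pCons.prems by (metis coeff_pCons_Suc poly_over_def, metis coeff_pCons_0 poly_over_def)
    then show ?case
      using pCons.IH assms f0 poly_over_eval[OF assms(1) _ assms(4)] fs_mult[OF assms(1)]
      by (auto simp: map_poly_pCons hom_on_def)
  qed (simp add: f0)
qed

lemma hom_on_extend_transcendental:
  fixes f :: "'a::field \<Rightarrow> 'b::field"
  assumes H: "field_set H" and f: "hom_on H f"
    and x: "\<not> algebraic_elt H x" and c: "\<not> algebraic_elt (f ` H) c"
  obtains g where "hom_on (gen (insert x H)) g" "\<And>h. h \<in> H \<Longrightarrow> g h = f h" "g x = c"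
proof (rule hom_on_extend[OF H f, of x c])
  fix p assume p: "poly_over H p"
  show "poly (map_poly f p) c = 0" if "poly p x = 0"
    using that p x by (auto simp: algebraic_elt_def)
  show "poly (map_poly f p) c dvd 1" if "poly p x \<noteq> 0"
  proof -
    have "coeff p (degree p) \<noteq> 0" using that by auto
    then have "coeff (map_poly f p) (degree p) \<noteq> 0"
      using p hom_on_eq_0_iff[OF H f] by (simp add: coeff_map_poly hom_on_0[OF H f] poly_over_def)
    then have "map_poly f p \<noteq> 0" by (metis coeff_0)
    moreover have "poly_over (f ` H) (map_poly f p)"
      using p by (simp add: poly_over_def coeff_map_poly hom_on_0[OF H f])
    ultimately have "poly (map_poly f p) c \<noteq> 0" using c by (auto simp: algebraic_elt_def)
    then show ?thesis by (simp add: dvd_field_iff)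
  qed
qed (use that in blast)

text \<open>A nonzero polynomial value at \<open>x\<close> has an inverse which is again polynomial
  in \<open>x\<close>, so its image is a unit.\<close>

lemma hom_on_extend_algebraic:
  fixes f :: "'a::field_char_0 \<Rightarrow> 'b::field"
  assumes H: "field_set H" and f: "hom_on H f"
    and P: "minimal_poly H x P" and c: "poly (map_poly f P) c = 0"
  obtains g where "hom_on (gen (insert x H)) g" "\<And>h. h \<in> H \<Longrightarrow> g h = f h" "g x = c"
proof (rule hom_on_extend[OF H f, of x c])
  note PD = minimal_polyD[OF P]
  have zero: "poly (map_poly f p) c = 0" if p: "poly_over H p" "poly p x = 0" for p
  proof -
    obtain r where r: "poly_over H r" "p = P * r" using PD(5)[OF p] by blast
    then show ?thesis using c by (simp add: hom_on_map_poly_mult[OF H f PD(1) r(1)])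
  qed
  fix p assume p: "poly_over H p"
  show "poly (map_poly f p) c = 0" if "poly p x = 0" by (rule zero[OF p that])
  show "poly (map_poly f p) c dvd 1" if p0: "poly p x \<noteq> 0"
  proof -
    have "P \<noteq> 0" using PD(2) by auto
    then have "algebraic_elt H x" using PD(1,3) by (auto simp: algebraic_elt_def)
    then obtain r where r: "poly_over H r" "poly p x * poly r x = 1"
      using algebraic_poly_inverse[OF H _ p p0] by blast
    have o: "poly_over H (p * r)" "poly_over H 1" using poly_over_mult[OF H p r(1)] poly_over_1[OF H] .
    have "poly (map_poly f (p * r - 1)) c = 0"
      using r by (intro zero poly_over_diff[OF H o]) simp
    then have "poly (map_poly f p) c * poly (map_poly f r) c = 1"
      using f by (simp add: hom_on_map_poly_diff[OF H f o] hom_on_map_poly_mult[OF H f p r(1)] hom_on_def)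
    then show ?thesis by (metis dvd_triv_left)
  qed
qed (use that in blast)

text \<open>The elements with both properties form a subfield, so checking generators is
  enough.\<close>

lemma hom_on_derivation_commute:
  fixes g :: "'a::field \<Rightarrow> 'b::field"
  assumes D: "derivation D" and E: "derivation E" and g: "hom_on (gen A) g"
    and A: "\<And>a. a \<in> A \<Longrightarrow> D a \<in> gen A \<and> g (D a) = E (g a)" and y: "y \<in> gen A"
  shows "D y \<in> gen A \<and> g (D y) = E (g y)"
proof -
  note G = gen_field_set[of A]
  let ?S = "{y \<in> gen A. D y \<in> gen A \<and> g (D y) = E (g y)}"
  have hom: "g (x + y) = g x + g y" "g (x * y) = g x * g y" if "x \<in> gen A" "y \<in> gen A" for x y
    using g that by (auto simp: hom_on_def)
  have "field_set ?S"
    unfolding field_set_def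
  proof (intro conjI ballI)
    show "1 \<in> ?S" using g fs_0[OF G] fs_1[OF G]
      by (auto simp: der_1[OF D] der_1[OF E] hom_on_def hom_on_0[OF G g])
  next
    fix u v assume u: "u \<in> ?S" and v: "v \<in> ?S"
    show "u - v \<in> ?S"
      using u v by (auto simp: der_diff[OF D] der_diff[OF E] hom_on_diff[OF G g] intro: fs_diff[OF G])
    have "g (D (u * v)) = E (g (u * v))"
      using u v by (simp add: der_mult[OF D] der_mult[OF E] hom fs_mult[OF G])
    then show "u * v \<in> ?S"
      using u v by (auto simp: der_mult[OF D] intro!: fs_add[OF G] fs_mult[OF G])
  next
    fix u assume u: "u \<in> ?S"
    have "D (inverse u) = - (D u / (u * u))" "E (inverse (g u)) = - (E (g u) / (g u * g u))"
      by (simp_all add: der_inverse[OF D] der_inverse[OF E] power2_eq_square)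
    moreover have "D u / (u * u) \<in> gen A" "u * u \<in> gen A"
      using u by (auto intro!: fs_divide[OF G] fs_mult[OF G])
    ultimately have "D (inverse u) \<in> gen A" "g (D (inverse u)) = E (g (inverse u))"
      using u fs_uminus[OF G, of "D u / (u * u)"]
      by (auto simp: hom_on_uminus[OF G g] hom_on_inverse[OF G g] hom_on_divide[OF G g] hom)
    then show "inverse u \<in> ?S" using u fs_inverse[OF G] by auto
  qed
  moreover have "A \<subseteq> ?S" using A gen_superset[of A] by auto
  ultimately show ?thesis using gen_least y by blast
qed

text \<open>Derivations extend uniquely to algebraic elements: \<open>D x\<close> and
  \<open>E (g x)\<close> are given by the same expression in the minimal polynomial and in its
  image.\<close>

lemma hom_on_derivation_commute_algebraic:
  fixes g :: "'a::field_char_0 \<Rightarrow> 'b::field"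
  assumes D: "derivation D" and E: "derivation E" and H: "field_set H"
    and DH: "\<And>h. h \<in> H \<Longrightarrow> D h \<in> H \<and> g (D h) = E (g h)"
    and g: "hom_on (gen (insert x H)) g" and x: "algebraic_elt H x" and y: "y \<in> gen (insert x H)"
  shows "D y \<in> gen (insert x H) \<and> g (D y) = E (g y)"
proof (rule hom_on_derivation_commute[OF D E g _ y])
  let ?G = "gen (insert x H)"
  note G = gen_field_set[of "insert x H"]
  have sub: "H \<subseteq> ?G" "x \<in> ?G" using gen_superset[of "insert x H"] by auto
  obtain P where "minimal_poly H x P" by (rule minimal_poly_exists[OF H x])
  note P = minimal_polyD[OF this]
  have nz: "poly (pderiv P) x \<noteq> 0" by (rule pderiv_minimal_ne_0[OF H P(1,2,4)])
  have oG: "poly_over ?G p" if "poly_over H p" for p using that sub by (auto simp: poly_over_def)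
  have o: "poly_over H (map_poly D P)" "poly_over H (pderiv P)"
    using DH by (auto intro!: poly_over_map[OF H P(1)] poly_over_pderiv[OF H P(1)] der_0[OF D])
  have Dx: "D x = - (poly (map_poly D P) x / poly (pderiv P) x)"
  proof -
    have "poly (map_poly D P) x + poly (pderiv P) x * D x = 0"
      using der_poly[OF D, of P x] P(3) der_0[OF D] by simp
    then have "poly (pderiv P) x * D x = - poly (map_poly D P) x" by (simp add: eq_neg_iff_add_eq_0 add.commute)
    then show ?thesis using nz by (simp add: field_simps)
  qed
  have m: "poly (map_poly D P) x \<in> ?G" "poly (pderiv P) x \<in> ?G"
    using poly_over_eval[OF G oG[OF o(1)] sub(2)] poly_over_eval[OF G oG[OF o(2)] sub(2)] .
  have DxG: "D x \<in> ?G" unfolding Dx by (intro fs_uminus[OF G] fs_divide[OF G] m)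
  have g0: "g 0 = 0" by (rule hom_on_0[OF G g])
  have mp: "poly (map_poly g P) (g x) = 0"
    using hom_on_poly[OF G g oG[OF P(1)] sub(2)] P(3) g0 by simp
  have e1: "map_poly E (map_poly g P) = map_poly g (map_poly D P)"
    using P(1) DH by (intro poly_eqI)
      (simp add: coeff_map_poly g0 der_0[OF D] der_0[OF E] poly_over_def)
  have gn: "g (of_nat n) = of_nat n" for n
  proof (induction n)
    case (Suc n)
    then show ?case using g fs_1[OF G] fs_of_nat[OF G, of n] by (simp add: hom_on_def)
  qed (simp add: g0)
  have e2: "pderiv (map_poly g P) = map_poly g (pderiv P)"
  proof (rule poly_eqI)
    fix n
    have "g (of_nat (Suc n) * coeff P (Suc n)) = of_nat (Suc n) * g (coeff P (Suc n))"
      using g fs_of_nat[OF G, of "Suc n"] oG[OF P(1)] gn[of "Suc n"]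
      by (simp add: hom_on_def poly_over_def del: of_nat_Suc)
    then show "coeff (pderiv (map_poly g P)) n = coeff (map_poly g (pderiv P)) n"
      by (simp add: coeff_pderiv coeff_map_poly g0 del: of_nat_Suc)
  qed
  have "poly (map_poly E (map_poly g P)) (g x) + poly (pderiv (map_poly g P)) (g x) * E (g x) = 0"
    using der_poly[OF E, of "map_poly g P" "g x"] mp der_0[OF E] by simp
  then have "g (poly (map_poly D P) x) + g (poly (pderiv P) x) * E (g x) = 0"
    by (simp add: e1 e2 hom_on_poly[OF G g oG[OF o(1)] sub(2)] hom_on_poly[OF G g oG[OF o(2)] sub(2)])
  then have "g (poly (pderiv P) x) * E (g x) = - g (poly (map_poly D P) x)"
    by (simp add: eq_neg_iff_add_eq_0 add.commute)
  moreover have "g (poly (pderiv P) x) \<noteq> 0" using nz hom_on_eq_0_iff[OF G g m(2)] by simp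
  ultimately have "E (g x) = - (g (poly (map_poly D P) x) / g (poly (pderiv P) x))"
    by (simp add: field_simps)
  then have "g (D x) = E (g x)"
    unfolding Dx using m
    by (simp add: hom_on_uminus[OF G g fs_divide[OF G]] hom_on_divide[OF G g])
  then show "D a \<in> ?G \<and> g (D a) = E (g a)" if "a \<in> insert x H" for a
    using that DH sub DxG by auto
qed

text \<open>A lower bound for the order that the series 0 satisfies for every \<open>a\<close>,
  whereas \<open>fls_subdegree 0 = 0\<close>.\<close>

definition vanishes_below :: "int \<Rightarrow> 'a::zero fls \<Rightarrow> bool" where
  "vanishes_below a f \<longleftrightarrow> (\<forall>n<a. f $$ n = 0)"

text \<open>The convolution may run over any range containing all nonzero products, so the bounds
  need not be sharp.\<close>

lemma fls_times_nth_bounds: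
  fixes f g :: "'a::comm_ring_1 fls"
  assumes "vanishes_below a f" "vanishes_below b g"
  shows "(f * g) $$ n = (\<Sum>i=a..n - b. f $$ i * g $$ (n - i))"
proof (cases "f = 0 \<or> g = 0")
  case False
  then have le: "a \<le> fls_subdegree f" "b \<le> fls_subdegree g"
    using assms by (auto simp: vanishes_below_def intro: fls_subdegree_geI)
  have "(f * g) $$ n = (\<Sum>i=fls_subdegree f..n - fls_subdegree g. f $$ i * g $$ (n - i))"
    by (rule fls_times_nth)
  also have "\<dots> = (\<Sum>i=a..n - b. f $$ i * g $$ (n - i))"
  proof (rule sum.mono_neutral_left)
    show "\<forall>i\<in>{a..n - b} - {fls_subdegree f..n - fls_subdegree g}. f $$ i * g $$ (n - i) = 0"
    proof
      fix i assume "i \<in> {a..n - b} - {fls_subdegree f..n - fls_subdegree g}"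
      then have "i < fls_subdegree f \<or> n - i < fls_subdegree g" by auto
      then show "f $$ i * g $$ (n - i) = 0" by (auto simp: fls_eq0_below_subdegree)
    qed
  qed (use le in auto)
  finally show ?thesis .
qed auto

lemma vanishes_below_mult:
  fixes f g :: "'a::comm_ring_1 fls"
  shows "vanishes_below a f \<Longrightarrow> vanishes_below b g \<Longrightarrow> vanishes_below (a + b) (f * g)"
  by (auto simp: vanishes_below_def[of "a + b"] fls_times_nth_bounds)

lemma fls_times_nth_lowest:
  fixes f g :: "'a::comm_ring_1 fls"
  shows "vanishes_below a f \<Longrightarrow> vanishes_below b g \<Longrightarrow> (f * g) $$ (a + b) = f $$ a * g $$ b"
  by (simp add: fls_times_nth_bounds)

lemma vanishes_below_subdegree: "vanishes_below (fls_subdegree f) f"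
  by (simp add: vanishes_below_def)

lemma vanishes_below_1: "a \<le> 0 \<Longrightarrow> vanishes_below a (1 :: 'a::comm_ring_1 fls)"
  by (simp add: vanishes_below_def)

lemma vanishes_below_power:
  fixes f :: "'a::comm_ring_1 fls"
  assumes "vanishes_below 0 f"
  shows "vanishes_below 0 (f ^ k) \<and> (f ^ k) $$ 0 = (f $$ 0) ^ k"
proof (induction k)
  case (Suc k)
  then show ?case
    using vanishes_below_mult[OF assms, of 0 "f ^ k"] fls_times_nth_lowest[OF assms, of 0 "f ^ k"] by simp
qed (simp add: vanishes_below_1)

lemma fls_subdegree_ge_vanishes: "f \<noteq> 0 \<Longrightarrow> vanishes_below a f \<Longrightarrow> a \<le> fls_subdegree f"
  by (auto simp: vanishes_below_def intro: fls_subdegree_geI)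

section \<open>Derivations on series, and the logarithm series\<close>

definition coeffwise :: "('a::comm_ring_1 \<Rightarrow> 'a) \<Rightarrow> 'a fls \<Rightarrow> 'a fls" where
  "coeffwise d f = Abs_fls (\<lambda>n. d (f $$ n))"

text \<open>\<open>c\<close> is the derivative of the series variable \<open>t\<close>. With
  \<open>c = v * t\<close> the variable is an exponential and the derivation is diagonal on powers
  of \<open>t\<close>; expansions at infinity take \<open>c\<close> to be a multiple of
  \<open>t ^ 2\<close>.\<close>

definition fls_der :: "('a::field \<Rightarrow> 'a) \<Rightarrow> 'a fls \<Rightarrow> 'a fls \<Rightarrow> 'a fls" where
  "fls_der d c f = coeffwise d f + c * fls_deriv f"

lemma coeffwise_nth:
  fixes d :: "'a::field \<Rightarrow> 'a"
  assumes "derivation d"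
  shows "coeffwise d f $$ n = d (f $$ n)"
proof -
  have "\<forall>n<fls_subdegree f. d (f $$ n) = 0" using der_0[OF assms] by simp
  then show ?thesis unfolding coeffwise_def by (rule nth_Abs_fls_lower_bound)
qed

lemma coeffwise_derivation:
  fixes d :: "'a::field \<Rightarrow> 'a"
  assumes d: "derivation d"
  shows "derivation (coeffwise d)"
proof -
  have van: "vanishes_below a (coeffwise d f)" if "vanishes_below a f" for a f
    using that by (simp add: vanishes_below_def coeffwise_nth[OF d] der_0[OF d])
  have "coeffwise d (f * g) = coeffwise d f * g + f * coeffwise d g" for f g
  proof (rule fls_eqI)
    fix n
    note v = vanishes_below_subdegree[of f] vanishes_below_subdegree[of g]
    show "coeffwise d (f * g) $$ n = (coeffwise d f * g + f * coeffwise d g) $$ n"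
      by (simp add: coeffwise_nth[OF d] fls_times_nth_bounds[OF v] fls_times_nth_bounds[OF van[OF v(1)] v(2)]
          fls_times_nth_bounds[OF v(1) van[OF v(2)]] der_sum[OF d] der_mult[OF d] sum.distrib)
  qed
  moreover have "coeffwise d (f + g) = coeffwise d f + coeffwise d g" for f g
    by (rule fls_eqI) (simp add: coeffwise_nth[OF d] der_add[OF d])
  ultimately show ?thesis unfolding derivation_def by blast
qed

lemma fls_deriv_derivation: "derivation (fls_deriv :: 'a::field fls \<Rightarrow> 'a fls)"
  by (simp add: derivation_def add.commute)

context
  fixes d :: "'a::field_char_0 \<Rightarrow> 'a"
  assumes d: "derivation d"
begin

lemma fls_der_derivation: "derivation (fls_der d c)"
proof -
  have "fls_der d c (f + g) = fls_der d c f + fls_der d c g"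
    "fls_der d c (f * g) = fls_der d c f * g + f * fls_der d c g" for f g
    unfolding fls_der_def der_add[OF coeffwise_derivation[OF d]]
      der_mult[OF coeffwise_derivation[OF d]] fls_deriv_add fls_deriv_mult
    by (simp_all only: ring_distribs mult_ac add_ac)
  then show ?thesis unfolding derivation_def by blast
qed

lemma fls_der_const: "fls_der d c (fls_const a) = fls_const (d a)"
  by (rule fls_eqI) (simp add: fls_der_def coeffwise_nth[OF d] der_0[OF d])

lemma fls_der_nth: "fls_der d (fls_const v * fls_X) f $$ n = d (f $$ n) + v * of_int n * f $$ n"
proof -
  have "(fls_const v * fls_X * fls_deriv f) $$ n = v * (fls_X * fls_deriv f) $$ n"
    by (simp only: mult.assoc) (simp add: fls_times_fps_to_fls)
  also have "(fls_X * fls_deriv f) $$ n = of_int n * f $$ n"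
    by (simp add: fls_X_times_conv_shift)
  finally show ?thesis by (simp add: fls_der_def coeffwise_nth[OF d] mult.assoc)
qed

lemma fls_der_vanishes:
  "vanishes_below a f \<Longrightarrow> vanishes_below a (fls_der d (fls_const v * fls_X) f)"
  by (simp add: vanishes_below_def fls_der_nth der_0[OF d])

text \<open>With leading term \<open>a * t ^ m\<close> the quotient starts with
  \<open>d a / a + m * v\<close>; everything else has positive order.\<close>

lemma fls_der_logarithmic:
  fixes v f
  defines "E \<equiv> fls_der d (fls_const v * fls_X)"
  defines "m \<equiv> fls_subdegree f"
  assumes "f \<noteq> 0"
  shows "vanishes_below 0 (E f / f)" "(E f / f) $$ 0 = d (f $$ m) / (f $$ m) + v * of_int m"
proof -
  have Ef: "vanishes_below m (E f)"
    unfolding E_def m_def by (intro fls_der_vanishes vanishes_below_subdegree)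
  have eq: "E f / f * f = E f" using assms by simp
  show v: "vanishes_below 0 (E f / f)"
  proof (cases "E f = 0")
    case False
    then have "fls_subdegree (E f / f) \<ge> 0"
      using fls_subdegree_ge_vanishes[OF False Ef] assms by (simp add: fls_divide_subdegree m_def)
    then show ?thesis by (simp add: vanishes_below_def)
  qed (simp add: vanishes_below_def)
  have "(E f / f) $$ 0 * f $$ m = E f $$ m"
    using fls_times_nth_lowest[OF v vanishes_below_subdegree[of f]] eq by (simp add: m_def)
  moreover have "f $$ m \<noteq> 0" using assms(3) by (simp add: m_def)
  ultimately show "(E f / f) $$ 0 = d (f $$ m) / (f $$ m) + v * of_int m"
    unfolding E_def fls_der_nth by (simp add: field_simps)
qed

text \<open>The new variable is a \<open>k\<close>-th root of the old one, so its logarithmic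
  derivative is divided by \<open>k\<close>.\<close>

lemma fls_der_compose_power:
  assumes "k > 0"
  shows "fls_compose_power (fls_der d (fls_const v * fls_X) f) k =
    fls_der d (fls_const (v / of_nat k) * fls_X) (fls_compose_power f k)"
  by (rule fls_eqI)
     (use assms in \<open>auto simp: fls_der_nth fls_nth_compose_power der_0[OF d] elim!: dvdE\<close>)

end

text \<open>\<open>z\<close> is the series \<open>log (1 + y)\<close>.\<close>
lemma fls_log_exists:
  fixes y :: "'a::field_char_0 fls"
  assumes y: "vanishes_below 1 y"
  obtains z where "vanishes_below 1 z"
    "\<And>d v. derivation d \<Longrightarrow> fls_der d (fls_const v * fls_X) z * (1 + y) = fls_der d (fls_const v * fls_X) y"
proof -
  have yi: "vanishes_below (int i) (y ^ i)" for i
  proof (induction i)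
    case (Suc i)
    then show ?case using vanishes_below_mult[OF y Suc] by (simp add: add.commute)
  qed (simp add: vanishes_below_1)
  define l :: "nat \<Rightarrow> 'a" where "l i = (- 1) ^ (i + 1) / of_nat i" for i
  define S where "S N = (\<Sum>i=1..N. fls_const (l i) * y ^ i)" for N
  define z where "z = Abs_fls (\<lambda>n. S (nat n) $$ n)"
  have SN: "S M $$ n = S N $$ n" if "nat n \<le> N" "N \<le> M" for n N M
    using that(2)
  proof (induction M rule: dec_induct)
    case (step M)
    have "(y ^ Suc M) $$ n = 0" using yi[of "Suc M"] step that(1) by (auto simp: vanishes_below_def)
    then show ?case using step by (simp add: S_def del: power_Suc)
  qed simp
  have znth: "z $$ n = S (nat n) $$ n" for n
    unfolding z_def by (rule nth_Abs_fls_lower_bound[of 0]) (simp add: S_def)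
  have zS: "z $$ n = S N $$ n" if "nat n \<le> N" for n N using SN[of n "nat n" N] znth that by simp
  show ?thesis
  proof (rule that[of z])
    have "n \<le> 0 \<Longrightarrow> z $$ n = 0" for n by (simp add: znth S_def)
    then show "vanishes_below 1 z" by (simp add: vanishes_below_def)
  next
    fix d :: "'a \<Rightarrow> 'a" and v assume d: "derivation d"
    define E where "E = fls_der d (fls_const v * fls_X)"
    have E: "derivation E" unfolding E_def by (rule fls_der_derivation[OF d])
    have dl: "d (l i) = 0" for i
    proof (cases "i = 0")
      case False
      have "d ((- 1) ^ (i + 1)) = 0" by (simp only: der_power[OF d] der_uminus[OF d] der_1[OF d]) simp
      moreover have "d ((- 1) ^ (i + 1) / of_nat i) =
          (d ((- 1) ^ (i + 1)) * of_nat i - (- 1) ^ (i + 1) * d (of_nat i)) / (of_nat i)\<^sup>2"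
        using False by (intro der_divide[OF d]) simp
      ultimately show ?thesis by (simp only: l_def der_of_nat[OF d]) simp
    qed (simp add: l_def der_0[OF d])
    \<comment> \<open>The rational coefficients have derivative 0, so each summand contributes a
      power of \<open>- y\<close> times \<open>E y\<close>, and the geometric sum
      telescopes.\<close>
    have ES: "E (S N) * (1 + y) = (1 - (- y) ^ N) * E y" for N
    proof (induction N)
      case 0
      then show ?case by (simp add: S_def der_0[OF E])
    next
      case (Suc N)
      have c: "fls_const (l (Suc N)) * of_nat (Suc N) = (- 1) ^ N"
      proof -
        have "fls_const (l (Suc N)) * of_nat (Suc N) = fls_const (l (Suc N) * of_nat (Suc N))"
          by (simp only: fls_of_nat fls_const_mult_const)
        also have "l (Suc N) * of_nat (Suc N) = (- 1) ^ N" by (simp add: l_def del: of_nat_Suc)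
        also have "fls_const ((- 1) ^ N) = ((- 1) ^ N :: 'a fls)" by (cases "even N") simp_all
        finally show ?thesis .
      qed
      have "E (fls_const (l (Suc N)) * y ^ Suc N) = (fls_const (l (Suc N)) * of_nat (Suc N)) * y ^ N * E y"
      proof -
        have "E (fls_const (l (Suc N))) = 0" by (simp add: E_def fls_der_const[OF d] dl)
        then show ?thesis
          by (simp only: der_mult[OF E] der_power[OF E] mult_zero_left add_0 diff_Suc_1 mult.assoc)
      qed
      also have "\<dots> = (- y) ^ N * E y" unfolding c by (simp add: power_minus[of y])
      finally have "E (S (Suc N)) = E (S N) + (- y) ^ N * E y" by (simp add: S_def der_add[OF E])
      then have "E (S (Suc N)) * (1 + y) = E (S N) * (1 + y) + ((- y) ^ N - (- y) ^ Suc N) * E y"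
        by (simp add: algebra_simps)
      then show ?case unfolding Suc by (simp add: algebra_simps)
    qed
    show "fls_der d (fls_const v * fls_X) z * (1 + y) = fls_der d (fls_const v * fls_X) y"
      unfolding E_def[symmetric]
    proof (rule fls_eqI)
      fix n
      \<comment> \<open>A partial sum of length \<open>N\<close> suffices for the coefficient at
        \<open>n\<close>: the remainder of \<open>z\<close> and the error of the geometric sum both
        contribute only in orders above \<open>N\<close>.\<close>
      define N where "N = nat n"
      have "vanishes_below (int N + 1) (z - S N)"
        unfolding vanishes_below_def using zS by simp
      then have "vanishes_below (int N + 1) (E (z - S N))"
        unfolding E_def by (rule fls_der_vanishes[OF d])
      moreover have y1: "vanishes_below 0 (1 + y)" using y by (simp add: vanishes_below_def)
      ultimately have 1: "vanishes_below (int N + 1) (E (z - S N) * (1 + y))"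
        using vanishes_below_mult by fastforce
      have "vanishes_below 1 (E y)" unfolding E_def by (rule fls_der_vanishes[OF d y])
      moreover have "vanishes_below (int N) ((- y) ^ N)"
        using yi[of N] by (cases "even N") (auto simp: vanishes_below_def)
      ultimately have 2: "vanishes_below (int N + 1) ((- y) ^ N * E y)"
        using vanishes_below_mult by blast
      have "E z * (1 + y) = E (z - S N) * (1 + y) + E y - (- y) ^ N * E y"
        using ES[of N] by (simp add: der_diff[OF E] algebra_simps)
      moreover have "n < int N + 1" by (simp add: N_def)
      ultimately show "(E z * (1 + y)) $$ n = E y $$ n" using 1 2 by (simp add: vanishes_below_def)
    qed
  qed
qed

section \<open>Series with coefficients in a closed subfield\<close>

definition series_over :: "'a::zero set \<Rightarrow> 'a fls set" where
  "series_over Q = {s. \<forall>n. s $$ n \<in> Q}"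

text \<open>Applied coefficientwise, the derivations that kill \<open>Q\<close> turn its kernel
  description into one for series.\<close>

lemma series_over_eq:
  fixes Q :: "'a::field_char_0 set"
  assumes Q: "cl Q = Q"
  shows "series_over Q = {s. \<forall>d. derivation d \<longrightarrow> (\<forall>a\<in>Q. d a = 0) \<longrightarrow> coeffwise d s = 0}"
proof -
  have "s \<in> series_over Q \<longleftrightarrow> (\<forall>d. derivation d \<longrightarrow> (\<forall>a\<in>Q. d a = 0) \<longrightarrow> coeffwise d s = 0)" for s
  proof -
    have "s \<in> series_over Q \<longleftrightarrow> (\<forall>n. \<forall>d. derivation d \<longrightarrow> (\<forall>a\<in>Q. d a = 0) \<longrightarrow> d (s $$ n) = 0)"
      unfolding series_over_def using Q by (auto simp: cl_def)
    also have "\<dots> \<longleftrightarrow> (\<forall>d. derivation d \<longrightarrow> (\<forall>a\<in>Q. d a = 0) \<longrightarrow> coeffwise d s = 0)"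
      by (auto simp: fls_eq_iff coeffwise_nth)
    finally show ?thesis .
  qed
  then show ?thesis by blast
qed

text \<open>Newton-Puiseux gives roots with coefficients somewhere in \<open>'u\<close>; this forces
  the coefficients into \<open>Q\<close>.\<close>

lemma series_over_cl:
  fixes Q :: "'a::field_char_0 set"
  assumes Q: "cl Q = Q"
  shows "cl (series_over Q) = series_over Q"
proof
  show "cl (series_over Q) \<subseteq> series_over Q"
  proof
    fix s assume "s \<in> cl (series_over Q)"
    then show "s \<in> series_over Q"
      unfolding series_over_eq[OF Q] using coeffwise_derivation by (auto intro: clD)
  qed
qed (rule cl_superset)

lemma series_over_field_set: "cl Q = (Q :: 'a::field_char_0 set) \<Longrightarrow> field_set (series_over Q)"
  by (metis series_over_cl field_set_closed)

text \<open>A coefficientwise derivation is \<open>fls_der\<close> with \<open>v = 0\<close>, so by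
  the equation for the logarithm it kills \<open>z\<close> along with \<open>y\<close>.\<close>

lemma series_over_log:
  fixes Q :: "'a::field_char_0 set"
  assumes Q: "cl Q = Q" and y: "y \<in> series_over Q" "vanishes_below 1 y"
    and z: "\<And>d v. derivation d \<Longrightarrow> fls_der d (fls_const v * fls_X) z * (1 + y) = fls_der d (fls_const v * fls_X) y"
  shows "z \<in> series_over Q"
  unfolding series_over_eq[OF Q]
proof (intro CollectI allI impI)
  fix d assume d: "derivation d" "\<forall>a\<in>Q. d a = 0"
  have "coeffwise d y = 0" using y(1) d by (auto simp: series_over_eq[OF Q])
  then have "coeffwise d z * (1 + y) = 0" using z[OF d(1), of 0] by (simp add: fls_der_def)
  moreover have "(1 + y) $$ 0 = 1" using y(2) by (simp add: vanishes_below_def)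
  then have "1 + y \<noteq> 0" by force
  ultimately show "coeffwise d z = 0" by simp
qed

text \<open>A derivation that kills \<open>Q\<close> and is 1 at \<open>lam\<close>, applied
  coefficientwise, kills \<open>H\<close> and \<open>g\<close> but not the sum.\<close>

lemma const_plus_series_transcendental:
  fixes Q :: "'a::field_char_0 set"
  assumes Q: "cl Q = Q" and lam: "lam \<notin> Q" and g: "g \<in> series_over Q" and H: "field_set H" "H \<subseteq> series_over Q"
  shows "\<not> algebraic_elt H (fls_const lam + g)"
proof
  assume a: "algebraic_elt H (fls_const lam + g)"
  obtain d where d: "derivation d" "\<And>a. a \<in> Q \<Longrightarrow> d a = 0" "d lam = 1"
    using closed_derivation[of lam Q] lam Q by metis
  have k: "coeffwise d h = 0" if "h \<in> series_over Q" for h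
    using that d by (auto simp: series_over_eq[OF Q])
  have "coeffwise d (fls_const lam + g) = 0"
    using H k by (intro derivation_algebraic_0[OF H(1) coeffwise_derivation[OF d(1)] _ a]) auto
  then have "coeffwise d (fls_const lam) = 0"
    using k[OF g] der_add[OF coeffwise_derivation[OF d(1)]] by simp
  then have "coeffwise d (fls_const lam) $$ 0 = 0" by simp
  then show False using d(3) by (simp add: coeffwise_nth[OF d(1)])
qed

text \<open>The derivative in the series variable kills the constants and hence all that is
  algebraic over them.\<close>

lemma fls_transcendental_over_constants:
  fixes s :: "'a::field_char_0 fls"
  assumes "field_set H" "H \<subseteq> range fls_const" "fls_deriv s \<noteq> 0"
  shows "\<not> algebraic_elt H s"
proof
  assume a: "algebraic_elt H s"
  have "fls_deriv h = 0" if h: "h \<in> H" for h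
  proof -
    obtain c where "h = fls_const c" using assms(2) h by blast
    then show ?thesis by simp
  qed
  from derivation_algebraic_0[OF assms(1) fls_deriv_derivation this a] have "fls_deriv s = 0" .
  then show False using assms by simp
qed

section \<open>Towers of logarithms and exponentials\<close>

text \<open>Every step takes the closure, so the algebraic steps of an elementary extension are
  absorbed.\<close>

inductive log_tower :: "('a::field \<Rightarrow> 'a) \<Rightarrow> 'a set \<Rightarrow> 'a set \<Rightarrow> bool" for D P where
  base: "log_tower D P P"
| log: "\<lbrakk>log_tower D P Q; a \<in> Q; a \<noteq> 0; D x = D a / a\<rbrakk> \<Longrightarrow> log_tower D P (cl (insert x Q))"

inductive elem_tower :: "('a::field \<Rightarrow> 'a) \<Rightarrow> 'a set \<Rightarrow> 'a set \<Rightarrow> bool" for D P where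
  base: "elem_tower D P P"
| log: "\<lbrakk>elem_tower D P Q; a \<in> Q; a \<noteq> 0; D x = D a / a\<rbrakk> \<Longrightarrow> elem_tower D P (cl (insert x Q))"
| exp: "\<lbrakk>elem_tower D P Q; u \<in> Q; D x = x * D u\<rbrakk> \<Longrightarrow> elem_tower D P (cl (insert x Q))"

definition diff_closed :: "('a::field \<Rightarrow> 'a) \<Rightarrow> 'a set \<Rightarrow> bool" where
  "diff_closed D P \<longleftrightarrow> derivation D \<and> cl P = P \<and> (\<forall>x\<in>P. D x \<in> P)"

lemma diff_closedD:
  assumes "diff_closed D P"
  shows "derivation D" "cl P = P" "x \<in> P \<Longrightarrow> D x \<in> P" "field_set P"
  using assms field_set_closed[of P] by (auto simp: diff_closed_def)

lemma diff_closed_insert: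
  assumes "diff_closed D Q" "D x \<in> cl (insert x Q)"
  shows "diff_closed D (cl (insert x Q))"
  unfolding diff_closed_def
proof (intro conjI ballI)
  fix y assume "y \<in> cl (insert x Q)"
  then show "D y \<in> cl (insert x Q)"
    by (rule cl_derivation_closed[OF diff_closedD(1)[OF assms(1)], rotated])
       (use assms diff_closedD(3)[OF assms(1)] cl_superset[of "insert x Q"] in auto)
qed (use assms in \<open>auto simp: diff_closed_def\<close>)

lemma diff_closed_log:
  assumes "diff_closed D Q" "a \<in> Q" "D x = D a / a"
  shows "diff_closed D (cl (insert x Q))"
proof (rule diff_closed_insert[OF assms(1)])
  have "D x \<in> Q" unfolding assms(3) using diff_closedD[OF assms(1)] assms(2) by (intro fs_divide)
  then show "D x \<in> cl (insert x Q)" using cl_superset[of "insert x Q"] by auto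
qed

lemma log_tower_superset: "log_tower D P Q \<Longrightarrow> P \<subseteq> Q"
  by (induction rule: log_tower.induct) (use cl_superset in blast)+

lemma elem_tower_superset: "elem_tower D P Q \<Longrightarrow> P \<subseteq> Q"
  by (induction rule: elem_tower.induct) (use cl_superset in blast)+

lemma log_tower_diff_closed: "log_tower D P Q \<Longrightarrow> diff_closed D P \<Longrightarrow> diff_closed D Q"
  by (induction rule: log_tower.induct) (auto intro: diff_closed_log)

lemma elem_tower_diff_closed: "elem_tower D P Q \<Longrightarrow> diff_closed D P \<Longrightarrow> diff_closed D Q"
proof (induction rule: elem_tower.induct)
  case (exp Q u x)
  let ?C = "cl (insert x Q)"
  have "x \<in> ?C" "D u \<in> ?C"
    using cl_superset[of "insert x Q"] diff_closedD(3)[OF exp.IH[OF exp.prems] exp.hyps(2)] by auto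
  then have "D x \<in> ?C" unfolding exp.hyps(3) by (intro fs_mult field_set_cl)
  then show ?case by (intro diff_closed_insert exp.IH exp.prems)
qed (auto intro: diff_closed_log)

lemma log_tower_trans: "log_tower D Q R \<Longrightarrow> log_tower D P Q \<Longrightarrow> log_tower D P R"
  by (induction rule: log_tower.induct) (auto intro: log_tower.intros)

text \<open>Lets a tower survive a redefinition of the derivation outside it.\<close>

lemma log_tower_cong: "log_tower D P Q \<Longrightarrow> (\<And>x. x \<in> Q \<Longrightarrow> D' x = D x) \<Longrightarrow> log_tower D' P Q"
proof (induction rule: log_tower.induct)
  case (log Q a x)
  have "insert x Q \<subseteq> cl (insert x Q)" by (rule cl_superset)
  then have "D' x = D' a / a" "log_tower D' P Q" using log by auto
  then show ?case using log.hyps by (intro log_tower.log)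
qed (rule log_tower.base)

text \<open>\<open>B\<close> bounds the fields in play. Closures and simple extensions of small
  fields stay small, so a small closed field always misses an element of \<open>'u\<close>, which is
  then transcendental over it.\<close>

locale large_field =
  fixes B :: "'b set" and ty :: "'u::{alg_closed_field, field_char_0} itself"
  assumes inf: "infinite B" and large: "\<not> |UNIV :: 'u set| \<le>o |B|"
begin

definition small :: "'u set \<Rightarrow> bool" where
  "small S \<longleftrightarrow> |S| \<le>o |B|"

lemma small_fresh: "small Q \<Longrightarrow> \<exists>x. x \<notin> Q"
  using large unfolding small_def by (metis UNIV_eq_I)

lemma small_polys:
  assumes "small Q"
  shows "|{p. poly_over Q p}| \<le>o |B|"
proof -
  have "|{p. poly_over Q p}| \<le>o |lists Q|"
  proof (rule card_of_ordLeqI[of coeffs])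
    show "inj_on coeffs {p. poly_over Q p}" by (auto intro: inj_onI simp: coeffs_eq_iff)
    show "coeffs p \<in> lists Q" if "p \<in> {p. poly_over Q p}" for p
      using that by (auto simp: poly_over_def coeffs_def)
  qed
  also have "|lists Q| \<le>o |lists B|" using assms unfolding small_def by (rule card_of_lists_mono)
  also have "|lists B| =o |B|" by (rule card_of_lists_infinite[OF inf])
  finally show ?thesis .
qed

text \<open>There are few polynomials over \<open>Q\<close>, each with finitely many roots.\<close>

lemma small_cl:
  assumes "field_set Q" "small Q"
  shows "small (cl Q)"
proof -
  let ?I = "{p. poly_over Q p} - {0}"
  have "cl Q = (\<Union>p\<in>?I. {x. poly p x = 0})"
    using cl_eq_algebraic[OF assms(1)] by (auto simp: algebraic_elt_def)
  moreover have "|\<Union>p\<in>?I. {x. poly p x = 0}| \<le>o |B|"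
  proof (rule card_of_UNION_ordLeq_infinite[OF inf])
    have "|?I| \<le>o |{p. poly_over Q p}|" by (rule card_of_mono1) auto
    then show "|?I| \<le>o |B|" using small_polys[OF assms(2)] by (rule ordLeq_transitive)
    show "\<forall>p\<in>?I. |{x. poly p x = 0}| \<le>o |B|"
      using inf by (auto intro!: ordLess_imp_ordLeq finite_ordLess_infinite2 poly_roots_finite)
  qed
  ultimately show ?thesis by (simp add: small_def)
qed

lemma small_gen_insert:
  assumes "field_set Q" "small Q"
  shows "small (gen (insert x Q))"
proof -
  let ?I = "{p. poly_over Q p}"
  have "gen (insert x Q) \<subseteq> (\<lambda>(p, q). poly p x / poly q x) ` (?I \<times> ?I)"
    unfolding gen_insert_eq[OF assms(1)] by auto
  then have "|gen (insert x Q)| \<le>o |?I \<times> ?I|"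
    by (rule surj_imp_ordLeq)
  also have "|?I \<times> ?I| \<le>o |B|"
    by (rule card_of_Times_ordLeq_infinite[OF inf]) (rule small_polys[OF assms(2)])+
  finally show ?thesis by (simp add: small_def)
qed

lemma small_cl_insert: "field_set Q \<Longrightarrow> small Q \<Longrightarrow> small (cl (insert x Q))"
  using small_cl[OF gen_field_set small_gen_insert, of Q x] by simp

lemma log_tower_small: "log_tower D P Q \<Longrightarrow> diff_closed D P \<Longrightarrow> small P \<Longrightarrow> small Q"
proof (induction rule: log_tower.induct)
  case (log Q a x)
  then show ?case
    using small_cl_insert diff_closedD(4)[OF log_tower_diff_closed[OF log.hyps(1) log.prems(1)]] by blast
qed

lemma elem_tower_small: "elem_tower D P Q \<Longrightarrow> diff_closed D P \<Longrightarrow> small P \<Longrightarrow> small Q"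
proof (induction rule: elem_tower.induct)
  case (log Q a x)
  then show ?case
    using small_cl_insert diff_closedD(4)[OF elem_tower_diff_closed[OF log.hyps(1) log.prems(1)]] by blast
next
  case (exp Q u x)
  then show ?case
    using small_cl_insert diff_closedD(4)[OF elem_tower_diff_closed[OF exp.hyps(1) exp.prems(1)]] by blast
qed

text \<open>The price of a new primitive \<open>lam\<close> of \<open>y\<close> is that the
  derivation changes outside \<open>Q\<close>.\<close>

lemma fresh_derivation:
  assumes Q: "diff_closed D Q" "small Q"
  obtains D' lam where "derivation D'" "lam \<notin> Q" "\<And>x. x \<in> Q \<Longrightarrow> D' x = D x" "D' lam = y" "diff_closed D' Q"
proof -
  obtain lam where lam: "lam \<notin> Q" using small_fresh[OF Q(2)] by blast
  obtain D' where D': "derivation D'" "\<And>x. x \<in> cl Q \<Longrightarrow> D' x = D x" "D' lam = y"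
    using derivation_redefine[OF diff_closedD(1)[OF Q(1)], of lam Q y] lam diff_closedD(2)[OF Q(1)] by metis
  have "diff_closed D' Q" using D'(1,2) Q(1) by (auto simp: diff_closed_def)
  then show ?thesis using that[of D' lam] D' lam diff_closedD(2)[OF Q(1)] by metis
qed

text \<open>A differential embedding of the subfield \<open>G\<close> into Laurent series over \<open>Q\<close> in \<open>t\<close>,
  where \<open>t ^ r\<close> is an exponential of \<open>u\<close>.\<close>
definition series_emb ::
  "('u \<Rightarrow> 'u) \<Rightarrow> 'u set \<Rightarrow> ('u \<Rightarrow> 'u fls) \<Rightarrow> nat \<Rightarrow> 'u set \<Rightarrow> ('u \<Rightarrow> 'u) \<Rightarrow> 'u \<Rightarrow> bool" where
  "series_emb D G \<phi> r Q D' u \<longleftrightarrow>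
     field_set G \<and> (\<forall>x\<in>G. D x \<in> G) \<and> diff_closed D' Q \<and> small Q \<and> u \<in> Q \<and> r > 0 \<and>
     hom_on G \<phi> \<and> (\<forall>x\<in>G. \<phi> x \<in> series_over Q) \<and>
     (\<forall>x\<in>G. \<phi> (D x) = fls_der D' (fls_const (D' u / of_nat r) * fls_X) (\<phi> x))"

end

lemma hom_on_gen_image:
  fixes g :: "'a::field \<Rightarrow> 'b::field"
  assumes g: "hom_on (gen A) g" and T: "field_set T" "\<And>a. a \<in> A \<Longrightarrow> g a \<in> T" and y: "y \<in> gen A"
  shows "g y \<in> T"
proof -
  note G = gen_field_set[of A]
  have "field_set {y \<in> gen A. g y \<in> T}"
    unfolding field_set_def
    using g hom_on_diff[OF G g] hom_on_inverse[OF G g] fs_1[OF G] fs_diff[OF G] fs_mult[OF G]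
      fs_inverse[OF G] fs_1[OF T(1)] fs_diff[OF T(1)] fs_mult[OF T(1)] fs_inverse[OF T(1)]
    by (simp add: hom_on_def)
  moreover have "A \<subseteq> {y \<in> gen A. g y \<in> T}" using T gen_superset[of A] by auto
  ultimately show ?thesis using gen_least y by blast
qed

lemma log_series:
  fixes Q :: "'a::field_char_0 set" and f :: "'a fls"
  defines "m \<equiv> fls_subdegree f"
  assumes d: "derivation d" and Q: "cl Q = Q" and f: "f \<noteq> 0" "f \<in> series_over Q"
    and lam: "d lam = d (f $$ m) / f $$ m"
  obtains z where "z \<in> series_over Q" "vanishes_below 1 z"
    "fls_der d (fls_const (d u / of_nat r) * fls_X) (fls_const (lam + of_int m * u / of_nat r) + z) =
     fls_der d (fls_const (d u / of_nat r) * fls_X) f / f"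
proof -
  define v where "v = d u / of_nat r"
  define E where "E = fls_der d (fls_const v * fls_X)"
  have E: "derivation E" unfolding E_def by (rule fls_der_derivation[OF d])
  note FQ = field_set_closed[OF Q]
  define b where "b = f $$ m"
  have b: "b \<noteq> 0" "b \<in> Q" using f by (auto simp: b_def m_def series_over_def)
  \<comment> \<open>This gives \<open>f = b * t ^ m * (1 + y)\<close>. The variable \<open>t\<close>
    has \<open>u / r\<close> as its logarithm, since \<open>t ^ r\<close> is an exponential of
    \<open>u\<close>.\<close>
  define y where "y = fls_const (inverse b) * fls_shift m f - 1"
  have yn: "y $$ n = inverse b * f $$ (n + m) - (if n = 0 then 1 else 0)" for n by (simp add: y_def)
  have y1: "vanishes_below 1 y"
    unfolding vanishes_below_def
  proof (intro allI impI)
    fix n :: int assume "n < 1"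
    then consider "n = 0" | "n < 0" by linarith
    then show "y $$ n = 0"
    proof cases
      case 1
      then show ?thesis using b by (simp add: yn b_def[symmetric])
    next
      case 2
      then show ?thesis by (simp add: yn m_def fls_eq0_below_subdegree)
    qed
  qed
  have yQ: "y \<in> series_over Q"
    unfolding series_over_def
    using f(2) b by (auto simp: yn series_over_def intro!: fs_diff[OF FQ] fs_mult[OF FQ] fs_inverse[OF FQ] fs_1[OF FQ] fs_0[OF FQ])
  have fy: "f = fls_const b * (fls_X_intpow m * (1 + y))"
    by (rule fls_eqI) (use b in \<open>simp add: y_def fls_shifted_times_simps\<close>)
  obtain z where z: "vanishes_below 1 z"
    "\<And>d v. derivation d \<Longrightarrow> fls_der d (fls_const v * fls_X) z * (1 + y) = fls_der d (fls_const v * fls_X) y"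
    using fls_log_exists[OF y1] by metis
  have zQ: "z \<in> series_over Q" by (rule series_over_log[OF Q yQ y1 z(2)])
  have nz: "1 + y \<noteq> 0" using y1 by (auto simp: fls_eq_iff vanishes_below_def intro!: exI[of _ 0])
  have Ez: "E z * (1 + y) = E y" using z(2)[OF d, of v] by (simp add: E_def)
  have EX: "E (fls_X_intpow m) = fls_const (v * of_int m) * fls_X_intpow m"
    by (rule fls_eqI) (simp add: E_def fls_der_nth[OF d] der_0[OF d] der_1[OF d])
  have Ec: "E (fls_const c) = fls_const (d c)" for c by (simp add: E_def fls_der_const[OF d])
  have "E f = fls_const (d b) * (fls_X_intpow m * (1 + y)) +
      fls_const b * (fls_const (v * of_int m) * fls_X_intpow m * (1 + y) + fls_X_intpow m * E y)"
    by (subst fy) (simp only: der_mult[OF E] der_add[OF E] der_1[OF E] EX add_0 Ec)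
  also have "\<dots> = (fls_const (d b / b) + fls_const (v * of_int m) + E z) * f"
  proof -
    have db: "fls_const (d b) = fls_const (d b / b) * fls_const b" using b by simp
    show ?thesis
      unfolding Ez[symmetric] db by (subst fy) (simp only: ring_distribs mult_ac add_ac)
  qed
  finally have "E f / f = fls_const (d b / b) + fls_const (v * of_int m) + E z" using f(1) by simp
  moreover have "E (fls_const (lam + of_int m * u / of_nat r) + z) =
      fls_const (d b / b) + fls_const (v * of_int m) + E z"
  proof -
    have "d (of_int m * u / of_nat r) = v * of_int m"
    proof (cases "r = 0")
      case False
      then show ?thesis
        by (simp add: der_divide[OF d] der_mult[OF d] der_of_int[OF d] der_of_nat[OF d] v_def power2_eq_square)
    qed (simp add: v_def der_0[OF d])
    then have "d (lam + of_int m * u / of_nat r) = d b / b + v * of_int m"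
      using lam by (simp add: der_add[OF d] b_def)
    then show ?thesis unfolding der_add[OF E] Ec by (simp add: fls_plus_const)
  qed
  ultimately show ?thesis using that[OF zQ z(1)] by (simp add: E_def v_def)
qed

lemma fls_der_cong:
  fixes Q :: "'a::field_char_0 set"
  assumes "derivation d" "derivation d'" "s \<in> series_over Q" "\<And>x. x \<in> Q \<Longrightarrow> d' x = d x"
  shows "fls_der d' c s = fls_der d c s"
  unfolding fls_der_def
  by (rule arg_cong[where f = "\<lambda>z. z + c * fls_deriv s"], rule fls_eqI)
     (use assms in \<open>simp add: coeffwise_nth series_over_def\<close>)

section \<open>Adjoining a primitive: effect on exponentials and constants\<close>

text \<open>Expansion at infinity: a primitive \<open>lam\<close> corresponds to the inverse of the series variable.\<close>
lemma primitive_expansion: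
  fixes Q :: "'a::field_char_0 set"
  assumes Q: "diff_closed D Q" and lam: "lam \<notin> Q" "D lam \<in> Q"
  obtains \<psi> where "hom_on (gen (insert lam Q)) \<psi>" "\<And>a. a \<in> Q \<Longrightarrow> \<psi> a = fls_const a"
    "\<And>y. y \<in> gen (insert lam Q) \<Longrightarrow> D y \<in> gen (insert lam Q) \<and> \<psi> y \<in> series_over Q"
    "\<And>y n. y \<in> gen (insert lam Q) \<Longrightarrow> \<psi> (D y) $$ n = D (\<psi> y $$ n) - D lam * of_int (n - 1) * \<psi> y $$ (n - 1)"
proof -
  note D = diff_closedD(1)[OF Q] and cQ = diff_closedD(2)[OF Q] and FQ = diff_closedD(4)[OF Q]
  have homc: "hom_on Q fls_const" by (simp add: hom_on_def fls_plus_const)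
  have tr: "\<not> algebraic_elt Q lam" using lam(1) cQ cl_eq_algebraic[OF FQ] by auto
  have "\<not> algebraic_elt (fls_const ` Q) fls_X_inv"
  proof (rule fls_transcendental_over_constants[OF field_set_image[OF FQ homc]])
    have "(fls_deriv fls_X_inv :: 'a fls) $$ (- 2) = - 1" by simp
    then show "fls_deriv fls_X_inv \<noteq> (0 :: 'a fls)" by (metis fls_zero_nth neg_equal_0_iff_equal zero_neq_one)
  qed auto
  then obtain \<psi> where \<psi>: "hom_on (gen (insert lam Q)) \<psi>" "\<And>a. a \<in> Q \<Longrightarrow> \<psi> a = fls_const a"
    "\<psi> lam = fls_X_inv"
    using hom_on_extend_transcendental[OF FQ homc tr] by metis
  \<comment> \<open>The variable \<open>t = 1 / lam\<close> has derivative
    \<open>- D lam * t ^ 2\<close>.\<close>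
  define E where "E = fls_der D (- fls_const (D lam) * fls_X\<^sup>2)"
  have E: "derivation E" unfolding E_def by (rule fls_der_derivation[OF D])
  have En: "E s $$ n = D (s $$ n) - D lam * of_int (n - 1) * s $$ (n - 1)" for s n
  proof -
    have "(- fls_const (D lam) * fls_X\<^sup>2 * fls_deriv s) $$ n = - (D lam * (fls_X\<^sup>2 * fls_deriv s) $$ n)"
      by (simp add: mult.assoc)
    also have "(fls_X\<^sup>2 * fls_deriv s) $$ n = of_int (n - 1) * s $$ (n - 1)"
      by (simp add: fls_X_power_times_conv_shift)
    finally show ?thesis by (simp add: E_def fls_der_def coeffwise_nth[OF D] mult.assoc)
  qed
  have Ex: "E fls_X_inv = fls_const (D lam)"
    by (rule fls_eqI) (simp add: En der_0[OF D] der_1[OF D])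
  have comm: "D y \<in> gen (insert lam Q) \<and> \<psi> (D y) = E (\<psi> y)" if "y \<in> gen (insert lam Q)" for y
  proof (rule hom_on_derivation_commute[OF D E \<psi>(1) _ that])
    fix a assume "a \<in> insert lam Q"
    moreover have "E (fls_const b) = fls_const (D b)" for b by (simp add: E_def fls_der_const[OF D])
    ultimately show "D a \<in> gen (insert lam Q) \<and> \<psi> (D a) = E (\<psi> a)"
      using \<psi>(2,3) lam(2) Ex diff_closedD(3)[OF Q] gen_superset[of "insert lam Q"] by auto
  qed
  have "\<psi> y \<in> series_over Q" if "y \<in> gen (insert lam Q)" for y
  proof (rule hom_on_gen_image[OF \<psi>(1) series_over_field_set[OF cQ] _ that])
    fix a assume "a \<in> insert lam Q"
    then show "\<psi> a \<in> series_over Q"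
      using \<psi>(2,3) fs_0[OF FQ] fs_1[OF FQ] by (auto simp: series_over_def)
  qed
  then show ?thesis using that[OF \<psi>(1,2)] comm En by simp
qed

text \<open>The norm brings the exponential into the field generated by \<open>lam\<close>, at the
  cost of a factor \<open>n\<close>. At infinity \<open>D lam\<close> enters one order higher, so
  the leading coefficient of the expansion satisfies the same equation inside
  \<open>Q\<close>.\<close>

lemma primitive_extension_exponential:
  fixes Q :: "'a::field_char_0 set"
  assumes Q: "diff_closed D Q" and lam: "lam \<notin> Q" "D lam \<in> Q"
    and y: "y \<in> cl (insert lam Q)" "y \<noteq> 0" "D y = g * y" "g \<in> Q"
  obtains n c where "n > 0" "c \<in> Q" "c \<noteq> 0" "D c = of_nat n * g * c"
proof -
  obtain \<psi> where \<psi>: "hom_on (gen (insert lam Q)) \<psi>" "\<And>a. a \<in> Q \<Longrightarrow> \<psi> a = fls_const a"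
    "\<And>y. y \<in> gen (insert lam Q) \<Longrightarrow> D y \<in> gen (insert lam Q) \<and> \<psi> y \<in> series_over Q"
    "\<And>y n. y \<in> gen (insert lam Q) \<Longrightarrow> \<psi> (D y) $$ n = D (\<psi> y $$ n) - D lam * of_int (n - 1) * \<psi> y $$ (n - 1)"
    using primitive_expansion[OF Q lam] by metis
  let ?G = "gen (insert lam Q)"
  note D = diff_closedD(1)[OF Q] and G = gen_field_set[of "insert lam Q"]
  have gG: "g \<in> ?G" using y(4) gen_superset[of "insert lam Q"] by auto
  have "algebraic_elt ?G y" using y(1) cl_eq_algebraic[OF G] by auto
  then obtain n a where a: "n > 0" "a \<in> ?G" "a \<noteq> 0" "D a = of_nat n * g * a"
    using algebraic_exponential[OF D G _ _ gG y(3,2)] \<psi>(3) by metis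
  define s where "s = \<psi> a"
  have s0: "s \<noteq> 0" using hom_on_eq_0_iff[OF G \<psi>(1) a(2)] a(3) by (simp add: s_def)
  have ng: "of_nat n * g \<in> Q"
    using y(4) diff_closedD(4)[OF Q] by (auto intro: fs_mult fs_of_nat)
  then have ngG: "of_nat n * g \<in> ?G" using gen_superset[of "insert lam Q"] by auto
  have "\<psi> (of_nat n * g * a) = \<psi> (of_nat n * g) * s"
    using \<psi>(1) ngG a(2) unfolding s_def hom_on_def by blast
  then have "\<psi> (D a) = fls_const (of_nat n * g) * s"
    unfolding a(4) using \<psi>(2)[OF ng] by simp
  then have "\<psi> (D a) $$ fls_subdegree s = of_nat n * g * s $$ fls_subdegree s" by (simp add: mult.assoc)
  moreover have "\<psi> (D a) $$ fls_subdegree s = D (s $$ fls_subdegree s)"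
    by (simp add: \<psi>(4)[OF a(2)] s_def)
  ultimately show ?thesis
    using that[of n "s $$ fls_subdegree s"] a(1) s0 \<psi>(3)[OF a(2)] by (simp add: s_def series_over_def)
qed

text \<open>A constant of order \<open>k \<noteq> 0\<close> at infinity would yield, from its second
  coefficient, an antiderivative of \<open>D lam\<close> in \<open>Q\<close>. So nonzero constants
  have order 0, and subtracting the constant coefficient leaves 0.\<close>

lemma primitive_extension_constants:
  fixes Q :: "'a::field_char_0 set"
  assumes Q: "diff_closed D Q" and lam: "lam \<notin> Q" "D lam \<in> Q" "\<And>b. b \<in> Q \<Longrightarrow> D b \<noteq> D lam"
    and y: "y \<in> cl (insert lam Q)" "D y = 0"
  shows "y \<in> Q"
proof -
  obtain \<psi> where \<psi>: "hom_on (gen (insert lam Q)) \<psi>" "\<And>a. a \<in> Q \<Longrightarrow> \<psi> a = fls_const a"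
    "\<And>y. y \<in> gen (insert lam Q) \<Longrightarrow> D y \<in> gen (insert lam Q) \<and> \<psi> y \<in> series_over Q"
    "\<And>y n. y \<in> gen (insert lam Q) \<Longrightarrow> \<psi> (D y) $$ n = D (\<psi> y $$ n) - D lam * of_int (n - 1) * \<psi> y $$ (n - 1)"
    using primitive_expansion[OF Q lam(1,2)] by metis
  let ?G = "gen (insert lam Q)"
  note D = diff_closedD(1)[OF Q] and G = gen_field_set[of "insert lam Q"] and FQ = diff_closedD(4)[OF Q]
  have low: "fls_subdegree (\<psi> c) = 0" "D (\<psi> c $$ 0) = 0" if c: "c \<in> ?G" "D c = 0" "c \<noteq> 0" for c
  proof -
    define s where "s = \<psi> c"
    define k where "k = fls_subdegree s"
    have s0: "s \<noteq> 0" using hom_on_eq_0_iff[OF G \<psi>(1) c(1)] c(3) by (simp add: s_def)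
    have sQ: "s $$ n \<in> Q" for n using \<psi>(3)[OF c(1)] by (simp add: s_def series_over_def)
    have e: "D (s $$ n) = D lam * of_int (n - 1) * s $$ (n - 1)" for n
      using \<psi>(4)[OF c(1), of n] c(2) hom_on_0[OF G \<psi>(1)] by (simp add: s_def)
    have ek: "D (s $$ k) = 0" using e[of k] by (simp add: k_def)
    have sk: "s $$ k \<noteq> 0" using s0 by (simp add: k_def)
    show k0: "fls_subdegree (\<psi> c) = 0"
    proof (rule ccontr)
      assume "fls_subdegree (\<psi> c) \<noteq> 0"
      then have kn: "of_int k * s $$ k \<noteq> 0" using sk by (simp add: k_def s_def)
      \<comment> \<open>An antiderivative of \<open>D lam\<close>, because
        \<open>D (s $$ (k + 1)) = D lam * k * s $$ k\<close> and \<open>k * s $$ k\<close> is a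
        constant.\<close>
      define b where "b = s $$ (k + 1) / (of_int k * s $$ k)"
      have "D (of_int k * s $$ k) = 0" using ek by (simp add: der_mult[OF D] der_of_int[OF D])
      then have "D b = D lam"
        unfolding b_def using e[of "k + 1"] kn
        by (simp only: der_divide[OF D kn]) (simp add: power2_eq_square)
      moreover have "b \<in> Q"
        unfolding b_def by (intro fs_divide[OF FQ] fs_mult[OF FQ] fs_of_int[OF FQ] sQ)
      ultimately show False using lam(3) by blast
    qed
    show "D (\<psi> c $$ 0) = 0" using ek k0 by (simp add: k_def s_def)
  qed
  have "c \<in> Q" if c: "c \<in> ?G" "D c = 0" for c
  proof (cases "c = 0")
    case False
    define c0 where "c0 = \<psi> c $$ 0"
    have c0: "c0 \<in> Q" "D c0 = 0" using \<psi>(3)[OF c(1)] low[OF c False] by (auto simp: c0_def series_over_def)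
    have c0G: "c0 \<in> ?G" using c0 gen_superset[of "insert lam Q"] by auto
    have "c - c0 = 0"
    proof (rule ccontr)
      assume ne: "c - c0 \<noteq> 0"
      have m: "c - c0 \<in> ?G" "D (c - c0) = 0"
        using c c0 c0G by (auto simp: der_diff[OF D] intro: fs_diff[OF G])
      have e: "\<psi> (c - c0) = \<psi> c - fls_const c0" using hom_on_diff[OF G \<psi>(1) c(1) c0G] \<psi>(2)[OF c0(1)] by simp
      have "fls_subdegree (\<psi> (c - c0)) = 0" "\<psi> (c - c0) \<noteq> 0"
        using low(1)[OF m ne] hom_on_eq_0_iff[OF G \<psi>(1) m(1)] ne by auto
      then have "\<psi> (c - c0) $$ 0 \<noteq> 0" by (metis nth_fls_subdegree_nonzero)
      moreover have "\<psi> (c - c0) $$ 0 = 0" unfolding e by (simp add: c0_def)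
      ultimately show False by simp
    qed
    then show ?thesis using c0 by simp
  qed (simp add: fs_0[OF FQ])
  then have sub: "{h \<in> ?G. D h = 0} \<subseteq> Q" by auto
  have "algebraic_elt ?G y" using y(1) cl_eq_algebraic[OF G] by auto
  then have "y \<in> cl {h \<in> ?G. D h = 0}"
    using algebraic_constant[OF D G _ _ y(2)] \<psi>(3) by metis
  then show ?thesis using cl_mono[OF sub] diff_closedD(2)[OF Q] by auto
qed

section \<open>Extending a series embedding by algebraic elements and logarithms\<close>

context large_field
begin

lemma series_embD:
  assumes "series_emb D G \<phi> r Q D' u"
  shows "field_set G" "\<And>x. x \<in> G \<Longrightarrow> D x \<in> G" "diff_closed D' Q" "small Q" "u \<in> Q" "r > 0" "hom_on G \<phi>"
    "\<And>x. x \<in> G \<Longrightarrow> \<phi> x \<in> series_over Q"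
    "\<And>x. x \<in> G \<Longrightarrow> \<phi> (D x) = fls_der D' (fls_const (D' u / of_nat r) * fls_X) (\<phi> x)"
  using assms by (auto simp: series_emb_def)

lemma series_emb_base:
  assumes P: "diff_closed D P" "small P" and u: "u \<in> P" and t: "t \<notin> P" "D t = t * D u"
  obtains \<phi> where "series_emb D (gen (insert t P)) \<phi> 1 P D u" "\<phi> t = fls_X" "\<And>p. p \<in> P \<Longrightarrow> \<phi> p = fls_const p"
proof -
  note D = diff_closedD(1)[OF P(1)] and cP = diff_closedD(2)[OF P(1)] and FP = diff_closedD(4)[OF P(1)]
  have homc: "hom_on P fls_const" by (simp add: hom_on_def fls_plus_const)
  have tr: "\<not> algebraic_elt P t" using t(1) cP cl_eq_algebraic[OF FP] by auto
  have "\<not> algebraic_elt (fls_const ` P) fls_X"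
    by (rule fls_transcendental_over_constants[OF field_set_image[OF FP homc]]) auto
  then obtain \<phi> where \<phi>: "hom_on (gen (insert t P)) \<phi>" "\<And>a. a \<in> P \<Longrightarrow> \<phi> a = fls_const a" "\<phi> t = fls_X"
    using hom_on_extend_transcendental[OF FP homc tr] by metis
  let ?G = "gen (insert t P)"
  define E where "E = fls_der D (fls_const (D u) * fls_X)"
  have E: "derivation E" unfolding E_def by (rule fls_der_derivation[OF D])
  have sub: "t \<in> ?G" "P \<subseteq> ?G" using gen_superset[of "insert t P"] by auto
  have Du: "D u \<in> P" by (rule diff_closedD(3)[OF P(1) u])
  have "E fls_X = fls_const (D u) * fls_X"
    by (rule fls_eqI) (simp add: E_def fls_der_nth[OF D] der_0[OF D] der_1[OF D])
  moreover have tG: "t * D u \<in> ?G" "\<phi> (t * D u) = fls_X * fls_const (D u)"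
    using \<phi> sub Du fs_mult[OF gen_field_set, of t "insert t P" "D u"] by (auto simp: hom_on_def subset_iff)
  ultimately have comm: "D y \<in> ?G \<and> \<phi> (D y) = E (\<phi> y)" if "y \<in> ?G" for y
  proof (intro hom_on_derivation_commute[OF D E \<phi>(1) _ that])
    fix a assume "a \<in> insert t P"
    moreover have "E (fls_const b) = fls_const (D b)" for b by (simp add: E_def fls_der_const[OF D])
    moreover assume "E fls_X = fls_const (D u) * fls_X"
    ultimately show "D a \<in> ?G \<and> \<phi> (D a) = E (\<phi> a)"
      using \<phi>(2,3) t(2) tG diff_closedD(3)[OF P(1)] sub by (auto simp: mult.commute)
  qed
  have "\<phi> y \<in> series_over P" if "y \<in> ?G" for y
  proof (rule hom_on_gen_image[OF \<phi>(1) series_over_field_set[OF cP] _ that])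
    fix a assume "a \<in> insert t P"
    then show "\<phi> a \<in> series_over P"
      using \<phi>(2,3) fs_0[OF FP] fs_1[OF FP] by (auto simp: series_over_def)
  qed
  then have "series_emb D ?G \<phi> 1 P D u"
    unfolding series_emb_def using P u \<phi>(1) comm gen_field_set by (simp add: E_def)
  then show ?thesis using that \<phi> by blast
qed

text \<open>Newton-Puiseux replaces \<open>r\<close> by a multiple, and old images undergo the
  substitution of \<open>t ^ k\<close>. What survives this, and what later arguments compare, are
  constant terms and constant series.\<close>

lemma series_emb_algebraic:
  assumes emb: "series_emb D G \<phi> r Q D' u" and D: "derivation D" and x: "x \<in> cl G"
  obtains G' \<phi>' r' where "series_emb D G' \<phi>' r' Q D' u" "G \<subseteq> G'" "x \<in> G'" "\<And>y. y \<in> G \<Longrightarrow> \<phi>' y $$ 0 = \<phi> y $$ 0"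
    "G' \<subseteq> cl G" "\<And>y c. y \<in> G \<Longrightarrow> \<phi> y = fls_const c \<Longrightarrow> \<phi>' y = fls_const c"
proof -
  note e = series_embD[OF emb]
  note G = e(1)
  note D' = diff_closedD(1)[OF e(3)] and cQ = diff_closedD(2)[OF e(3)]
  have ax: "algebraic_elt G x" using x cl_eq_algebraic[OF G] by auto
  obtain P where P: "minimal_poly G x P" by (rule minimal_poly_exists[OF G ax])
  note PD = minimal_polyD[OF P]
  define p where "p = map_poly \<phi> P"
  have \<phi>0: "\<phi> 0 = 0" by (rule hom_on_0[OF G e(7)])
  have cp: "coeff p i = \<phi> (coeff P i)" for i by (simp add: p_def coeff_map_poly \<phi>0)
  have lp: "coeff p (degree P) = 1" using PD(6) e(7) by (simp add: cp hom_on_def)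
  have dp: "degree p = degree P"
  proof (rule antisym)
    show "degree p \<le> degree P" unfolding p_def by (rule map_poly_degree_leq)
    show "degree P \<le> degree p" using lp by (intro le_degree) simp
  qed
  obtain k s where k: "k > 0" and s: "poly (map_poly (\<lambda>f. fls_compose_power f k) p) s = 0"
    using newton_puiseux[of p] lp dp PD(2) by auto
  define f where "f y = fls_compose_power (\<phi> y) k" for y
  have f: "hom_on G f" using e(7) k by (simp add: hom_on_def f_def)
  have "map_poly (\<lambda>f. fls_compose_power f k) p = map_poly f P"
    by (rule poly_eqI) (simp add: coeff_map_poly cp f_def \<phi>0)
  with s have s: "poly (map_poly f P) s = 0" by simp
  obtain g where g: "hom_on (gen (insert x G)) g" "\<And>h. h \<in> G \<Longrightarrow> g h = f h" "g x = s"
    using hom_on_extend_algebraic[OF G f P s] by metis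
  let ?G = "gen (insert x G)"
  have sub: "x \<in> ?G" "G \<subseteq> ?G" using gen_superset[of "insert x G"] by auto
  define E where "E = fls_der D' (fls_const (D' u / of_nat (r * k)) * fls_X)"
  have E: "derivation E" unfolding E_def by (rule fls_der_derivation[OF D'])
  have comm: "D h \<in> G \<and> g (D h) = E (g h)" if h: "h \<in> G" for h
  proof -
    have "f (D h) = E (f h)"
      unfolding f_def e(9)[OF h] fls_der_compose_power[OF D' k] E_def by simp
    then show ?thesis using e(2)[OF h] h g(2) by simp
  qed
  have comm': "D y \<in> ?G \<and> g (D y) = E (g y)" if "y \<in> ?G" for y
    by (rule hom_on_derivation_commute_algebraic[OF D E G comm g(1) ax that])
  have fser: "f h \<in> series_over Q" if "h \<in> G" for h
    using e(8)[OF that] fs_0[OF diff_closedD(4)[OF e(3)]] k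
    by (auto simp: f_def series_over_def fls_nth_compose_power)
  have "s \<in> cl (series_over Q)"
  proof -
    have "P \<noteq> 0" using PD(2) by auto
    have f0: "f 0 = 0" by (rule hom_on_0[OF G f])
    have "coeff (map_poly f P) (degree P) = 1" using PD(6) f by (simp add: coeff_map_poly f0 hom_on_def)
    then have "map_poly f P \<noteq> 0" by force
    moreover have "poly_over (series_over Q) (map_poly f P)"
      using PD(1) fser by (simp add: poly_over_def coeff_map_poly f0)
    ultimately have "algebraic_elt (series_over Q) s" using s by (auto simp: algebraic_elt_def)
    then show ?thesis using cl_eq_algebraic[OF series_over_field_set[OF cQ]] by auto
  qed
  then have sser: "s \<in> series_over Q" using series_over_cl[OF cQ] by simp
  have ser: "g y \<in> series_over Q" if "y \<in> ?G" for y
  proof (rule hom_on_gen_image[OF g(1) series_over_field_set[OF cQ] _ that])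
    show "g a \<in> series_over Q" if "a \<in> insert x G" for a using that g(2,3) sser fser by auto
  qed
  have "series_emb D ?G g (r * k) Q D' u"
    unfolding series_emb_def using gen_field_set comm' e k g(1) ser by (simp add: E_def)
  moreover have "g y $$ 0 = \<phi> y $$ 0" if "y \<in> G" for y
    using g(2)[OF that] k by (simp add: f_def fls_nth_compose_power)
  moreover have "?G \<subseteq> cl G" using x cl_superset[of G] by (intro gen_least field_set_cl) auto
  moreover have "g y = fls_const c" if "y \<in> G" "\<phi> y = fls_const c" for y c
    using g(2)[OF that(1)] that(2) k by (simp add: f_def)
  ultimately show ?thesis using that sub by blast
qed

text \<open>Each new element may raise the ramification \<open>r\<close>, so a single embedding need
  not reach all of \<open>cl G\<close>.\<close>

lemma series_emb_algebraic_finite: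
  assumes "finite S" "series_emb D G \<phi> r Q D' u" "derivation D" "S \<subseteq> cl G"
  shows "\<exists>G' \<phi>' r'. series_emb D G' \<phi>' r' Q D' u \<and> G \<subseteq> G' \<and> S \<subseteq> G' \<and>
    (\<forall>y\<in>G. \<phi>' y $$ 0 = \<phi> y $$ 0) \<and> G' \<subseteq> cl G \<and>
    (\<forall>y\<in>G. \<forall>c. \<phi> y = fls_const c \<longrightarrow> \<phi>' y = fls_const c)"
  using assms(1,4)
proof (induction S)
  case empty
  then show ?case using assms(2) cl_superset by blast
next
  case (insert x S)
  then obtain G1 \<phi>1 r1 where 1: "series_emb D G1 \<phi>1 r1 Q D' u" "G \<subseteq> G1" "S \<subseteq> G1"
    "\<forall>y\<in>G. \<phi>1 y $$ 0 = \<phi> y $$ 0" "G1 \<subseteq> cl G" "\<forall>y\<in>G. \<forall>c. \<phi> y = fls_const c \<longrightarrow> \<phi>1 y = fls_const c"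
    by auto
  have "x \<in> cl G1" using insert.prems cl_mono[OF 1(2)] by auto
  then obtain G2 \<phi>2 r2 where 2: "series_emb D G2 \<phi>2 r2 Q D' u" "G1 \<subseteq> G2" "x \<in> G2"
    "\<And>y. y \<in> G1 \<Longrightarrow> \<phi>2 y $$ 0 = \<phi>1 y $$ 0" "G2 \<subseteq> cl G1"
    "\<And>y c. y \<in> G1 \<Longrightarrow> \<phi>1 y = fls_const c \<Longrightarrow> \<phi>2 y = fls_const c"
    using series_emb_algebraic[OF 1(1) assms(3)] by metis
  have "G \<subseteq> G2" "insert x S \<subseteq> G2" "\<forall>y\<in>G. \<phi>2 y $$ 0 = \<phi> y $$ 0" using 1 2 by auto
  moreover have "G2 \<subseteq> cl G" using 2(5) cl_minimal[OF 1(5)] by blast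
  moreover have "\<forall>y\<in>G. \<forall>c. \<phi> y = fls_const c \<longrightarrow> \<phi>2 y = fls_const c" using 1(2,6) 2(6) by blast
  ultimately show ?case using 2(1) by blast
qed

text \<open>Transcendence on both sides removes every algebraic condition on \<open>l\<close>, and
  compatibility with the derivations need only be checked at \<open>x\<close>. Old images do not
  notice the passage to \<open>D''\<close>, which agrees with \<open>D'\<close> on their
  coefficients.\<close>

lemma series_emb_primitive:
  assumes emb: "series_emb D G \<phi> r Q D' u" and D: "derivation D"
    and Q': "diff_closed D'' Q'" "small Q'" "Q \<subseteq> Q'" "\<And>y. y \<in> Q \<Longrightarrow> D'' y = D' y"
    and x: "x \<notin> cl G" "D x \<in> G"
    and l: "l \<in> series_over Q'" "fls_der D'' (fls_const (D'' u / of_nat r) * fls_X) l = \<phi> (D x)"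
      "\<not> algebraic_elt (\<phi> ` G) l"
  obtains \<phi>' where "series_emb D (gen (insert x G)) \<phi>' r Q' D'' u" "\<And>y. y \<in> G \<Longrightarrow> \<phi>' y = \<phi> y" "\<phi>' x = l"
proof -
  note e = series_embD[OF emb]
  note G = e(1)
  have ax: "\<not> algebraic_elt G x" using x cl_eq_algebraic[OF G] by auto
  obtain g where g: "hom_on (gen (insert x G)) g" "\<And>h. h \<in> G \<Longrightarrow> g h = \<phi> h" "g x = l"
    using hom_on_extend_transcendental[OF G e(7) ax l(3)] by metis
  let ?G = "gen (insert x G)"
  have sub: "x \<in> ?G" "G \<subseteq> ?G" using gen_superset[of "insert x G"] by auto
  note D'' = diff_closedD(1)[OF Q'(1)]
  define E where "E = fls_der D'' (fls_const (D'' u / of_nat r) * fls_X)"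
  have E: "derivation E" unfolding E_def by (rule fls_der_derivation[OF D''])
  have EG: "\<phi> (D h) = E (\<phi> h)" if "h \<in> G" for h
    using e(9)[OF that] fls_der_cong[OF diff_closedD(1)[OF e(3)] D'' e(8)[OF that] Q'(4)] Q'(4)[OF e(5)]
    by (simp add: E_def)
  have comm: "D y \<in> ?G \<and> g (D y) = E (g y)" if "y \<in> ?G" for y
  proof (rule hom_on_derivation_commute[OF D E g(1) _ that])
    fix a assume "a \<in> insert x G"
    then show "D a \<in> ?G \<and> g (D a) = E (g a)"
      using g(2,3) x(2) l(2) EG e(2) sub by (auto simp: E_def)
  qed
  have ser: "g y \<in> series_over Q'" if "y \<in> ?G" for y
  proof (rule hom_on_gen_image[OF g(1) series_over_field_set[OF diff_closedD(2)[OF Q'(1)]] _ that])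
    fix a assume "a \<in> insert x G"
    then show "g a \<in> series_over Q'" using g(2,3) l(1) e(8) Q'(3) by (auto simp: series_over_def)
  qed
  have "series_emb D ?G g r Q' D'' u"
    unfolding series_emb_def using gen_field_set comm e Q' g(1) ser by (auto simp: E_def)
  then show ?thesis using that g by blast
qed

end

context large_field
begin

lemma log_tower_single:
  assumes "a \<in> Q" "a \<noteq> 0" "D x = D a / a"
  shows "log_tower D Q (cl (insert x Q))"
  using log_tower.log[OF log_tower.base assms] .

text \<open>Always adjoining a new logarithm \<open>lam\<close> of the leading coefficient makes the
  image of \<open>x\<close> transcendental. \<open>Q'\<close> may get new constants; this is
  harmless for the elementary part.\<close>

lemma series_emb_log_fresh:
  assumes emb: "series_emb D G \<phi> r Q D' u" and D: "derivation D"
    and a: "a \<in> G" "a \<noteq> 0" and x: "D x = D a / a" "x \<notin> cl G"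
  obtains G' \<phi>' Q' D'' where "series_emb D G' \<phi>' r Q' D'' u" "G \<subseteq> G'" "x \<in> G'"
    "\<And>y. y \<in> G \<Longrightarrow> \<phi>' y = \<phi> y" "log_tower D'' Q Q'" "\<And>y. y \<in> Q \<Longrightarrow> D'' y = D' y"
proof -
  note e = series_embD[OF emb]
  note G = e(1) and FQ = diff_closedD(4)[OF e(3)]
  define b where "b = \<phi> a $$ fls_subdegree (\<phi> a)"
  have fa: "\<phi> a \<noteq> 0" using hom_on_eq_0_iff[OF G e(7) a(1)] a(2) by simp
  have b: "b \<in> Q" "b \<noteq> 0" using fa e(8)[OF a(1)] by (auto simp: b_def series_over_def)
  obtain D'' lam where D'': "derivation D''" "lam \<notin> Q" "\<And>x. x \<in> Q \<Longrightarrow> D'' x = D' x" "D'' lam = D' b / b"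
    "diff_closed D'' Q"
    using fresh_derivation[OF e(3,4), of "D' b / b"] by metis
  have lamb: "D'' lam = D'' b / b" using D''(3,4) b by simp
  obtain z where z: "z \<in> series_over Q" "vanishes_below 1 z"
    "fls_der D'' (fls_const (D'' u / of_nat r) * fls_X) (fls_const (lam + of_int (fls_subdegree (\<phi> a)) * u / of_nat r) + z) =
     fls_der D'' (fls_const (D'' u / of_nat r) * fls_X) (\<phi> a) / \<phi> a"
    using log_series[OF D''(1) diff_closedD(2)[OF e(3)] fa e(8)[OF a(1)] lamb[unfolded b_def], of u r] by metis
  define Q' where "Q' = cl (insert lam Q)"
  have sub: "Q \<subseteq> Q'" "lam \<in> Q'" using cl_superset[of "insert lam Q"] by (auto simp: Q'_def)
  have Q': "diff_closed D'' Q'" unfolding Q'_def by (rule diff_closed_log[OF D''(5) b(1) lamb])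
  have sQ': "small Q'" unfolding Q'_def by (rule small_cl_insert[OF FQ e(4)])
  define w where "w = of_int (fls_subdegree (\<phi> a)) * u / of_nat r"
  have wQ: "w \<in> Q" unfolding w_def
    using e(5) by (intro fs_divide[OF FQ] fs_mult[OF FQ] fs_of_int[OF FQ] fs_of_nat[OF FQ])
  define l where "l = fls_const (lam + w) + z"
  have l': "l = fls_const lam + (fls_const w + z)" by (simp add: l_def fls_plus_const flip: add.assoc)
  have wz: "fls_const w + z \<in> series_over Q"
    using wQ z(1) fs_add[OF FQ] by (auto simp: series_over_def)
  have DxG: "D x \<in> G" unfolding x(1) using a e(2) by (intro fs_divide[OF G])
  have lser: "l \<in> series_over Q'"
  proof -
    have "fls_const lam \<in> series_over Q'" using sub fs_0[OF FQ] by (auto simp: series_over_def)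
    moreover have "fls_const w + z \<in> series_over Q'"
      using wz sub(1) unfolding series_over_def by blast
    ultimately show ?thesis
      unfolding l' by (rule fs_add[OF series_over_field_set[OF diff_closedD(2)[OF Q']]])
  qed
  have El: "fls_der D'' (fls_const (D'' u / of_nat r) * fls_X) l = \<phi> (D x)"
  proof -
    have "\<phi> (D x) = \<phi> (D a) / \<phi> a" unfolding x(1) by (rule hom_on_divide[OF G e(7) e(2)[OF a(1)] a(1)])
    also have "\<phi> (D a) = fls_der D'' (fls_const (D'' u / of_nat r) * fls_X) (\<phi> a)"
      using e(9)[OF a(1)] fls_der_cong[OF diff_closedD(1)[OF e(3)] D''(1) e(8)[OF a(1)] D''(3)] D''(3)[OF e(5)]
      by simp
    finally show ?thesis using z(3) by (simp add: l_def w_def)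
  qed
  have tr: "\<not> algebraic_elt (\<phi> ` G) l"
    unfolding l' using e(8)
    by (intro const_plus_series_transcendental[OF diff_closedD(2)[OF e(3)] D''(2) wz field_set_image[OF G e(7)]]) auto
  obtain \<phi>' where "series_emb D (gen (insert x G)) \<phi>' r Q' D'' u" "\<And>y. y \<in> G \<Longrightarrow> \<phi>' y = \<phi> y"
    using series_emb_primitive[OF emb D Q' sQ' sub(1) D''(3) x(2) DxG lser El tr] by metis
  moreover have "log_tower D'' Q Q'" unfolding Q'_def by (rule log_tower_single[of b, OF b lamb])
  ultimately show ?thesis using that[of "gen (insert x G)" \<phi>' Q' D''] D''(3) gen_superset[of "insert x G"] by auto
qed

text \<open>The source and the target derivations agree on the base field only.\<close>
theorem series_emb_tower:
  assumes "log_tower D N T" "derivation D" "series_emb D G \<phi> r Q D' u" "N \<subseteq> cl G" "finite S" "S \<subseteq> T"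
  shows "\<exists>G' \<phi>' r' Q' D''. series_emb D G' \<phi>' r' Q' D'' u \<and> G \<subseteq> G' \<and> S \<subseteq> G' \<and>
    (\<forall>y\<in>G. \<phi>' y $$ 0 = \<phi> y $$ 0) \<and> log_tower D'' Q Q' \<and> (\<forall>y\<in>Q. D'' y = D' y)"
  using assms
proof (induction arbitrary: S rule: log_tower.induct)
  case base
  have "S \<subseteq> cl G" using base.prems(3,5) by blast
  from series_emb_algebraic_finite[OF base.prems(4,2,1) this]
  show ?case using log_tower.base by metis
next
  case (log T a x)
  have "\<forall>s\<in>S. \<exists>Y. finite Y \<and> Y \<subseteq> insert x T \<and> s \<in> cl Y"
  proof
    fix s assume "s \<in> S"
    then have "s \<in> cl (insert x T)" using log.prems by blast
    then show "\<exists>Y. finite Y \<and> Y \<subseteq> insert x T \<and> s \<in> cl Y" by (rule cl_finite_character) blast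
  qed
  then obtain Y where Y: "\<And>s. s \<in> S \<Longrightarrow> finite (Y s) \<and> Y s \<subseteq> insert x T \<and> s \<in> cl (Y s)" by metis
  \<comment> \<open>What has to be reached one level lower: the argument \<open>a\<close> of the
    logarithm and, apart from \<open>x\<close>, the finitely many elements over which
    \<open>S\<close> is algebraic.\<close>
  define Z where "Z = insert a ((\<Union>s\<in>S. Y s) - {x})"
  have Z: "finite Z" "Z \<subseteq> T" using Y log.prems(4) log.hyps(2) by (auto simp: Z_def)
  obtain G1 \<phi>1 r1 Q1 D1 where 1: "series_emb D G1 \<phi>1 r1 Q1 D1 u" "G \<subseteq> G1" "Z \<subseteq> G1"
    "\<forall>y\<in>G. \<phi>1 y $$ 0 = \<phi> y $$ 0" "log_tower D1 Q Q1" "\<forall>y\<in>Q. D1 y = D' y"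
    using log.IH[OF log.prems(1,2,3) Z] by blast
  have aG1: "a \<in> G1" using 1(3) by (auto simp: Z_def)
  obtain G2 \<phi>2 r2 Q2 D2 where 2: "series_emb D G2 \<phi>2 r2 Q2 D2 u" "G1 \<subseteq> G2" "x \<in> G2"
    "\<forall>y\<in>G1. \<phi>2 y $$ 0 = \<phi>1 y $$ 0" "log_tower D2 Q1 Q2" "\<forall>y\<in>Q1. D2 y = D1 y"
  proof (cases "x \<in> cl G1")
    case True
    show ?thesis
      by (rule series_emb_algebraic[OF 1(1) log.prems(1) True]) (rule that[of _ _ _ Q1 D1], auto intro: log_tower.base)
  next
    case False
    show ?thesis
      by (rule series_emb_log_fresh[OF 1(1) log.prems(1) aG1 log.hyps(3,4) False]) (rule that, auto)
  qed
  have "S \<subseteq> cl G2"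
  proof
    fix s assume s: "s \<in> S"
    then have "Y s \<subseteq> G2" using Y[OF s] 1(3) 2(2,3) by (auto simp: Z_def)
    then show "s \<in> cl G2" using Y[OF s] cl_mono by blast
  qed
  from series_emb_algebraic_finite[OF log.prems(4) 2(1) log.prems(1) this]
  obtain G3 \<phi>3 r3 where 3: "series_emb D G3 \<phi>3 r3 Q2 D2 u" "G2 \<subseteq> G3" "S \<subseteq> G3"
    "\<forall>y\<in>G2. \<phi>3 y $$ 0 = \<phi>2 y $$ 0" by blast
  have QQ: "Q \<subseteq> Q1" by (rule log_tower_superset[OF 1(5)])
  have t2: "log_tower D2 Q Q1" by (rule log_tower_cong[OF 1(5)]) (use 2(6) in auto)
  have "G \<subseteq> G3" using 1(2) 2(2) 3(2) by blast
  moreover have "\<forall>y\<in>G. \<phi>3 y $$ 0 = \<phi> y $$ 0"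
    using 1(2,4) 2(2,4) 3(4) by (metis subsetD)
  moreover have "\<forall>y\<in>Q. D2 y = D' y" using 1(6) 2(6) QQ by (metis subsetD)
  moreover have "log_tower D2 Q Q2" by (rule log_tower_trans[OF 2(5) t2])
  ultimately show ?case using 3(1,3) by blast
qed

text \<open>Constant terms of series in the exponential turn an antiderivative lying above an exponential
  into one that avoids it.\<close>
lemma eliminate_exponential:
  assumes P: "diff_closed D P" "small P" and u: "u \<in> P" and t: "D t = t * D u"
    and T: "log_tower D (cl (insert t P)) T" and E: "E \<in> T" "D E \<in> P"
  obtains D' Q E' where "derivation D'" "log_tower D' P Q" "\<And>x. x \<in> P \<Longrightarrow> D' x = D x" "E' \<in> Q" "D' E' = D E"
proof (cases "t \<in> P")
  case True
  then have "cl (insert t P) = P" using diff_closedD(2)[OF P(1)] by (simp add: insert_absorb)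
  then show ?thesis using that[of D T E] T E diff_closedD(1)[OF P(1)] by simp
next
  case False
  note D = diff_closedD(1)[OF P(1)]
  obtain \<phi> where \<phi>: "series_emb D (gen (insert t P)) \<phi> 1 P D u" "\<And>p. p \<in> P \<Longrightarrow> \<phi> p = fls_const p"
    using series_emb_base[OF P u False t] by metis
  have "cl (insert t P) \<subseteq> cl (gen (insert t P))" by simp
  from series_emb_tower[OF T D \<phi>(1) this, of "{E}"] E(1)
  obtain G' \<phi>' r' Q' D'' where 1: "series_emb D G' \<phi>' r' Q' D'' u" "gen (insert t P) \<subseteq> G'" "E \<in> G'"
    "\<forall>y\<in>gen (insert t P). \<phi>' y $$ 0 = \<phi> y $$ 0" "log_tower D'' P Q'" "\<forall>y\<in>P. D'' y = D y" by auto
  note e = series_embD[OF 1(1)]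
  have "D E \<in> gen (insert t P)" using E(2) gen_superset[of "insert t P"] by auto
  \<comment> \<open>As an element of \<open>P\<close>, \<open>D E\<close> starts out as a constant
    series, and extensions of the embedding keep constant terms.\<close>
  then have "\<phi>' (D E) $$ 0 = D E" using 1(4) \<phi>(2)[OF E(2)] by simp
  then have "D'' (\<phi>' E $$ 0) = D E"
    using e(9)[OF 1(3)] fls_der_nth[OF diff_closedD(1)[OF e(3)]] by simp
  moreover have "\<phi>' E $$ 0 \<in> Q'" using e(8)[OF 1(3)] by (simp add: series_over_def)
  ultimately show ?thesis using that[of D'' Q' "\<phi>' E $$ 0"] 1(5,6) diff_closedD(1)[OF e(3)] by auto
qed

text \<open>Exponentials are removed from the top downwards: logarithmic steps are moved into the
  logarithmic tower above until an exponential step is met, to which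
  \<open>eliminate_exponential\<close> applies. That works at each level because \<open>D E\<close>
  lies at the bottom.\<close>

theorem eliminate_exponentials:
  assumes "elem_tower D N T0" "diff_closed D N" "small N" "log_tower D T0 T" "E \<in> T" "D E \<in> N"
  shows "\<exists>D' Q E'. derivation D' \<and> log_tower D' N Q \<and> (\<forall>x\<in>N. D' x = D x) \<and> E' \<in> Q \<and> D' E' = D E"
proof -
  define D0 where "D0 = D"
  define g where "g = D E"
  \<comment> \<open>Quantified over \<open>D\<close>, since each elimination returns a derivation
    that agrees with the original \<open>D0\<close> only on the tower still left.\<close>
  have "diff_closed D0 N \<Longrightarrow> small N \<Longrightarrow> (\<And>D T E. derivation D \<Longrightarrow> (\<And>x. x \<in> T0 \<Longrightarrow> D x = D0 x) \<Longrightarrow>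
      log_tower D T0 T \<Longrightarrow> E \<in> T \<Longrightarrow> D E = g \<Longrightarrow> g \<in> N \<Longrightarrow>
      \<exists>D' Q E'. derivation D' \<and> log_tower D' N Q \<and> (\<forall>x\<in>N. D' x = D0 x) \<and> E' \<in> Q \<and> D' E' = g)"
    using assms(1)[folded D0_def]
  proof (induction rule: elem_tower.induct)
    case base
    then show ?case by blast
  next
    case (log Q a x)
    have xQ: "insert x Q \<subseteq> cl (insert x Q)" by (rule cl_superset)
    have "D x = D a / a" using log.hyps log.prems(4)[of x] log.prems(4)[of a] xQ by auto
    then have "log_tower D Q (cl (insert x Q))" by (rule log_tower_single[OF log.hyps(2,3)])
    from log_tower_trans[OF log.prems(5) this] have "log_tower D Q T" .
    from log.IH[OF log.prems(1-3) _ this log.prems(6-8)] show ?case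
      using log.prems(4) xQ by blast
  next
    case (exp Q u x)
    have xQ: "insert x Q \<subseteq> cl (insert x Q)" by (rule cl_superset)
    have DD: "D y = D0 y" if "y \<in> insert x Q" for y using exp.prems(4) that xQ by blast
    have dQ0: "diff_closed D0 Q" by (rule elem_tower_diff_closed[OF exp.hyps(1) exp.prems(1)])
    then have dQ: "diff_closed D Q" using exp.prems(3) DD unfolding diff_closed_def by simp
    have sQ: "small Q" by (rule elem_tower_small[OF exp.hyps(1) exp.prems(1,2)])
    have Dx: "D x = x * D u" using exp.hyps(2,3) DD by simp
    have "D E \<in> Q" using elem_tower_superset[OF exp.hyps(1)] exp.prems(7,8) by auto
    from eliminate_exponential[OF dQ sQ exp.hyps(2) Dx exp.prems(5,6) this]
    obtain D' R E' where "derivation D'" "log_tower D' Q R" "\<And>x. x \<in> Q \<Longrightarrow> D' x = D x" "E' \<in> R" "D' E' = D E"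
      by metis
    with exp.IH[OF exp.prems(1,2), of D' R E'] DD exp.prems(7,8) show ?case by auto
  qed
  from this[OF assms(2)[folded D0_def] assms(3) _ _ assms(4,5) _ assms(6)[folded g_def]]
  show ?thesis using diff_closedD(1)[OF assms(2)] by (simp add: D0_def g_def)
qed

end

section \<open>Targets without new constants\<close>

text \<open>Constants stay in \<open>P\<close>, and no nontrivial power of \<open>exp u\<close> with \<open>D u = w\<close> appears in \<open>Q\<close>.\<close>
definition tame :: "('a::field \<Rightarrow> 'a) \<Rightarrow> 'a set \<Rightarrow> 'a set \<Rightarrow> 'a \<Rightarrow> bool" where
  "tame D Q P w \<longleftrightarrow> (\<forall>y\<in>Q. D y = 0 \<longrightarrow> y \<in> P) \<and>
     (\<forall>y\<in>Q. \<forall>n. n \<noteq> 0 \<longrightarrow> D y = of_int n * w * y \<longrightarrow> y = 0)"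

text \<open>A coefficient at \<open>t ^ n\<close> satisfies an equation of fractional weight
  \<open>n / r\<close>; its \<open>r\<close>-th power has integral weight and so falls under
  \<open>tame\<close>.\<close>

lemma tame_rational:
  fixes D :: "'a::field_char_0 \<Rightarrow> 'a"
  assumes D: "diff_closed D Q" and t: "tame D Q P w" and r: "r > 0" and n: "n \<noteq> 0"
    and y: "y \<in> Q" "D y + w / of_nat r * of_int n * y = 0"
  shows "y = 0"
proof -
  note d = diff_closedD(1)[OF D]
  have Dy: "D y = - (w / of_nat r * of_int n * y)" using y(2) by (simp add: eq_neg_iff_add_eq_0)
  obtain k where k: "r = Suc k" using r gr0_implies_Suc by blast
  have "D (y ^ r) = of_nat r * y ^ (r - 1) * D y" by (rule der_power[OF d])
  also have "\<dots> = of_int (- n) * w * y ^ r"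
    unfolding Dy using r by (simp add: k del: of_nat_Suc)
  finally have "D (y ^ r) = of_int (- n) * w * y ^ r" .
  moreover have "y ^ r \<in> Q" using y(1) by (intro fs_power diff_closedD(4)[OF D])
  ultimately have "y ^ r = 0" using t n unfolding tame_def by (metis neg_equal_0_iff_equal)
  then show ?thesis by simp
qed

text \<open>Expansion at infinity: the absence of an antiderivative in \<open>Q\<close> excludes new
  constants, and an exponential in the extension would produce one in \<open>Q\<close>.\<close>

lemma tame_primitive:
  fixes D :: "'a::field_char_0 \<Rightarrow> 'a"
  assumes Q: "diff_closed D Q" and t: "tame D Q P w" and w: "w \<in> Q"
    and lam: "lam \<notin> Q" "D lam \<in> Q" "\<And>b. b \<in> Q \<Longrightarrow> D b \<noteq> D lam"
  shows "tame D (cl (insert lam Q)) P w"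
  unfolding tame_def
proof (intro conjI ballI allI impI)
  fix y assume "y \<in> cl (insert lam Q)" "D y = 0"
  then show "y \<in> P" using primitive_extension_constants[OF Q lam] t by (auto simp: tame_def)
next
  fix y and n :: int assume y: "y \<in> cl (insert lam Q)" "D y = of_int n * w * y" and n: "n \<noteq> 0"
  show "y = 0"
  proof (rule ccontr)
    assume "y \<noteq> 0"
    have "of_int n * w \<in> Q" using w diff_closedD(4)[OF Q] by (auto intro: fs_mult fs_of_int)
    from primitive_extension_exponential[OF Q lam(1,2) y(1) \<open>y \<noteq> 0\<close> y(2) this]
    obtain m c where c: "m > 0" "c \<in> Q" "c \<noteq> 0" "D c = of_nat m * (of_int n * w) * c" by metis
    have "D c = of_int (int m * n) * w * c" using c(4) by (simp add: mult.assoc)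
    moreover have "int m * n \<noteq> 0" using c(1) n by simp
    ultimately show False using t c(2,3) unfolding tame_def by blast
  qed
qed

context large_field
begin

text \<open>The coefficient satisfies a homogeneous exponential equation, whose nonzero solutions
  \<open>tame\<close> forbids.\<close>

lemma tame_series:
  assumes emb: "series_emb D G \<phi> r Q D' u" and t: "tame D' Q P (D' u)" and x: "x \<in> G"
    and n: "n \<noteq> 0" "\<phi> (D x) $$ n = 0"
  shows "\<phi> x $$ n = 0"
proof -
  note e = series_embD[OF emb]
  have "D' (\<phi> x $$ n) + D' u / of_nat r * of_int n * \<phi> x $$ n = 0"
    using n(2) e(9)[OF x] fls_der_nth[OF diff_closedD(1)[OF e(3)]] by simp
  then show ?thesis
    using tame_rational[OF e(3) t e(6) n(1)] e(8)[OF x] by (simp add: series_over_def)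
qed

lemma series_emb_logarithmic:
  assumes emb: "series_emb D G \<phi> r Q D' u" and a: "a \<in> G" "a \<noteq> 0"
  defines "m \<equiv> fls_subdegree (\<phi> a)"
  shows "vanishes_below 0 (\<phi> (D a / a))"
    "\<phi> (D a / a) $$ 0 = D' (\<phi> a $$ m) / (\<phi> a $$ m) + D' u / of_nat r * of_int m"
proof -
  note e = series_embD[OF emb]
  have "\<phi> (D a / a) = \<phi> (D a) / \<phi> a" by (rule hom_on_divide[OF e(1,7) e(2)[OF a(1)] a(1)])
  moreover have "\<phi> a \<noteq> 0" using hom_on_eq_0_iff[OF e(1,7) a(1)] a(2) by simp
  ultimately show "vanishes_below 0 (\<phi> (D a / a))"
    "\<phi> (D a / a) $$ 0 = D' (\<phi> a $$ m) / (\<phi> a $$ m) + D' u / of_nat r * of_int m"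
    using fls_der_logarithmic[OF diff_closedD(1)[OF e(3)]] e(9)[OF a(1)] by (simp_all add: m_def)
qed

text \<open>If the new logarithm already has an antiderivative in \<open>Q\<close>, that antiderivative is used as its
  constant term; this keeps the constants of \<open>Q\<close> under control.\<close>
lemma series_emb_log_tame:
  assumes emb: "series_emb D G \<phi> r Q D' u" and D: "derivation D" and t: "tame D' Q P (D' u)"
    and a: "a \<in> G" "a \<noteq> 0" and x: "D x = D a / a"
    and const: "\<And>y. y \<in> cl (insert x G) \<Longrightarrow> D y = 0 \<Longrightarrow> y \<in> G"
  obtains G' \<phi>' Q' D'' where "series_emb D G' \<phi>' r Q' D'' u" "G \<subseteq> G'" "x \<in> G'" "G' \<subseteq> cl (insert x G)"
    "\<And>y. y \<in> G \<Longrightarrow> \<phi>' y = \<phi> y" "log_tower D'' Q Q'" "\<And>y. y \<in> Q \<Longrightarrow> D'' y = D' y"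
    "tame D'' Q' P (D'' u)" "vanishes_below 0 (\<phi>' x)"
proof (cases "x \<in> cl G")
  case True
  note e = series_embD[OF emb]
  note G = e(1)
  have DxG: "D x \<in> G" unfolding x using a e(2) by (intro fs_divide[OF G])
  have "algebraic_elt G x" using True cl_eq_algebraic[OF G] by auto
  \<comment> \<open>By the trace, \<open>x\<close> differs from an element of \<open>G\<close> by a
    constant, and so already lies in \<open>G\<close>.\<close>
  then obtain b where b: "b \<in> G" "D b = D x" using algebraic_antiderivative[OF D G e(2)] DxG by metis
  have "x \<in> cl (insert x G)" "b \<in> cl (insert x G)" using b(1) cl_superset[of "insert x G"] by auto
  then have "x - b \<in> cl (insert x G)" by (rule fs_diff[OF field_set_cl])
  moreover have "D (x - b) = 0" using b by (simp add: der_diff[OF D])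
  ultimately have "x - b \<in> G" by (rule const)
  then have xG: "x \<in> G" using fs_add[OF G _ b(1), of "x - b"] by simp
  \<comment> \<open>The expansion of \<open>D x\<close> has no polar part, and tameness carries this
    over to \<open>x\<close>.\<close>
  have "\<phi> x $$ n = 0" if "n < 0" for n
    using tame_series[OF emb t xG, of n] that series_emb_logarithmic(1)[OF emb a]
    by (simp add: x vanishes_below_def)
  then have "vanishes_below 0 (\<phi> x)" by (simp add: vanishes_below_def)
  moreover have "G \<subseteq> cl (insert x G)" using cl_superset[of "insert x G"] by auto
  ultimately show ?thesis
    using that[of G \<phi> Q D'] emb xG t log_tower.base[of D' Q] by simp
next
  case False
  note e = series_embD[OF emb]
  note G = e(1) and FQ = diff_closedD(4)[OF e(3)]
  have DxG: "D x \<in> G" unfolding x using a e(2) by (intro fs_divide[OF G])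
  have sub: "G \<subseteq> gen (insert x G)" "x \<in> gen (insert x G)" "gen (insert x G) \<subseteq> cl (insert x G)"
    using gen_superset[of "insert x G"] gen_subset_cl by auto
  define b where "b = \<phi> a $$ fls_subdegree (\<phi> a)"
  have fa: "\<phi> a \<noteq> 0" using hom_on_eq_0_iff[OF G e(7) a(1)] a(2) by simp
  have b: "b \<in> Q" "b \<noteq> 0" using fa e(8)[OF a(1)] by (auto simp: b_def series_over_def)
  have bQ: "D' b / b \<in> Q" using b diff_closedD(3)[OF e(3) b(1)] by (intro fs_divide[OF FQ])
  obtain lam D'' Q' where L: "diff_closed D'' Q'" "small Q'" "Q \<subseteq> Q'" "\<And>y. y \<in> Q \<Longrightarrow> D'' y = D' y"
    "lam \<in> Q'" "D'' lam = D' b / b" "log_tower D'' Q Q'" "tame D'' Q' P (D'' u)"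
  proof (cases "\<exists>lam\<in>Q. D' lam = D' b / b")
    case True
    then obtain lam where "lam \<in> Q" "D' lam = D' b / b" by blast
    then show ?thesis
      by (intro that[of D' Q lam]) (use e t in \<open>auto intro: log_tower.base\<close>)
  next
    case no: False
    obtain D'' lam where D'': "derivation D''" "lam \<notin> Q" "\<And>x. x \<in> Q \<Longrightarrow> D'' x = D' x" "D'' lam = D' b / b"
      "diff_closed D'' Q"
      using fresh_derivation[OF e(3,4), of "D' b / b"] by metis
    have lamb: "D'' lam = D'' b / b" using D''(3,4) b by simp
    have Q': "diff_closed D'' (cl (insert lam Q))" by (rule diff_closed_log[OF D''(5) b(1) lamb])
    have sQ': "small (cl (insert lam Q))" by (rule small_cl_insert[OF FQ e(4)])
    have tQ: "tame D'' Q P (D'' u)" using t D''(3) e(5) by (simp add: tame_def)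
    have "tame D'' (cl (insert lam Q)) P (D'' u)"
      by (rule tame_primitive[OF D''(5) tQ _ D''(2)])
         (use D''(3,4) e(5) diff_closedD(3)[OF e(3) e(5)] bQ no in auto)
    moreover have "insert lam Q \<subseteq> cl (insert lam Q)" by (rule cl_superset)
    ultimately show ?thesis
      using that[of D'' "cl (insert lam Q)" lam] Q' sQ' D''(3,4) log_tower_single[of b Q D'' lam, OF b lamb]
      by auto
  qed
  have lamb: "D'' lam = D'' b / b" using L(4,6) b by simp
  have FQ': "field_set Q'" by (rule diff_closedD(4)[OF L(1)])
  have faQ': "\<phi> a \<in> series_over Q'" using e(8)[OF a(1)] L(3) unfolding series_over_def by blast
  obtain z where z: "z \<in> series_over Q'" "vanishes_below 1 z"
    "fls_der D'' (fls_const (D'' u / of_nat r) * fls_X) (fls_const (lam + of_int (fls_subdegree (\<phi> a)) * u / of_nat r) + z) =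
     fls_der D'' (fls_const (D'' u / of_nat r) * fls_X) (\<phi> a) / \<phi> a"
    using log_series[OF diff_closedD(1)[OF L(1)] diff_closedD(2)[OF L(1)] fa faQ' lamb[unfolded b_def], of u r]
    by metis
  define l where "l = fls_const (lam + of_int (fls_subdegree (\<phi> a)) * u / of_nat r) + z"
  have uQ': "u \<in> Q'" using e(5) L(3) by blast
  have "lam + of_int (fls_subdegree (\<phi> a)) * u / of_nat r \<in> Q'"
    by (intro fs_add[OF FQ'] fs_divide[OF FQ'] fs_mult[OF FQ'] fs_of_int[OF FQ'] fs_of_nat[OF FQ'] L(5) uQ')
  then have "fls_const (lam + of_int (fls_subdegree (\<phi> a)) * u / of_nat r) \<in> series_over Q'"
    using fs_0[OF FQ'] by (simp add: series_over_def)
  then have lser: "l \<in> series_over Q'"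
    unfolding l_def using z(1) by (rule fs_add[OF series_over_field_set[OF diff_closedD(2)[OF L(1)]]])
  have lv: "vanishes_below 0 l" using z(2) by (simp add: l_def vanishes_below_def)
  define E where "E = fls_der D'' (fls_const (D'' u / of_nat r) * fls_X)"
  have E: "derivation E" unfolding E_def by (rule fls_der_derivation[OF diff_closedD(1)[OF L(1)]])
  have EG: "\<phi> (D h) = E (\<phi> h)" if "h \<in> G" for h
    using e(9)[OF that] fls_der_cong[OF diff_closedD(1)[OF e(3)] diff_closedD(1)[OF L(1)] e(8)[OF that] L(4)]
      L(4)[OF e(5)] by (simp add: E_def)
  have El: "E l = \<phi> (D x)"
    using z(3) EG[OF a(1)] unfolding x hom_on_divide[OF G e(7) e(2)[OF a(1)] a(1)] by (simp add: l_def E_def)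
  \<comment> \<open>Were \<open>l\<close> algebraic, the trace would give an antiderivative of
    \<open>D x\<close> in \<open>G\<close>; the difference to \<open>x\<close> is a constant, so
    \<open>x\<close> would be in \<open>G\<close>.\<close>
  have tr: "\<not> algebraic_elt (\<phi> ` G) l"
  proof
    assume al: "algebraic_elt (\<phi> ` G) l"
    have "E s \<in> \<phi> ` G" if s: "s \<in> \<phi> ` G" for s
    proof -
      obtain y where y: "y \<in> G" "s = \<phi> y" using s by blast
      then have "E s = \<phi> (D y)" using EG[OF y(1)] by simp
      then show ?thesis using e(2)[OF y(1)] by blast
    qed
    moreover have "E l \<in> \<phi> ` G" unfolding El using DxG by blast
    ultimately obtain s where s: "s \<in> \<phi> ` G" "E s = E l"
      using algebraic_antiderivative[OF E field_set_image[OF G e(7)] _ al] by metis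
    then obtain c where c: "c \<in> G" "s = \<phi> c" by blast
    have "\<phi> (D c) = \<phi> (D x)" using s(2) c El EG by simp
    then have "\<phi> (D c - D x) = 0" using hom_on_diff[OF G e(7) e(2)[OF c(1)] DxG] by simp
    then have "D c = D x" using hom_on_eq_0_iff[OF G e(7) fs_diff[OF G e(2)[OF c(1)] DxG]] by simp
    then have "D (x - c) = 0" by (simp add: der_diff[OF D])
    moreover have "x \<in> cl (insert x G)" "c \<in> cl (insert x G)" using c(1) cl_superset[of "insert x G"] by auto
    then have "x - c \<in> cl (insert x G)" by (rule fs_diff[OF field_set_cl])
    ultimately have "x - c \<in> G" using const by blast
    then have "x \<in> G" using fs_add[OF G _ c(1), of "x - c"] by simp
    then show False using False cl_superset[of G] by blast
  qed
  obtain \<phi>' where \<phi>': "series_emb D (gen (insert x G)) \<phi>' r Q' D'' u" "\<And>y. y \<in> G \<Longrightarrow> \<phi>' y = \<phi> y" "\<phi>' x = l"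
    using series_emb_primitive[OF emb D L(1-4) False DxG lser El[unfolded E_def] tr] by metis
  show ?thesis
    by (rule that[OF \<phi>'(1) sub]) (use \<phi>' L lv in auto)
qed

text \<open>Provides logarithms for terms \<open>c * (D b / b)\<close>. They belong to the
  elementary part, so fresh elements may be used freely.\<close>

lemma adjoin_logs:
  fixes n :: nat
  assumes "diff_closed D Q" "small Q" "\<And>i. i < n \<Longrightarrow> b i \<in> Q \<and> b i \<noteq> 0"
  shows "\<exists>D' Q' \<mu>. derivation D' \<and> log_tower D' Q Q' \<and> (\<forall>y\<in>Q. D' y = D y) \<and>
    (\<forall>i<n. \<mu> i \<in> Q' \<and> D' (\<mu> i) = D' (b i) / b i)"
  using assms(3)
proof (induction n)
  case 0
  then show ?case using log_tower.base diff_closedD(1)[OF assms(1)] by blast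
next
  case (Suc n)
  then obtain D1 Q1 \<mu> where 1: "derivation D1" "log_tower D1 Q Q1" "\<forall>y\<in>Q. D1 y = D y"
    "\<forall>i<n. \<mu> i \<in> Q1 \<and> D1 (\<mu> i) = D1 (b i) / b i" by auto
  have dQ: "diff_closed D1 Q" using assms(1) 1(1,3) by (auto simp: diff_closed_def)
  have Q1: "diff_closed D1 Q1" "small Q1"
    using log_tower_diff_closed[OF 1(2) dQ] log_tower_small[OF 1(2) dQ assms(2)] .
  have QQ1: "Q \<subseteq> Q1" by (rule log_tower_superset[OF 1(2)])
  obtain D2 lam where 2: "derivation D2" "\<And>y. y \<in> Q1 \<Longrightarrow> D2 y = D1 y" "D2 lam = D1 (b n) / b n"
    using fresh_derivation[OF Q1, of "D1 (b n) / b n"] by metis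
  have bn: "b n \<in> Q1" "b n \<noteq> 0" using Suc.prems[of n] QQ1 by auto
  have t1: "log_tower D2 Q Q1" by (rule log_tower_cong[OF 1(2)]) (use 2 in auto)
  have "log_tower D2 Q (cl (insert lam Q1))" by (rule log_tower.log[OF t1 bn]) (use 2 bn in auto)
  moreover have "\<forall>y\<in>Q. D2 y = D y" using 1(3) 2(2) QQ1 by auto
  moreover have "(\<mu>(n := lam)) i \<in> cl (insert lam Q1) \<and> D2 ((\<mu>(n := lam)) i) = D2 (b i) / b i" if "i < Suc n" for i
  proof (cases "i = n")
    case True
    then show ?thesis using 2 bn cl_superset[of "insert lam Q1"] by auto
  next
    case False
    then have "i < n" using that by simp
    then have "\<mu> i \<in> Q1" "D1 (\<mu> i) = D1 (b i) / b i" "b i \<in> Q1" using 1(4) Suc.prems[of i] QQ1 by auto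
    then show ?thesis using False 2(2) cl_superset[of "insert lam Q1"] by auto
  qed
  ultimately show ?case using 2(1) by blast
qed

lemma small_cl_finite:
  assumes "field_set F" "small F" "finite S"
  shows "small (cl (F \<union> S))"
  using assms(3)
proof (induction S)
  case (insert x S)
  have "small (cl (insert x (cl (F \<union> S))))"
    by (rule small_cl_insert[OF field_set_cl insert.IH])
  moreover have "cl (F \<union> insert x S) \<subseteq> cl (insert x (cl (F \<union> S)))"
    by (rule cl_mono) (use cl_superset[of "F \<union> S"] in auto)
  ultimately show ?case unfolding small_def using card_of_mono1 ordLeq_transitive by blast
qed (use assms small_cl in simp)

end

context large_field
begin

text \<open>Only exponentials need an argument. By the norm, a nonzero solution \<open>y\<close>
  gives some \<open>a\<close> in \<open>F\<close> with the logarithmic derivative of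
  \<open>th ^ N\<close>, where \<open>N \<noteq> 0\<close>. The quotient is a constant of
  \<open>K\<close>, hence in \<open>F\<close>; so \<open>th ^ N\<close> is in \<open>F\<close>, and
  \<open>th\<close> would be algebraic.\<close>

lemma tame_algebraic_closure:
  fixes D :: "'u \<Rightarrow> 'u"
  assumes D: "derivation D" and F: "field_set F" "\<And>x. x \<in> F \<Longrightarrow> D x \<in> F"
    and K: "field_set K" "F \<subseteq> K" "\<And>x. x \<in> K \<Longrightarrow> D x = 0 \<Longrightarrow> x \<in> F"
    and th: "th \<in> K" "th \<noteq> 0" "D th = th * w" "w \<in> F" "th \<notin> cl F"
  shows "tame D (cl F) (cl F) w"
  unfolding tame_def
proof (intro conjI ballI allI impI)
  fix y and n :: int assume y: "y \<in> cl F" "D y = of_int n * w * y" and n: "n \<noteq> 0"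
  show "y = 0"
  proof (rule ccontr)
    assume y0: "y \<noteq> 0"
    have nw: "of_int n * w \<in> F" using th(4) by (intro fs_mult[OF F(1)] fs_of_int[OF F(1)])
    have "algebraic_elt F y" using y(1) cl_eq_algebraic[OF F(1)] by auto
    then obtain m a where a: "m > 0" "a \<in> F" "a \<noteq> 0" "D a = of_nat m * (of_int n * w) * a"
      using algebraic_exponential[OF D F _ nw y(2) y0] by metis
    define N where "N = int m * n"
    have N0: "N \<noteq> 0" using a(1) n by (simp add: N_def)
    \<comment> \<open>Natural exponents for \<open>th ^ N\<close> with an integer \<open>N\<close>;
      at most one of them is positive.\<close>
    define p q where "p = nat N" and "q = nat (- N)"
    have pq: "int p - int q = N" by (simp add: p_def q_def)
    have dth: "d (th ^ k) = of_nat k * (d th / th) * th ^ k" if "derivation d" for d and k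
      using th(2) der_power[OF that, of th k] by (cases k) (simp_all add: field_simps)
    define s where "s = th ^ p / th ^ q"
    have s0: "s \<noteq> 0" using th(2) by (simp add: s_def)
    have ds: "d s = of_int N * (d th / th) * s" if d: "derivation d" for d
    proof -
      have "d s = (d (th ^ p) * th ^ q - th ^ p * d (th ^ q)) / (th ^ q)\<^sup>2"
        unfolding s_def using th(2) by (intro der_divide[OF d]) simp
      also have "\<dots> = (of_nat p - of_nat q) * (d th / th) * s"
        unfolding dth[OF d] s_def using th(2) by (simp add: field_simps power2_eq_square)
      also have "of_nat p - of_nat q = (of_int N :: 'u)" by (simp flip: pq)
      finally show ?thesis .
    qed
    have Da: "D a = of_int N * w * a" using a(4) by (simp add: N_def mult.assoc)
    have Ds: "D s = of_int N * w * s" using ds[OF D] th(2,3) by simp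
    have "D (a / s) = 0"
      unfolding der_divide[OF D s0] Da Ds by (simp add: mult.commute mult.left_commute)
    moreover have "a / s \<in> K"
      unfolding s_def using a(2) K(2) th(1) by (intro fs_divide[OF K(1)] fs_power[OF K(1)]) auto
    ultimately have "a / s \<in> F" by (rule K(3)[rotated])
    with a(2) have "a / (a / s) \<in> F" by (rule fs_divide[OF F(1)])
    moreover have "a / (a / s) = s" using a(3) by simp
    ultimately have sF: "s \<in> F" by metis
    \<comment> \<open>A derivation that kills \<open>F\<close> kills \<open>s\<close>, and
      \<open>s\<close> has \<open>N\<close> times the logarithmic derivative of
      \<open>th\<close>.\<close>
    have "th \<in> cl F"
      unfolding cl_def
    proof (intro CollectI allI impI)
      fix d assume d: "derivation d" "\<forall>a\<in>F. d a = 0"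
      then have "of_int N * (d th / th) * s = 0" using ds[OF d(1)] sF by simp
      then show "d th = 0" using N0 s0 th(2) by simp
    qed
    then show False using th(5) by blast
  qed
qed

lemma diff_closed_cl:
  fixes D :: "'u \<Rightarrow> 'u"
  assumes "derivation D" "\<And>a. a \<in> A \<Longrightarrow> D a \<in> cl A"
  shows "diff_closed D (cl A)"
  using assms cl_derivation_closed[OF assms(1)] by (auto simp: diff_closed_def)

text \<open>The closed field \<open>N\<close> contains every intermediate extension, so its
  hypothesis on constants supplies the one required for each single logarithm.\<close>

lemma series_emb_logs:
  fixes n :: nat
  assumes D: "derivation D" and emb: "series_emb D G \<phi> r Q D' u" and t: "tame D' Q P (D' u)"
    and h: "\<And>i. i < n \<Longrightarrow> h i \<in> G \<and> h i \<noteq> 0" and l: "\<And>i. i < n \<Longrightarrow> D (l i) = D (h i) / h i"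
    and N: "cl N = N" "G \<subseteq> N" "\<And>i. i < n \<Longrightarrow> l i \<in> N" and const: "\<And>y. y \<in> N \<Longrightarrow> D y = 0 \<Longrightarrow> y \<in> G"
  shows "\<exists>G' \<phi>' Q' D''. series_emb D G' \<phi>' r Q' D'' u \<and> G \<subseteq> G' \<and> G' \<subseteq> N \<and> (\<forall>y\<in>G. \<phi>' y = \<phi> y) \<and>
    log_tower D'' Q Q' \<and> (\<forall>y\<in>Q. D'' y = D' y) \<and> tame D'' Q' P (D'' u) \<and>
    (\<forall>i<n. l i \<in> G' \<and> vanishes_below 0 (\<phi>' (l i)))"
  using h l N(3)
proof (induction n)
  case 0
  then show ?case using emb t N log_tower.base[of D' Q] by blast
next
  case (Suc n)
  then obtain G1 \<phi>1 Q1 D1 where 1: "series_emb D G1 \<phi>1 r Q1 D1 u" "G \<subseteq> G1" "G1 \<subseteq> N" "\<forall>y\<in>G. \<phi>1 y = \<phi> y"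
    "log_tower D1 Q Q1" "\<forall>y\<in>Q. D1 y = D' y" "tame D1 Q1 P (D1 u)"
    "\<forall>i<n. l i \<in> G1 \<and> vanishes_below 0 (\<phi>1 (l i))"
    using less_Suc_eq by auto
  have hn: "h n \<in> G1" "h n \<noteq> 0" "D (l n) = D (h n) / h n" "l n \<in> N" using Suc.prems 1(2) by auto
  have sub: "cl (insert (l n) G1) \<subseteq> N" using 1(3) hn(4) cl_minimal[of "insert (l n) G1" N] N(1) by auto
  have cst: "y \<in> G1" if "y \<in> cl (insert (l n) G1)" "D y = 0" for y using const[of y] sub 1(2) that by blast
  obtain G2 \<phi>2 Q2 D2 where 2: "series_emb D G2 \<phi>2 r Q2 D2 u" "G1 \<subseteq> G2" "l n \<in> G2" "G2 \<subseteq> cl (insert (l n) G1)"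
    "\<And>y. y \<in> G1 \<Longrightarrow> \<phi>2 y = \<phi>1 y" "log_tower D2 Q1 Q2" "\<And>y. y \<in> Q1 \<Longrightarrow> D2 y = D1 y"
    "tame D2 Q2 P (D2 u)" "vanishes_below 0 (\<phi>2 (l n))"
    using series_emb_log_tame[OF 1(1) D 1(7) hn(1-3) cst] by metis
  have QQ1: "Q \<subseteq> Q1" by (rule log_tower_superset[OF 1(5)])
  have "log_tower D2 Q Q1" by (rule log_tower_cong[OF 1(5)]) (use 2(7) in auto)
  then have "log_tower D2 Q Q2" by (rule log_tower_trans[OF 2(6)])
  moreover have "G \<subseteq> G2" "G2 \<subseteq> N" using 1(2) 2(2,4) sub by auto
  moreover have "\<forall>y\<in>G. \<phi>2 y = \<phi> y" using 1(2,4) 2(5) by (metis subsetD)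
  moreover have "\<forall>y\<in>Q. D2 y = D' y" using 1(6) 2(7) QQ1 by (metis subsetD)
  moreover have "l i \<in> G2 \<and> vanishes_below 0 (\<phi>2 (l i))" if "i < Suc n" for i
  proof (cases "i = n")
    case False
    then have "i < n" using that by simp
    then have "l i \<in> G1" "vanishes_below 0 (\<phi>1 (l i))" using 1(8) by auto
    then show ?thesis using 2(2,5) by auto
  qed (use 2(3,9) in simp)
  ultimately show ?case using 2(1,8) by blast
qed

section \<open>Constant terms of the summands, and descent to the algebraic closure of
  \<open>F\<close>\<close>

text \<open>If \<open>h\<close> has a zero, the constant term is 0. If it has a pole, \<open>1 - h\<close> and \<open>- h\<close> have the same
  leading term, so with \<open>\<lambda>\<close> the constant term of \<open>l\<close> we get \<open>D' \<lambda> * \<lambda> ^ k\<close>, which has an antiderivative. If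
  \<open>h\<close> is a unit with constant term \<open>a \<noteq> 1\<close>, this is the polylogarithmic term of \<open>a\<close>; if \<open>a = 1\<close>, then
  \<open>\<lambda>\<close> is constant and only a logarithmic term remains, up to a derivative.\<close>
lemma polylog_constant_term:
  fixes k :: nat
  assumes emb: "series_emb D G \<phi> r Q D' u" and t: "tame D' Q P (D' u)"
    and P: "diff_closed D' P" "P \<subseteq> Q" "u \<in> P"
    and h: "h \<in> G" "h \<noteq> 0" "h \<noteq> 1" "\<phi> h \<in> series_over P"
    and l: "l \<in> G" "D l = D h / h" "vanishes_below 0 (\<phi> l)"
  defines "T \<equiv> \<phi> (D (1 - h) / (1 - h) * l ^ k) $$ 0"
  shows "(\<exists>a. a \<in> P \<and> a \<noteq> 0 \<and> a \<noteq> 1 \<and> D' (\<phi> l $$ 0) = D' a / a \<and> T = D' (1 - a) / (1 - a) * (\<phi> l $$ 0) ^ k) \<or>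
    (\<exists>e c b. e \<in> Q \<and> c \<in> P \<and> D' c = 0 \<and> b \<in> P \<and> b \<noteq> 0 \<and> T = D' e + c * (D' b / b))"
proof -
  note e = series_embD[OF emb]
  note G = e(1) and D' = diff_closedD(1)[OF e(3)] and FP = diff_closedD(4)[OF P(1)] and FQ = diff_closedD(4)[OF e(3)]
  have h1: "1 - h \<in> G" "1 - h \<noteq> 0" using h fs_diff[OF G fs_1[OF G]] by auto
  have DlG: "D (1 - h) / (1 - h) \<in> G" using h1 e(2) by (intro fs_divide[OF G])
  have phi1: "\<phi> (1 - h) = 1 - \<phi> h" using hom_on_diff[OF G e(7) fs_1[OF G] h(1)] e(7) by (simp add: hom_on_def)
  define m where "m = fls_subdegree (\<phi> h)"
  define a where "a = \<phi> h $$ m"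
  define m1 where "m1 = fls_subdegree (1 - \<phi> h)"
  define b where "b = (1 - \<phi> h) $$ m1"
  define lam where "lam = \<phi> l $$ 0"
  define v where "v = D' u / of_nat r"
  have fh: "\<phi> h \<noteq> 0" "1 - \<phi> h \<noteq> 0"
    using hom_on_eq_0_iff[OF G e(7) h(1)] hom_on_eq_0_iff[OF G e(7) h1(1)] h(2) h1(2) phi1 by auto
  have aP: "a \<in> P" "a \<noteq> 0" using h(4) fh by (auto simp: a_def m_def series_over_def)
  have bP: "b \<in> P" "b \<noteq> 0"
  proof -
    show "b \<noteq> 0" unfolding b_def m1_def using fh(2) by (rule nth_fls_subdegree_nonzero)
    have "1 \<in> series_over P" using fs_0[OF FP] fs_1[OF FP] by (simp add: series_over_def)
    then have "1 - \<phi> h \<in> series_over P"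
      using h(4) by (intro fs_diff[OF series_over_field_set[OF diff_closedD(2)[OF P(1)]]])
    then show "b \<in> P" by (simp add: b_def series_over_def)
  qed
  have lamQ: "lam \<in> Q" using e(8)[OF l(1)] by (simp add: lam_def series_over_def)
  have Dlam: "D' lam = D' a / a + v * of_int m"
  proof -
    have "\<phi> (D l) $$ 0 = D' lam" using e(9)[OF l(1)] fls_der_nth[OF D'] by (simp add: lam_def)
    then show ?thesis using series_emb_logarithmic(2)[OF emb h(1,2)] l(2) by (simp add: a_def m_def v_def)
  qed
  \<comment> \<open>Neither factor has a polar part, so the constant term of the product is the
    product of the constant terms.\<close>
  have T: "T = (D' b / b + v * of_int m1) * lam ^ k"
  proof -
    note s = series_emb_logarithmic[OF emb h1]
    have "\<phi> (D (1 - h) / (1 - h) * l ^ k) = \<phi> (D (1 - h) / (1 - h)) * \<phi> l ^ k"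
    proof -
      have hom: "\<phi> (x * y) = \<phi> x * \<phi> y" if "x \<in> G" "y \<in> G" for x y using e(7) that by (simp add: hom_on_def)
      show ?thesis unfolding hom[OF DlG fs_power[OF G l(1)]] hom_on_power[OF G e(7) l(1)] ..
    qed
    then show ?thesis
      using fls_times_nth_lowest[OF s(1), of 0 "\<phi> l ^ k"] vanishes_below_power[OF l(3), of k] s(2)
      by (simp add: T_def lam_def b_def m1_def v_def phi1)
  qed
  have below: "\<phi> h $$ n = 0" if "n < m" for n using that by (simp add: m_def fls_eq0_below_subdegree)
  consider "m < 0" | "m > 0" | "m = 0" "a \<noteq> 1" | "m = 0" "a = 1" by linarith
  then show ?thesis
  proof cases
    case 1
    have "m1 = m"
      unfolding m1_def by (rule fls_subdegree_eqI) (use 1 aP below in \<open>auto simp: a_def\<close>)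
    then have "b = - a" using 1 by (simp add: b_def a_def)
    then have "T = D' lam * lam ^ k" using T Dlam \<open>m1 = m\<close> by (simp add: der_uminus[OF D'])
    also have "\<dots> = D' (lam ^ Suc k / of_nat (Suc k))"
    proof -
      have ne: "of_nat (Suc k) \<noteq> (0 :: 'u)" by (simp del: of_nat_Suc)
      show ?thesis
        unfolding der_divide[OF D' ne] der_power[OF D'] der_of_nat[OF D']
        using ne by (simp add: power2_eq_square mult.commute del: of_nat_Suc)
    qed
    finally have "T = D' (lam ^ Suc k / of_nat (Suc k)) + 0 * (D' 1 / 1)" by simp
    moreover have "lam ^ Suc k / of_nat (Suc k) \<in> Q"
      using lamQ by (intro fs_divide[OF FQ] fs_power[OF FQ] fs_of_nat[OF FQ])
    ultimately show ?thesis
      by (intro disjI2 exI[of _ "lam ^ Suc k / of_nat (Suc k)"] exI[of _ 0] exI[of _ 1] conjI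
          fs_0[OF FP] fs_1[OF FP] der_0[OF D'] one_neq_zero)
  next
    case 2
    then have h0: "\<phi> h $$ 0 = 0" by (rule below)
    have "m1 = 0"
      unfolding m1_def by (rule fls_subdegree_eqI) (use 2 h0 below in auto)
    then have "b = 1" using h0 by (simp add: b_def)
    then have "T = D' 0 + 0 * (D' 1 / 1)" using T \<open>m1 = 0\<close> by (simp add: der_1[OF D'] der_0[OF D'])
    then show ?thesis
      by (intro disjI2 exI[of _ 0] exI[of _ 1] conjI
          fs_0[OF FQ] fs_0[OF FP] fs_1[OF FP] der_0[OF D'] one_neq_zero)
  next
    case 3
    have "m1 = 0"
      unfolding m1_def by (rule fls_subdegree_eqI) (use 3 below in \<open>auto simp: a_def\<close>)
    then have "b = 1 - a" using 3 by (simp add: b_def a_def)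
    then have "T = D' (1 - a) / (1 - a) * lam ^ k" using T \<open>m1 = 0\<close> by simp
    moreover have "D' lam = D' a / a" using Dlam 3 by simp
    ultimately show ?thesis
      unfolding lam_def by (intro disjI1 exI[of _ a] conjI aP 3(2))
  next
    case 4
    then have "D' lam = 0" using Dlam by (simp add: der_1[OF D'])
    then have lamP: "lam \<in> P" using t lamQ by (simp add: tame_def)
    have Dlk: "D' (lam ^ k) = 0" using \<open>D' lam = 0\<close> by (simp add: der_power[OF D'])
    \<comment> \<open>The order \<open>m1\<close> of \<open>1 - h\<close> contributes
      \<open>m1\<close> times the logarithm \<open>u / r\<close> of the series variable.\<close>
    have "D' (lam ^ k * (of_int m1 * u / of_nat r)) = lam ^ k * (v * of_int m1)"
    proof -
      have ne: "of_nat r \<noteq> (0 :: 'u)" using e(6) by simp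
      have "D' (of_int m1 * u / of_nat r) = v * of_int m1"
        unfolding der_divide[OF D' ne] der_mult[OF D'] der_of_int[OF D'] der_of_nat[OF D']
        using ne by (simp add: v_def power2_eq_square)
      then show ?thesis by (simp only: der_mult[OF D'] Dlk) simp
    qed
    then have "T = D' (lam ^ k * (of_int m1 * u / of_nat r)) + lam ^ k * (D' b / b)"
      using T by (simp add: ring_distribs mult.commute)
    moreover have "lam ^ k * (of_int m1 * u / of_nat r) \<in> Q"
      using lamQ e(5) by (intro fs_mult[OF FQ] fs_divide[OF FQ] fs_power[OF FQ] fs_of_int[OF FQ] fs_of_nat[OF FQ])
    ultimately show ?thesis
      by (intro disjI2 exI[of _ "lam ^ k * (of_int m1 * u / of_nat r)"] exI[of _ "lam ^ k"] exI[of _ b] conjI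
          fs_power[OF FP lamP] Dlk bP)
  qed
qed

text \<open>Five derivations occur: \<open>D\<close> on the source, \<open>D1\<close> once
  exponentials are gone, and \<open>D2\<close>, \<open>D3\<close>, \<open>D4\<close> on targets that
  hold the logarithms \<open>l'\<close>, the elementary part, and the further logarithms it needs.
  All agree on \<open>cl F\<close>. The conclusion keeps \<open>Q1\<close> apart from
  \<open>Q\<close> because freedom from new constants is guaranteed only for the former.\<close>

theorem polylog_descent:
  fixes n :: nat
  assumes D: "derivation D" and F: "field_set F" "\<And>x. x \<in> F \<Longrightarrow> D x \<in> F" "small F"
    and K: "field_set K" "F \<subseteq> K" "\<And>x. x \<in> K \<Longrightarrow> D x \<in> K" "K \<subseteq> cl (insert th F)"
    and th: "th \<in> K" "th \<noteq> 0" "D th = th * D u" "u \<in> F" "th \<notin> cl F"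
    and f: "f \<in> F" and h: "\<And>i. i < n \<Longrightarrow> h i \<in> K \<and> h i \<noteq> 0 \<and> h i \<noteq> 1"
    and l: "\<And>i. i < n \<Longrightarrow> D (l i) = D (h i) / h i"
    and const: "\<And>y. y \<in> gen (K \<union> l ` {..<n}) \<Longrightarrow> D y = 0 \<Longrightarrow> y \<in> F"
    and d: "\<And>i. i < n \<Longrightarrow> d i \<in> F \<and> D (d i) = 0"
    and E: "elem_tower D (cl (K \<union> l ` {..<n})) T" "E \<in> T"
    and eq: "f = D E + (\<Sum>i<n. d i * (D (1 - h i) / (1 - h i)) * l i ^ k i)"
  obtains D' Q Q1 E' h' l' d' where "derivation D'" "log_tower D' (cl F) Q" "\<And>y. y \<in> cl F \<Longrightarrow> D' y = D y"
    "E' \<in> Q" "cl Q1 = Q1" "cl F \<subseteq> Q1" "Q1 \<subseteq> Q" "\<And>y. y \<in> Q1 \<Longrightarrow> D' y = 0 \<Longrightarrow> y \<in> cl F"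
    "\<And>i. i < n \<Longrightarrow> h' i \<in> cl F \<and> h' i \<noteq> 0 \<and> h' i \<noteq> 1 \<and> l' i \<in> Q1 \<and> D' (l' i) = D' (h' i) / h' i \<and>
      d' i \<in> cl F \<and> D' (d' i) = 0"
    "f = D' E' + (\<Sum>i<n. d' i * (D' (1 - h' i) / (1 - h' i)) * l' i ^ k i)"
proof -
  define P where "P = cl F"
  define N where "N = cl (K \<union> l ` {..<n})"
  have KN: "K \<subseteq> N" and lN: "\<And>i. i < n \<Longrightarrow> l i \<in> N"
    using cl_superset[of "K \<union> l ` {..<n}"] by (auto simp: N_def)
  have FP: "F \<subseteq> P" using cl_superset by (auto simp: P_def)
  have Dl: "D (l i) \<in> K" if "i < n" for i
    using l[OF that] h[OF that] K(3) by (auto intro!: fs_divide[OF K(1)])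
  have dP: "diff_closed D P" unfolding P_def
    by (rule diff_closed_cl[OF D]) (use F(2) cl_superset[of F] in auto)
  have dN: "diff_closed D N" unfolding N_def
    by (rule diff_closed_cl[OF D]) (use K(3) Dl KN N_def in auto)
  note FN = diff_closedD(4)[OF dN]
  have sP: "small P" unfolding P_def by (rule small_cl[OF F(1,3)])
  have PN: "P \<subseteq> N" unfolding P_def N_def using K(2) by (intro cl_mono) auto
  have sN: "small N"
  proof -
    let ?S = "insert th (l ` {..<n})"
    have "K \<union> l ` {..<n} \<subseteq> cl (F \<union> ?S)"
      using K(4) cl_mono[of "insert th F" "F \<union> ?S"] cl_superset[of "F \<union> ?S"] by auto
    then have "N \<subseteq> cl (F \<union> ?S)" unfolding N_def by (rule cl_minimal)
    moreover have "small (cl (F \<union> ?S))" by (rule small_cl_finite[OF F(1,3)]) auto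
    ultimately show ?thesis unfolding small_def using card_of_mono1 ordLeq_transitive by blast
  qed
  \<comment> \<open>\<open>N\<close> is algebraic over the field generated by \<open>K\<close> and
    the logarithms, whose constants lie in \<open>F\<close>.\<close>
  have Nconst: "y \<in> P" if y: "y \<in> N" "D y = 0" for y
  proof -
    let ?L = "gen (K \<union> l ` {..<n})"
    have DL: "D a \<in> ?L" if "a \<in> ?L" for a
      by (rule gen_derivation_closed[OF D _ that]) (use K(3) Dl gen_superset[of "K \<union> l ` {..<n}"] in auto)
    have "algebraic_elt ?L y" using y(1) cl_eq_algebraic[OF gen_field_set] by (auto simp: N_def)
    then have "y \<in> cl {z \<in> ?L. D z = 0}" using algebraic_constant[OF D gen_field_set DL _ y(2)] by metis
    moreover have "{z \<in> ?L. D z = 0} \<subseteq> F" using const by auto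
    ultimately show ?thesis unfolding P_def using cl_mono by blast
  qed
  define g where "g = (\<Sum>i<n. d i * (D (1 - h i) / (1 - h i)) * l i ^ k i)"
  have gN: "g \<in> N" unfolding g_def
  proof (rule fs_sum[OF FN])
    fix i assume "i \<in> {..<n}"
    then have i: "i < n" by simp
    have "h i \<in> N" "d i \<in> N" using h[OF i] d[OF i] K(2) KN by auto
    then show "d i * (D (1 - h i) / (1 - h i)) * l i ^ k i \<in> N"
      using lN[OF i] diff_closedD(3)[OF dN]
      by (intro fs_mult[OF FN] fs_divide[OF FN] fs_power[OF FN] fs_diff[OF FN] fs_1[OF FN]) (auto intro!: fs_diff[OF FN] fs_1[OF FN])
  qed
  have DE: "D E = f - g" using eq by (simp add: g_def)
  have fN: "f \<in> N" using f K(2) KN by auto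
  have DEN: "D E \<in> N" unfolding DE by (rule fs_diff[OF FN fN gN])
  \<comment> \<open>The base is \<open>N\<close> because \<open>D E\<close> involves the logarithms
    \<open>l i\<close>. The new antiderivative \<open>E1\<close> lies in a purely logarithmic tower
    over it.\<close>
  from eliminate_exponentials[OF E(1)[folded N_def] dN sN log_tower.base E(2) DEN]
  obtain D1 T1 E1 where D1: "derivation D1" "log_tower D1 N T1" "\<forall>x\<in>N. D1 x = D x" "E1 \<in> T1" "D1 E1 = D E"
    by blast
  have D1P: "D1 y = D y" if "y \<in> P" for y using D1(3) that PN by auto
  have dP1: "diff_closed D1 P" using dP D1(1) D1P by (auto simp: diff_closed_def)
  have uP: "u \<in> P" using th(4) FP by auto
  have thN: "th \<in> N" using th(1) KN by auto
  have Dth: "D1 th = th * D1 u" using D1(3) thN D1P[OF uP] th(3) by simp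
  obtain \<phi>0 where emb0: "series_emb D1 (gen (insert th P)) \<phi>0 1 P D1 u" "\<And>p. p \<in> P \<Longrightarrow> \<phi>0 p = fls_const p"
    using series_emb_base[OF dP1 sP uP _ Dth] th(5) unfolding P_def by metis
  define G0 where "G0 = gen (insert th P)"
  have G0: "P \<subseteq> G0" "th \<in> G0" using gen_superset[of "insert th P"] by (auto simp: G0_def)
  have KG0: "K \<subseteq> cl G0" using K(4) cl_mono[of "insert th F" G0] FP G0 by auto
  \<comment> \<open>The \<open>h i\<close> are expanded first, while the target is still
    \<open>P\<close>; hence their coefficients, among them the new polylogarithmic arguments, are in
    \<open>P\<close>.\<close>
  have "h ` {..<n} \<subseteq> cl G0" using h KG0 by auto
  from series_emb_algebraic_finite[OF _ emb0(1)[folded G0_def] D1(1) this]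
  obtain G1 \<phi>1 r1 where 1: "series_emb D1 G1 \<phi>1 r1 P D1 u" "G0 \<subseteq> G1" "h ` {..<n} \<subseteq> G1"
    "G1 \<subseteq> cl G0" "\<forall>y\<in>G0. \<forall>c. \<phi>0 y = fls_const c \<longrightarrow> \<phi>1 y = fls_const c" by blast
  have PG1: "P \<subseteq> G1" using G0 1(2) by auto
  have phiP: "\<phi>1 p = fls_const p" if "p \<in> P" for p using 1(5) emb0(2)[OF that] that G0 by auto
  have "G0 \<subseteq> N" unfolding G0_def using PN thN by (intro gen_least[OF FN]) auto
  then have G1N: "G1 \<subseteq> N" using 1(4) cl_minimal[of G0 N] diff_closedD(2)[OF dN] by auto
  have "tame D P P (D u)"
    unfolding P_def
    by (rule tame_algebraic_closure[OF D F(1,2) K(1,2) _ th(1-3) F(2)[OF th(4)] th(5)])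
       (use const gen_superset[of "K \<union> l ` {..<n}"] in auto)
  then have tame1: "tame D1 P P (D1 u)" using D1P uP by (simp add: tame_def)
  have c1: "y \<in> G1" if "y \<in> N" "D1 y = 0" for y using Nconst that D1(3) PG1 by auto
  have "\<exists>G' \<phi>' Q' D''. series_emb D1 G' \<phi>' r1 Q' D'' u \<and> G1 \<subseteq> G' \<and> G' \<subseteq> N \<and> (\<forall>y\<in>G1. \<phi>' y = \<phi>1 y) \<and>
    log_tower D'' P Q' \<and> (\<forall>y\<in>P. D'' y = D1 y) \<and> tame D'' Q' P (D'' u) \<and>
    (\<forall>i<n. l i \<in> G' \<and> vanishes_below 0 (\<phi>' (l i)))"
  proof (rule series_emb_logs[OF D1(1) 1(1) tame1 _ _ diff_closedD(2)[OF dN] G1N lN c1])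
    show "h i \<in> G1 \<and> h i \<noteq> 0" if "i < n" for i using that h 1(3) by auto
    show "D1 (l i) = D1 (h i) / h i" if "i < n" for i using that h[OF that] l D1(3) lN KN by auto
  qed
  then obtain G2 \<phi>2 Q2 D2 where 2: "series_emb D1 G2 \<phi>2 r1 Q2 D2 u" "G1 \<subseteq> G2" "G2 \<subseteq> N"
    "\<forall>y\<in>G1. \<phi>2 y = \<phi>1 y" "log_tower D2 P Q2" "\<forall>y\<in>P. D2 y = D1 y" "tame D2 Q2 P (D2 u)"
    "\<forall>i<n. l i \<in> G2 \<and> vanishes_below 0 (\<phi>2 (l i))" by blast
  note e2 = series_embD[OF 2(1)]
  have PQ2: "P \<subseteq> Q2" by (rule log_tower_superset[OF 2(5)])
  have NG2: "N \<subseteq> cl G2"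
  proof -
    have "K \<subseteq> cl G2" using KG0 cl_mono[of G0 G2] 1(2) 2(2) by auto
    then show ?thesis unfolding N_def using 2(8) cl_superset[of G2] by (intro cl_minimal) auto
  qed
  have "{E1} \<subseteq> T1" "finite {E1}" using D1(4) by auto
  from series_emb_tower[OF D1(2,1) 2(1) NG2 this(2,1)]
  obtain G3 \<phi>3 r3 Q3 D3 where 3: "series_emb D1 G3 \<phi>3 r3 Q3 D3 u" "G2 \<subseteq> G3" "E1 \<in> G3"
    "\<forall>y\<in>G2. \<phi>3 y $$ 0 = \<phi>2 y $$ 0" "log_tower D3 Q2 Q3" "\<forall>y\<in>Q2. D3 y = D2 y" by auto
  note e3 = series_embD[OF 3(1)]
  have Q23: "Q2 \<subseteq> Q3" by (rule log_tower_superset[OF 3(5)])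
  have D3P: "D3 y = D y" if "y \<in> P" for y using that 3(6) 2(6) D1P PQ2 by auto
  have D2P: "D2 y = D y" if "y \<in> P" for y using that 2(6) D1P by auto
  have dP2: "diff_closed D2 P" using dP diff_closedD(1)[OF e2(3)] D2P by (auto simp: diff_closed_def)
  have phi2P: "\<phi>2 p = fls_const p" if "p \<in> P" for p using 2(4) phiP[OF that] that PG1 by auto
  define E0 where "E0 = \<phi>3 E1 $$ 0"
  have E0: "E0 \<in> Q3" using e3(8)[OF 3(3)] by (simp add: E0_def series_over_def)
  define tm where "tm i = D (1 - h i) / (1 - h i) * l i ^ k i" for i
  define CT where "CT i = \<phi>2 (tm i) $$ 0" for i
  have hG2: "h i \<in> G2" if "i < n" for i using that 1(3) 2(2) by auto
  have tm1: "tm i = D1 (1 - h i) / (1 - h i) * l i ^ k i" if "i < n" for i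
    using D1(3) h[OF that] KN fs_diff[OF FN fs_1[OF FN], of "h i"] by (auto simp: tm_def)
  have tmG: "tm i \<in> G2" if "i < n" for i
    unfolding tm1[OF that] using hG2[OF that] 2(8) that e2(2)
    by (auto intro!: fs_mult[OF e2(1)] fs_divide[OF e2(1)] fs_power[OF e2(1)] fs_diff[OF e2(1)] fs_1[OF e2(1)])
  \<comment> \<open>Constant terms on both sides of the formula for \<open>D1 E1\<close>:
    \<open>f\<close> and the \<open>d i\<close> are constant series, and the last extension, which
    reaches \<open>E1\<close>, keeps constant terms.\<close>
  have DE0: "D3 E0 = f - (\<Sum>i<n. d i * CT i)"
  proof -
    have D1E: "D1 E1 = f - (\<Sum>i<n. d i * tm i)"
      unfolding D1(5) DE g_def by (simp add: tm_def mult.assoc)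
    have PG2: "P \<subseteq> G2" using PG1 2(2) by auto
    have dm: "d i \<in> P" "d i \<in> G2" if "i < n" for i using d[OF that] FP PG2 by auto
    have fG: "f \<in> G2" "f \<in> P" using f FP PG2 by auto
    have sG: "(\<Sum>i<n. d i * tm i) \<in> G2" using dm tmG by (intro fs_sum[OF e2(1)] fs_mult[OF e2(1)]) auto
    have "\<phi>2 (\<Sum>i<n. d i * tm i) = (\<Sum>i<n. \<phi>2 (d i * tm i))"
      using dm tmG by (intro hom_on_sum[OF e2(1,7)] fs_mult[OF e2(1)]) auto
    also have "\<dots> = (\<Sum>i<n. fls_const (d i) * \<phi>2 (tm i))"
      using dm tmG e2(7) phi2P by (intro sum.cong) (auto simp: hom_on_def)
    finally have "\<phi>2 (D1 E1) $$ 0 = f - (\<Sum>i<n. d i * CT i)"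
      unfolding D1E hom_on_diff[OF e2(1,7) fG(1) sG] using phi2P[OF fG(2)]
      by (simp add: CT_def fls_nth_sum)
    moreover have "D1 E1 \<in> G2" unfolding D1E by (rule fs_diff[OF e2(1) fG(1) sG])
    ultimately have "\<phi>3 (D1 E1) $$ 0 = f - (\<Sum>i<n. d i * CT i)" using 3(4) by simp
    then show ?thesis using e3(9)[OF 3(3)] fls_der_nth[OF diff_closedD(1)[OF e3(3)]] by (simp add: E0_def)
  qed
  define poly_case where "poly_case i a \<longleftrightarrow> a \<in> P \<and> a \<noteq> 0 \<and> a \<noteq> 1 \<and> D2 (\<phi>2 (l i) $$ 0) = D2 a / a \<and>
     CT i = D2 (1 - a) / (1 - a) * (\<phi>2 (l i) $$ 0) ^ k i" for i a
  define elem_case where "elem_case i e c b \<longleftrightarrow> e \<in> Q2 \<and> c \<in> P \<and> D2 c = 0 \<and> b \<in> P \<and> b \<noteq> 0 \<and>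
     CT i = D2 e + c * (D2 b / b)" for i e c b
  have cases: "(\<exists>a. poly_case i a) \<or> (\<exists>e c b. elem_case i e c b)" if "i < n" for i
  proof -
    have "\<phi>2 (h i) \<in> series_over P"
      using series_embD(8)[OF 1(1), of "h i"] 1(3) that 2(4) by auto
    moreover have "D1 (l i) = D1 (h i) / h i" using that h[OF that] l D1(3) lN KN by auto
    ultimately show ?thesis
      using polylog_constant_term[OF 2(1,7) dP2 PQ2 uP hG2[OF that], of "l i" "k i"] h[OF that] 2(8) that
      unfolding poly_case_def elem_case_def CT_def tm1[OF that] by blast
  qed
  define pl where "pl i \<longleftrightarrow> (\<exists>a. poly_case i a)" for i
  define a where "a i = (SOME a. poly_case i a)" for i
  have a: "poly_case i (a i)" if "pl i" for i using that unfolding pl_def a_def by (rule someI_ex)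
  have "\<exists>e c b. elem_case i e c b" if "i < n" "\<not> pl i" for i using cases[OF that(1)] that(2) by (simp add: pl_def)
  then obtain e c b where ecb: "\<And>i. i < n \<Longrightarrow> \<not> pl i \<Longrightarrow> elem_case i (e i) (c i) (b i)" by metis
  \<comment> \<open>The default 1 serves the indices without a logarithmic remainder, as
    \<open>adjoin_logs\<close> expects a nonzero argument everywhere.\<close>
  define b' where "b' i = (if pl i then 1 else b i)" for i
  note FP' = diff_closedD(4)[OF dP]
  have b': "b' i \<in> Q3 \<and> b' i \<noteq> 0" if "i < n" for i
    using ecb[OF that] PQ2 Q23 fs_1[OF diff_closedD(4)[OF e3(3)]] by (auto simp: b'_def elem_case_def)
  from adjoin_logs[of D3 Q3 n b', OF e3(3,4) b']
  obtain D4 Q4 \<mu> where 4: "derivation D4" "log_tower D4 Q3 Q4" "\<forall>y\<in>Q3. D4 y = D3 y"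
    "\<forall>i<n. \<mu> i \<in> Q4 \<and> D4 (\<mu> i) = D4 (b' i) / b' i" by blast
  have Q34: "Q3 \<subseteq> Q4" by (rule log_tower_superset[OF 4(2)])
  have D4_3: "D4 y = D3 y" if "y \<in> Q3" for y using 4(3) that by blast
  have D4_2: "D4 y = D2 y" if "y \<in> Q2" for y using 4(3) that 3(6) Q23 by auto
  have D4P: "D4 y = D y" if "y \<in> P" for y using D4_2 that PQ2 D2P by auto
  have dQ4: "diff_closed D4 Q4"
    by (rule log_tower_diff_closed[OF 4(2)]) (use e3(3) 4(1,3) in \<open>auto simp: diff_closed_def\<close>)
  note FQ4 = diff_closedD(4)[OF dQ4]
  have "log_tower D4 P Q2" by (rule log_tower_cong[OF 2(5)]) (use D4_2 in auto)
  moreover have "log_tower D4 Q2 Q3" by (rule log_tower_cong[OF 3(5)]) (use D4_3 in auto)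
  ultimately have tower: "log_tower D4 P Q4" using 4(2) log_tower_trans by blast
  define E' where "E' = E0 + (\<Sum>i<n. if pl i then 0 else d i * (e i + c i * \<mu> i))"
  \<comment> \<open>Summands that became elementary stay as dummies, so that \<open>n\<close> and
    \<open>k\<close> are kept: coefficient 0, and as argument the constant 2, different from 0 and
    1, with logarithm 0.\<close>
  define h' where "h' i = (if pl i then a i else 2)" for i
  define l' where "l' i = (if pl i then \<phi>2 (l i) $$ 0 else 0)" for i
  define d' where "d' i = (if pl i then d i else 0)" for i
  have QQ4: "y \<in> Q4" if "y \<in> Q2" for y using that Q23 Q34 by auto
  have PQ4: "y \<in> Q4" if "y \<in> P" for y using that PQ2 QQ4 by auto
  have E'Q: "E' \<in> Q4"
    unfolding E'_def
  proof (intro fs_add[OF FQ4] fs_sum[OF FQ4])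
    show "E0 \<in> Q4" using E0 Q34 by auto
    fix i assume "i \<in> {..<n}"
    then show "(if pl i then 0 else d i * (e i + c i * \<mu> i)) \<in> Q4"
      using ecb[of i] 4(4) d[of i] FP QQ4 PQ4 fs_0[OF FQ4]
      by (auto simp: elem_case_def intro!: fs_mult[OF FQ4] fs_add[OF FQ4])
  qed
  have two: "(2 :: 'u) \<in> P" using fs_of_nat[OF FP', of 2] by simp
  have term_eq: "d i * CT i = D4 (if pl i then 0 else d i * (e i + c i * \<mu> i)) +
      d' i * (D4 (1 - h' i) / (1 - h' i)) * l' i ^ k i" if i: "i < n" for i
  proof (cases "pl i")
    case True
    from a[OF True] have ai: "a i \<in> P" "CT i = D2 (1 - a i) / (1 - a i) * (\<phi>2 (l i) $$ 0) ^ k i"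
      by (auto simp: poly_case_def)
    have "1 - a i \<in> Q2" using ai(1) PQ2 by (auto intro!: fs_diff[OF diff_closedD(4)[OF e2(3)]] fs_1[OF diff_closedD(4)[OF e2(3)]])
    then show ?thesis using True ai(2) D4_2 by (simp add: d'_def h'_def l'_def der_0[OF 4(1)] mult.assoc)
  next
    case False
    from ecb[OF i False] have x: "e i \<in> Q2" "c i \<in> P" "D2 (c i) = 0" "b i \<in> P"
      "CT i = D2 (e i) + c i * (D2 (b i) / b i)" by (auto simp: elem_case_def)
    have "D4 (d i) = 0" using d[OF i] FP D4P by auto
    moreover have "D4 (c i) = 0" using x D4_2 PQ2 by auto
    moreover have "D4 (\<mu> i) = D2 (b i) / b i" using 4(4) i False D4_2 x(4) PQ2 by (auto simp: b'_def)
    moreover have "D4 (e i) = D2 (e i)" using D4_2 x(1) by simp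
    ultimately show ?thesis using False x(5) by (simp add: d'_def der_mult[OF 4(1)] der_add[OF 4(1)])
  qed
  have "D4 E' = D3 E0 + (\<Sum>i<n. D4 (if pl i then 0 else d i * (e i + c i * \<mu> i)))"
    unfolding E'_def der_add[OF 4(1)] der_sum[OF 4(1)] using D4_3[OF E0] by simp
  moreover have "(\<Sum>i<n. d i * CT i) = (\<Sum>i<n. D4 (if pl i then 0 else d i * (e i + c i * \<mu> i))) +
      (\<Sum>i<n. d' i * (D4 (1 - h' i) / (1 - h' i)) * l' i ^ k i)"
    unfolding sum.distrib[symmetric] by (rule sum.cong) (use term_eq in auto)
  ultimately have final: "f = D4 E' + (\<Sum>i<n. d' i * (D4 (1 - h' i) / (1 - h' i)) * l' i ^ k i)"
    using DE0 by simp
  have data: "h' i \<in> P \<and> h' i \<noteq> 0 \<and> h' i \<noteq> 1 \<and> l' i \<in> Q2 \<and> D4 (l' i) = D4 (h' i) / h' i \<and>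
      d' i \<in> P \<and> D4 (d' i) = 0" if i: "i < n" for i
  proof (cases "pl i")
    case True
    from a[OF True] have ai: "a i \<in> P" "a i \<noteq> 0" "a i \<noteq> 1" "D2 (\<phi>2 (l i) $$ 0) = D2 (a i) / a i"
      by (auto simp: poly_case_def)
    have "\<phi>2 (l i) $$ 0 \<in> Q2" using e2(8) 2(8) i by (auto simp: series_over_def)
    then show ?thesis using True ai d[OF i] FP D4_2 D4P D2P PQ2 by (auto simp: h'_def l'_def d'_def)
  next
    case False
    have "D4 2 = 0" using der_of_nat[OF 4(1), of 2] by simp
    then show ?thesis using False two fs_0[OF FP'] fs_0[OF diff_closedD(4)[OF e2(3)]]
      by (auto simp: h'_def l'_def d'_def der_0[OF 4(1)])
  qed
  show ?thesis
  proof (rule that[of D4 Q4 E' Q2 h' l' d'])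
    show "y \<in> cl F" if "y \<in> Q2" "D4 y = 0" for y
      using that 2(7) D4_2 unfolding tame_def P_def by auto
    show "Q2 \<subseteq> Q4" using QQ4 by auto
    show "h' i \<in> cl F \<and> h' i \<noteq> 0 \<and> h' i \<noteq> 1 \<and> l' i \<in> Q2 \<and> D4 (l' i) = D4 (h' i) / h' i \<and>
      d' i \<in> cl F \<and> D4 (d' i) = 0" if "i < n" for i
      using data[OF that] unfolding P_def .
    show "f = D4 E' + (\<Sum>i<n. d' i * (D4 (1 - h' i) / (1 - h' i)) * l' i ^ k i)" by (rule final)
    show "D4 y = D y" if "y \<in> cl F" for y using D4P that by (simp add: P_def)
  qed (use 4(1) tower E'Q diff_closedD(2)[OF e2(3)] PQ2 in \<open>simp_all add: P_def\<close>)
qed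

end

section \<open>Fields given by a carrier\<close>

no_notation fls_nth (infixl "$$" 75)

text \<open>Carries fields with a carrier over to sets in \<open>'u\<close>, where the arguments
  above take place. The way back uses the same locale, with \<open>inv_into\<close> as the
  embedding.\<close>

locale field_embedding = field R for R :: "('a, 'm) ring_scheme" (structure) +
  fixes \<iota> :: "'a \<Rightarrow> 'u::field_char_0"
  assumes emb_one: "\<iota> \<one> = 1"
    and emb_add: "\<lbrakk>x \<in> carrier R; y \<in> carrier R\<rbrakk> \<Longrightarrow> \<iota> (x \<oplus> y) = \<iota> x + \<iota> y"
    and emb_mult: "\<lbrakk>x \<in> carrier R; y \<in> carrier R\<rbrakk> \<Longrightarrow> \<iota> (x \<otimes> y) = \<iota> x * \<iota> y"
begin

lemma emb_zero: "\<iota> \<zero> = 0"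
  using emb_add[of \<zero> \<zero>] by (metis add_cancel_right_left l_zero zero_closed)

lemma emb_uminus: "x \<in> carrier R \<Longrightarrow> \<iota> (\<ominus> x) = - \<iota> x"
  using emb_add[of x "\<ominus> x"] emb_zero by (simp add: r_neg eq_neg_iff_add_eq_0 add.commute)

lemma emb_minus: "x \<in> carrier R \<Longrightarrow> y \<in> carrier R \<Longrightarrow> \<iota> (x \<ominus> y) = \<iota> x - \<iota> y"
  by (simp add: a_minus_def emb_add emb_uminus)

lemma emb_eq_0_iff: "x \<in> carrier R \<Longrightarrow> \<iota> x = 0 \<longleftrightarrow> x = \<zero>"
proof
  assume x: "x \<in> carrier R" "\<iota> x = 0"
  show "x = \<zero>"
  proof (rule ccontr)
    assume "x \<noteq> \<zero>"
    then have "x \<otimes> inv x = \<one>" "inv x \<in> carrier R" using x field_Units by auto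
    then show False using emb_mult[of x "inv x"] x emb_one by simp
  qed
qed (simp add: emb_zero)

lemma emb_inj: "inj_on \<iota> (carrier R)"
proof (rule inj_onI)
  fix x y assume xy: "x \<in> carrier R" "y \<in> carrier R" "\<iota> x = \<iota> y"
  then have "\<iota> (x \<ominus> y) = 0" by (simp add: emb_minus)
  then have "x \<ominus> y = \<zero>" using emb_eq_0_iff[of "x \<ominus> y"] xy by simp
  then show "x = y" using xy by simp
qed

lemma emb_inverse: "x \<in> carrier R \<Longrightarrow> x \<noteq> \<zero> \<Longrightarrow> \<iota> (inv x) = inverse (\<iota> x)"
proof -
  assume x: "x \<in> carrier R" "x \<noteq> \<zero>"
  then have "x \<otimes> inv x = \<one>" "inv x \<in> carrier R" using field_Units by auto
  then have "\<iota> x * \<iota> (inv x) = 1" using emb_mult[of x "inv x"] x emb_one by simp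
  then show ?thesis by (metis inverse_unique)
qed

lemma emb_pow: "x \<in> carrier R \<Longrightarrow> \<iota> (x [^] (n::nat)) = \<iota> x ^ n"
  by (induction n) (simp_all add: emb_one emb_mult mult.commute)

lemma emb_finsum:
  "finite A \<Longrightarrow> f \<in> A \<rightarrow> carrier R \<Longrightarrow> \<iota> (\<Oplus>i\<in>A. f i) = (\<Sum>i\<in>A. \<iota> (f i))"
  by (induction A rule: finite_induct) (simp_all add: emb_zero emb_add Pi_def)

lemma emb_generate_field:
  assumes "A \<subseteq> carrier R"
  shows "\<iota> ` generate_field R A = gen (\<iota> ` A)"
proof
  note c = generate_field_in_carrier[OF assms]
  note G = gen_field_set[of "\<iota> ` A"]
  have "\<iota> x \<in> gen (\<iota> ` A)" if "x \<in> generate_field R A" for x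
    using that
  proof (induction rule: generate_field.induct)
    case (incl h)
    then show ?case using gen_superset[of "\<iota> ` A"] by blast
  qed (auto simp: emb_one emb_uminus emb_inverse emb_add emb_mult c
      intro!: fs_1[OF G] fs_uminus[OF G] fs_inverse[OF G] fs_add[OF G] fs_mult[OF G])
  then show "\<iota> ` generate_field R A \<subseteq> gen (\<iota> ` A)" by blast
  show "gen (\<iota> ` A) \<subseteq> \<iota> ` generate_field R A"
  proof (rule gen_least)
    show "\<iota> ` A \<subseteq> \<iota> ` generate_field R A"
      by (intro image_mono subsetI generate_field.incl)
    show "field_set (\<iota> ` generate_field R A)"
      unfolding field_set_def
    proof (intro conjI ballI)
      show "1 \<in> \<iota> ` generate_field R A" using emb_one generate_field.one by (metis imageI)
    next
      fix x y assume "x \<in> \<iota> ` generate_field R A" "y \<in> \<iota> ` generate_field R A"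
      then obtain a b where ab: "a \<in> generate_field R A" "b \<in> generate_field R A" "x = \<iota> a" "y = \<iota> b" by blast
      have "a \<ominus> b \<in> generate_field R A" "a \<otimes> b \<in> generate_field R A"
        using ab by (auto simp: a_minus_def intro: generate_field.intros)
      moreover have "x - y = \<iota> (a \<ominus> b)" "x * y = \<iota> (a \<otimes> b)" using ab c by (simp_all add: emb_minus emb_mult)
      ultimately show "x - y \<in> \<iota> ` generate_field R A" "x * y \<in> \<iota> ` generate_field R A" by blast+
    next
      fix x assume "x \<in> \<iota> ` generate_field R A"
      then obtain a where a: "a \<in> generate_field R A" "x = \<iota> a" by blast
      show "inverse x \<in> \<iota> ` generate_field R A"
      proof (cases "a = \<zero>")
        case True
        then have "inverse x = x" using a by (simp add: emb_zero)
        then show ?thesis using a by blast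
      next
        case False
        then have "inverse x = \<iota> (inv a)" "inv a \<in> generate_field R A"
          using a c by (auto simp: emb_inverse intro: generate_field.m_inv)
        then show ?thesis by blast
      qed
    qed
  qed
qed

lemma emb_subfield: "subfield L R \<Longrightarrow> field_set (\<iota> ` L)"
  using emb_generate_field[of L] gen_field_set[of "\<iota> ` L"] generate_field_min_subfield1[of L L]
    subfieldE(3)[of L R] generate_field.incl[of _ L R] by (metis order_refl subset_antisym subsetI)

text \<open>Polynomials over a carrier are lists with the leading coefficient first, hence
  \<open>rev\<close>.\<close>

lemma emb_eval:
  assumes "set p \<subseteq> carrier R" "x \<in> carrier R"
  shows "\<iota> (eval p x) = poly (Poly (rev (map \<iota> p))) (\<iota> x)"
  using assms(1)
proof (induction p)
  case (Cons a p)
  have app: "poly (Poly (xs @ [c])) y = poly (Poly xs) y + c * y ^ length xs" for xs and c y :: 'u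
    by (induction xs) (simp_all add: algebra_simps)
  have "eval p x \<in> carrier R" using Cons.prems assms(2) by (intro eval_in_carrier) auto
  then show ?case
    using Cons assms(2) app[of "rev (map \<iota> p)" "\<iota> a" "\<iota> x"] by (simp add: emb_add emb_mult emb_pow)
qed (simp add: emb_zero)

lemma emb_algebraic:
  assumes L: "subfield L R" and x: "x \<in> carrier R"
  shows "algebraic L x \<longleftrightarrow> \<iota> x \<in> cl (\<iota> ` L)"
proof -
  note Lc = subfieldE(3)[OF L]
  note FL = emb_subfield[OF L]
  have "algebraic L x \<longleftrightarrow> algebraic_elt (\<iota> ` L) (\<iota> x)"
  proof
    assume "algebraic L x"
    then obtain p where p: "p \<in> carrier (L[X])" "p \<noteq> []" "eval p x = \<zero>"
      using algebraicE[OF subfieldE(1)[OF L] x] unfolding over_def by blast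
    then have pL: "set p \<subseteq> L" "hd p \<noteq> \<zero>" by (auto simp: univ_poly_def polynomial_def)
    define q where "q = Poly (rev (map \<iota> p))"
    have "poly q (\<iota> x) = 0"
      using emb_eval[of p x] pL(1) Lc x p(3) emb_zero by (auto simp: q_def)
    moreover have "poly_over (\<iota> ` L) q"
    proof -
      have "p ! (length p - Suc i) \<in> L" if "i < length p" for i
        using pL(1) that nth_mem[of "length p - Suc i" p] by auto
      then show ?thesis
        using fs_0[OF FL] by (simp add: poly_over_def q_def coeff_Poly_eq nth_default_def rev_nth)
    qed
    moreover have "q \<noteq> 0"
    proof -
      have "hd p \<in> carrier R" using pL(1) Lc p(2) hd_in_set by blast
      then have "\<iota> (hd p) \<noteq> 0" using emb_eq_0_iff pL(2) by simp
      moreover have "poly.coeff q (length p - 1) = \<iota> (hd p)"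
        using p(2) by (simp add: q_def coeff_Poly_eq nth_default_def rev_nth hd_conv_nth)
      ultimately show ?thesis by auto
    qed
    ultimately show "algebraic_elt (\<iota> ` L) (\<iota> x)" by (auto simp: algebraic_elt_def)
  next
    assume "algebraic_elt (\<iota> ` L) (\<iota> x)"
    then obtain q where q: "poly_over (\<iota> ` L) q" "q \<noteq> 0" "poly q (\<iota> x) = 0" by (auto simp: algebraic_elt_def)
    define g where "g = inv_into L \<iota>"
    have g: "g y \<in> L \<and> \<iota> (g y) = y" if "y \<in> \<iota> ` L" for y
      using that by (simp add: g_def inv_into_into f_inv_into_f)
    define p where "p = map g (rev (coeffs q))"
    have cq: "set (coeffs q) \<subseteq> \<iota> ` L" using q(1) by (auto simp: poly_over_def coeffs_def)
    have pL: "set p \<subseteq> L" using cq g by (auto simp: p_def)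
    have "map \<iota> p = rev (coeffs q)" using cq g by (auto simp: p_def intro!: map_idI)
    then have "\<iota> (eval p x) = 0" using emb_eval[of p x] pL Lc x q(3) by auto
    then have "eval p x = \<zero>" using emb_eq_0_iff eval_in_carrier[of p x] pL Lc x by blast
    moreover have pne: "p \<noteq> []" using q(2) by (simp add: p_def)
    moreover have "hd p \<noteq> \<zero>"
    proof
      assume h: "hd p = \<zero>"
      have "hd p = g (poly.coeff q (Polynomial.degree q))"
        using q(2) by (simp add: p_def hd_map hd_rev last_coeffs_eq_coeff_degree)
      then have "\<iota> (hd p) = poly.coeff q (Polynomial.degree q)" using g q(1) by (simp add: poly_over_def)
      then show False using h emb_zero q(2) by simp
    qed
    then have "p \<in> carrier (L[X])" using pL pne by (simp add: univ_poly_def polynomial_def)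
    ultimately show "algebraic L x"
      using algebraicI[of p L x] unfolding over_def by blast
  qed
  then show ?thesis using cl_eq_algebraic[OF FL] by auto
qed

end

text \<open>No closure is taken here: as in an elementary extension finitely many generators are
  added, whereas the closures in a \<open>log_tower\<close> may need infinitely many.\<close>

inductive fin_tower :: "('a::field \<Rightarrow> 'a) \<Rightarrow> 'a set \<Rightarrow> 'a set \<Rightarrow> bool" for D P where
  base: "fin_tower D P P"
| step: "\<lbrakk>fin_tower D P S; x \<in> cl S \<or> (\<exists>a\<in>S. a \<noteq> 0 \<and> D x = D a / a)\<rbrakk> \<Longrightarrow> fin_tower D P (gen (insert x S))"

lemma fin_tower_superset: "fin_tower D P S \<Longrightarrow> P \<subseteq> S"
proof (induction rule: fin_tower.induct)
  case (step S x)
  then show ?case using gen_superset[of "insert x S"] by auto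
qed simp

lemma fin_tower_algebraic:
  assumes "finite Z" "fin_tower D P S" "Z \<subseteq> cl S"
  shows "\<exists>S'. fin_tower D P S' \<and> S \<subseteq> S' \<and> Z \<subseteq> S'"
  using assms(1,3)
proof (induction Z)
  case (insert x Z)
  then obtain S1 where 1: "fin_tower D P S1" "S \<subseteq> S1" "Z \<subseteq> S1" by auto
  have "x \<in> cl S1" using insert.prems cl_mono[OF 1(2)] by auto
  then have "fin_tower D P (gen (insert x S1))" using fin_tower.step[OF 1(1)] by blast
  moreover have "insert x S1 \<subseteq> gen (insert x S1)" by (rule gen_superset)
  ultimately show ?case using 1 by blast
qed (use assms in blast)

text \<open>By finite character, finitely many elements involve only finitely many algebraic
  elements at each level.\<close>

lemma log_tower_finite:
  fixes D :: "'a::field_char_0 \<Rightarrow> 'a"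
  assumes "log_tower D P Q" "finite Z" "Z \<subseteq> Q"
  shows "\<exists>S. fin_tower D P S \<and> Z \<subseteq> S"
  using assms
proof (induction arbitrary: Z rule: log_tower.induct)
  case base
  then show ?case using fin_tower.base by blast
next
  case (log T a x)
  have "\<forall>s\<in>Z. \<exists>Y. finite Y \<and> Y \<subseteq> insert x T \<and> s \<in> cl Y"
  proof
    fix s assume "s \<in> Z"
    then have "s \<in> cl (insert x T)" using log.prems by blast
    then show "\<exists>Y. finite Y \<and> Y \<subseteq> insert x T \<and> s \<in> cl Y" by (rule cl_finite_character) blast
  qed
  then obtain Y where Y: "\<And>s. s \<in> Z \<Longrightarrow> finite (Y s) \<and> Y s \<subseteq> insert x T \<and> s \<in> cl (Y s)" by metis
  define W where "W = insert a ((\<Union>s\<in>Z. Y s) - {x})"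
  have W: "finite W" "W \<subseteq> T" using Y log.prems(1) log.hyps(2) by (auto simp: W_def)
  obtain S where S: "fin_tower D P S" "W \<subseteq> S" using log.IH[OF W] by blast
  have "a \<in> S" using S(2) by (auto simp: W_def)
  then have 2: "fin_tower D P (gen (insert x S))" using fin_tower.step[OF S(1), of x] log.hyps(3,4) by blast
  have sub: "insert x S \<subseteq> gen (insert x S)" by (rule gen_superset)
  have "Z \<subseteq> cl (gen (insert x S))"
  proof
    fix s assume s: "s \<in> Z"
    then have "Y s \<subseteq> gen (insert x S)" using Y[OF s] S(2) sub by (auto simp: W_def)
    then show "s \<in> cl (gen (insert x S))" using Y[OF s] cl_mono by blast
  qed
  from fin_tower_algebraic[OF log.prems(1) 2 this] show ?case by blast
qed

lemma fin_tower_field_set: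
  fixes D :: "'a::field_char_0 \<Rightarrow> 'a"
  assumes "fin_tower D P S" "derivation D" "field_set P" "\<And>x. x \<in> P \<Longrightarrow> D x \<in> P"
  shows "field_set S \<and> (\<forall>x\<in>S. D x \<in> S)"
  using assms(1)
proof (induction rule: fin_tower.induct)
  case base
  then show ?case using assms by blast
next
  case (step S x)
  then have S: "field_set S" "\<And>y. y \<in> S \<Longrightarrow> D y \<in> S" by auto
  have sub: "x \<in> gen (insert x S)" "S \<subseteq> gen (insert x S)" using gen_superset[of "insert x S"] by auto
  have "D x \<in> gen (insert x S)"
    using step.hyps(2)
  proof
    assume "x \<in> cl S"
    then have "algebraic_elt S x" using cl_eq_algebraic[OF S(1)] by auto
    moreover have "hom_on (gen (insert x S)) (\<lambda>y. y)" by (simp add: hom_on_def)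
    ultimately show ?thesis
      using hom_on_derivation_commute_algebraic[OF assms(2,2) S(1), of "\<lambda>y. y" x x] S(2) sub by auto
  next
    assume "\<exists>a\<in>S. a \<noteq> 0 \<and> D x = D a / a"
    then have "D x \<in> S" using S(2) fs_divide[OF S(1)] by auto
    then show ?thesis using sub by auto
  qed
  then have "D y \<in> gen (insert x S)" if "y \<in> gen (insert x S)" for y
    using gen_derivation_closed[OF assms(2) _ that] S(2) sub by auto
  then show ?case using gen_field_set by blast
qed

lemma (in large_field) fin_tower_small:
  assumes "fin_tower D P S" "derivation D" "field_set P" "\<And>x. x \<in> P \<Longrightarrow> D x \<in> P" "small P"
  shows "small S"
  using assms(1)
proof (induction rule: fin_tower.induct)
  case (step S x)
  have "field_set S" using fin_tower_field_set[OF step.hyps(1) assms(2-4)] by blast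
  then show ?case using small_gen_insert step.IH by blast
qed (use assms in simp)

section \<open>Copying subfields back to the given type\<close>

text \<open>The subfield \<open>T\<close> of a field copied along \<open>g\<close>, which is injective on \<open>S \<supseteq> T\<close>.\<close>
definition copy :: "('u::field \<Rightarrow> 'a) \<Rightarrow> 'u set \<Rightarrow> 'u set \<Rightarrow> 'a ring" where
  "copy g S T = \<lparr>carrier = g ` T, monoid.mult = (\<lambda>x y. g (inv_into S g x * inv_into S g y)), one = g 1,
     ring.zero = g 0, add = (\<lambda>x y. g (inv_into S g x + inv_into S g y))\<rparr>"

lemma copy_embedding:
  fixes g :: "'u::field_char_0 \<Rightarrow> 'a"
  assumes S: "inj_on g S" "T \<subseteq> S" and T: "field_set T"
  shows "field_embedding (copy g S T) (inv_into S g)"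
proof -
  have gi: "inv_into S g (g x) = x" if "x \<in> T" for x using that S by auto
  note cl = fs_0[OF T] fs_1[OF T] fs_add[OF T] fs_mult[OF T] fs_uminus[OF T] fs_inverse[OF T]
  interpret c: cring "copy g S T"
  proof (rule cringI)
    show "abelian_group (copy g S T)"
    proof (rule abelian_groupI)
      fix x assume "x \<in> carrier (copy g S T)"
      then obtain y where y: "x = g y" "y \<in> T" by (auto simp: copy_def)
      then have "g (- y) \<in> carrier (copy g S T) \<and> g (- y) \<oplus>\<^bsub>copy g S T\<^esub> x = \<zero>\<^bsub>copy g S T\<^esub>"
        using cl gi by (simp add: copy_def)
      then show "\<exists>y\<in>carrier (copy g S T). y \<oplus>\<^bsub>copy g S T\<^esub> x = \<zero>\<^bsub>copy g S T\<^esub>" by blast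
    qed (auto simp: copy_def gi cl add_ac)
    show "comm_monoid (copy g S T)"
      by (rule comm_monoidI) (auto simp: copy_def gi cl mult_ac)
  qed (auto simp: copy_def gi cl ring_distribs)
  have "field (copy g S T)"
  proof (rule c.cring_fieldI2)
    show "\<zero>\<^bsub>copy g S T\<^esub> \<noteq> \<one>\<^bsub>copy g S T\<^esub>"
      using gi[of 0] gi[of 1] cl by (simp add: copy_def) (metis zero_neq_one)
    fix a assume a: "a \<in> carrier (copy g S T)" "a \<noteq> \<zero>\<^bsub>copy g S T\<^esub>"
    then obtain y where y: "a = g y" "y \<in> T" "y \<noteq> 0" by (auto simp: copy_def)
    then have "g (inverse y) \<in> carrier (copy g S T)" "a \<otimes>\<^bsub>copy g S T\<^esub> g (inverse y) = \<one>\<^bsub>copy g S T\<^esub>"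
      using cl gi by (simp_all add: copy_def)
    then show "\<exists>b\<in>carrier (copy g S T). a \<otimes>\<^bsub>copy g S T\<^esub> b = \<one>\<^bsub>copy g S T\<^esub>" by blast
  qed
  then show ?thesis
    unfolding field_embedding_def field_embedding_axioms_def using gi cl
    by (auto simp: copy_def)
qed

lemma copy_differential_field:
  fixes g :: "'u::field_char_0 \<Rightarrow> 'a"
  assumes S: "inj_on g S" "T \<subseteq> S" and T: "field_set T" and D: "derivation D" "\<And>x. x \<in> T \<Longrightarrow> D x \<in> T"
  shows "differential_field (copy g S T) (\<lambda>x. g (D (inv_into S g x)))"
proof -
  interpret field_embedding "copy g S T" "inv_into S g" by (rule copy_embedding[OF S T])
  have gi: "inv_into S g (g x) = x" if "x \<in> T" for x using that S by auto
  note cl = fs_0[OF T] fs_1[OF T] fs_add[OF T] fs_mult[OF T] D(2)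
  have c: "carrier (copy g S T) = g ` T" by (simp add: copy_def)
  have "inv_into S g ([n] \<cdot>\<^bsub>copy g S T\<^esub> \<one>\<^bsub>copy g S T\<^esub>) = of_nat n" for n :: nat
  proof (induction n)
    case 0
    then show ?case using emb_zero by (simp add: add.nat_pow_0)
  next
    case (Suc n)
    then show ?case using emb_add emb_one by (simp add: add.nat_pow_Suc add.nat_pow_closed)
  qed
  then have cz: "[n] \<cdot>\<^bsub>copy g S T\<^esub> \<one>\<^bsub>copy g S T\<^esub> \<noteq> \<zero>\<^bsub>copy g S T\<^esub>" if "n > 0" for n :: nat
    using that emb_zero by (metis neq0_conv of_nat_0_eq_iff)
  show ?thesis
  proof (intro differential_field.intro differential_field_axioms.intro)
    show "field (copy g S T)" by (rule field_axioms)
  qed (use cz cl gi in \<open>auto simp: copy_def der_add[OF D(1)] der_mult[OF D(1)]\<close>)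
qed

lemma (in field_embedding) emb_log_deriv:
  assumes "x \<in> carrier R" "x \<noteq> \<zero>" "D x \<in> carrier R"
  shows "\<iota> (log_deriv R D x) = \<iota> (D x) / \<iota> x"
  using assms field_Units by (simp add: log_deriv_def emb_mult emb_inverse divide_inverse)

lemma (in field_embedding) emb_carrier_field_set: "field_set (\<iota> ` carrier R)"
  using emb_subfield[OF carrier_is_subfield] .

text \<open>Only containment is claimed, because the tower is closed at every level; algebraic steps
  leave it unchanged.\<close>

lemma (in field_embedding) elementary_ext_tower:
  assumes D: "\<And>x. x \<in> carrier R \<Longrightarrow> D x \<in> carrier R"
    and D': "\<And>x. x \<in> carrier R \<Longrightarrow> D' (\<iota> x) = \<iota> (D x)"
    and P: "subfield P R" "\<iota> ` P \<subseteq> N" "cl N = N"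
    and ext: "elementary_ext R D P S"
  shows "subfield S R \<and> (\<exists>T. elem_tower D' N T \<and> cl T = T \<and> \<iota> ` S \<subseteq> T)"
  using ext
proof (induction rule: elementary_ext.induct)
  case base
  then show ?case using P elem_tower.base by blast
next
  case (step S \<theta>)
  then obtain T where S: "subfield S R" and T: "elem_tower D' N T" "cl T = T" "\<iota> ` S \<subseteq> T" by blast
  note Sc = subfieldE(3)[OF S]
  have th: "\<theta> \<in> carrier R"
    using step.hyps(2) by (auto simp: algebraic_over_def exponential_over_def logarithmic_over_def is_log_def)
  have c: "insert \<theta> S \<subseteq> carrier R" using th Sc by auto
  have sf: "subfield (generate_field R (insert \<theta> S)) R" by (rule generate_field_is_subfield[OF c])
  have img: "\<iota> ` generate_field R (insert \<theta> S) = gen (insert (\<iota> \<theta>) (\<iota> ` S))"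
    using emb_generate_field[OF c] by simp
  have new: "\<iota> ` generate_field R (insert \<theta> S) \<subseteq> cl (insert (\<iota> \<theta>) T)"
  proof -
    have "gen (insert (\<iota> \<theta>) (\<iota> ` S)) \<subseteq> gen (insert (\<iota> \<theta>) T)" using T(3) by (intro gen_mono) auto
    then show ?thesis unfolding img using gen_subset_cl by blast
  qed
  consider "algebraic_over R S \<theta>" | "exponential_over R D S \<theta>" | "logarithmic_over R D S \<theta>"
    using step.hyps(2) by blast
  then have "\<exists>T'. elem_tower D' N T' \<and> cl T' = T' \<and> \<iota> ` generate_field R (insert \<theta> S) \<subseteq> T'"
  proof cases
    case 1
    then have "\<iota> \<theta> \<in> cl (\<iota> ` S)" using emb_algebraic[OF S th] by (simp add: algebraic_over_def)
    then have "\<iota> \<theta> \<in> T" using cl_mono[OF T(3)] T(2) by auto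
    then have "cl (insert (\<iota> \<theta>) T) = T" using T(2) by (simp add: insert_absorb)
    then show ?thesis using new T by auto
  next
    case 2
    then obtain u where u: "\<theta> \<noteq> \<zero>" "u \<in> S" "log_deriv R D \<theta> = D u" by (auto simp: exponential_over_def)
    then have "\<iota> (D \<theta>) / \<iota> \<theta> = \<iota> (D u)" using emb_log_deriv[of \<theta> D] th D by simp
    moreover have "\<iota> \<theta> \<noteq> 0" using emb_eq_0_iff[OF th] u(1) by simp
    ultimately have "D' (\<iota> \<theta>) = \<iota> \<theta> * D' (\<iota> u)" using D' th u(2) Sc by (auto simp: field_simps)
    moreover have "\<iota> u \<in> T" using u(2) T(3) by auto
    ultimately have "elem_tower D' N (cl (insert (\<iota> \<theta>) T))" using elem_tower.exp[OF T(1)] by blast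
    then show ?thesis using new by auto
  next
    case 3
    then obtain u where u: "u \<in> S" "u \<noteq> \<zero>" "D \<theta> = log_deriv R D u"
      by (auto simp: logarithmic_over_def is_log_def)
    have uc: "u \<in> carrier R" using u(1) Sc by auto
    have "\<iota> (D \<theta>) = \<iota> (D u) / \<iota> u" unfolding u(3) using emb_log_deriv[of u D] uc u(2) D by simp
    then have "D' (\<iota> \<theta>) = D' (\<iota> u) / \<iota> u" using D' th uc by simp
    moreover have "\<iota> u \<noteq> 0" "\<iota> u \<in> T" using emb_eq_0_iff[OF uc] u T(3) by auto
    ultimately have "elem_tower D' N (cl (insert (\<iota> \<theta>) T))" using elem_tower.log[OF T(1)] by blast
    then show ?thesis using new by auto
  qed
  then show ?case using sf by blast
qed

text \<open>Each generator is copied to one of the same kind. Generation of subfields commutes with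
  copying because the inverse map is an embedding.\<close>

lemma copy_fin_tower:
  fixes g :: "'u::field_char_0 \<Rightarrow> 'a"
  assumes T: "fin_tower D P T" "T \<subseteq> S" and D: "derivation D" "\<And>x. x \<in> P \<Longrightarrow> D x \<in> P" "field_set P"
    and S: "inj_on g S" "field_set S" "\<And>x. x \<in> S \<Longrightarrow> D x \<in> S"
  shows "elementary_ext (copy g S S) (\<lambda>x. g (D (inv_into S g x))) (g ` P) (g ` T)"
  using T
proof (induction rule: fin_tower.induct)
  case base
  then show ?case by (simp add: elementary_ext.base)
next
  case (step T x)
  let ?R = "copy g S S" and ?D = "\<lambda>x. g (D (inv_into S g x))"
  interpret field_embedding ?R "inv_into S g" by (rule copy_embedding[OF S(1) order_refl S(2)])
  have c: "carrier ?R = g ` S" by (simp add: copy_def)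
  have gi: "inv_into S g (g y) = y" if "y \<in> S" for y using that S(1) by simp
  have sub: "insert x T \<subseteq> S" using step.prems gen_superset[of "insert x T"] by auto
  have T: "field_set T" "\<And>y. y \<in> T \<Longrightarrow> D y \<in> T"
    using fin_tower_field_set[OF step.hyps(1) D(1,3,2)] by blast+
  have gig: "inv_into S g ` g ` Z = Z" if "Z \<subseteq> S" for Z using that S(1) by (simp add: inv_into_image_cancel)
  have gT: "g ` insert x T \<subseteq> carrier ?R" using sub c by auto
  have "inv_into S g ` generate_field ?R (g ` insert x T) = gen (insert x T)"
    using emb_generate_field[OF gT] gig[OF sub] by simp
  then have "g ` gen (insert x T) = g ` inv_into S g ` generate_field ?R (g ` insert x T)" by simp
  also have "\<dots> = generate_field ?R (g ` insert x T)"
    using generate_field_incl[OF gT] c by (simp add: image_inv_into_cancel[OF refl])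
  finally have gen: "g ` gen (insert x T) = generate_field ?R (insert (g x) (g ` T))" by simp
  have "subfield (g ` T) ?R"
  proof -
    have gT': "g ` T \<subseteq> carrier ?R" using gT by auto
    have "inv_into S g ` generate_field ?R (g ` T) = gen T"
      using emb_generate_field[OF gT'] gig[of T] sub by simp
    then have "inv_into S g ` generate_field ?R (g ` T) = T" using gen_id[OF T(1)] by simp
    then have "g ` T = g ` inv_into S g ` generate_field ?R (g ` T)" by simp
    also have "\<dots> = generate_field ?R (g ` T)"
      using generate_field_incl[OF gT'] c by (simp add: image_inv_into_cancel[OF refl])
    finally show ?thesis using generate_field_is_subfield[OF gT'] by simp
  qed
  note sf = this
  have xc: "g x \<in> carrier ?R" using gT by auto
  have "algebraic_over ?R (g ` T) (g x) \<or> logarithmic_over ?R ?D (g ` T) (g x)"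
    using step.hyps(2)
  proof
    assume "x \<in> cl T"
    then have "algebraic (g ` T) (g x)"
      using emb_algebraic[OF sf xc] gi[of x] gig[of T] sub by auto
    then show ?thesis using xc by (simp add: algebraic_over_def)
  next
    assume "\<exists>a\<in>T. a \<noteq> 0 \<and> D x = D a / a"
    then obtain a where a: "a \<in> T" "a \<noteq> 0" "D x = D a / a" by blast
    have aS: "a \<in> S" "g a \<in> carrier ?R" "x \<in> S" using a(1) sub c by auto
    have az: "g a \<noteq> \<zero>\<^bsub>?R\<^esub>" using emb_zero gi[OF aS(1)] a(2) by metis
    have Dc: "?D (g a) \<in> carrier ?R" "?D (g x) \<in> carrier ?R" using S(3) gi aS c by auto
    have ld: "log_deriv ?R ?D (g a) \<in> carrier ?R"
      using Dc az aS field_Units by (simp add: log_deriv_def)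
    have "inv_into S g (?D (g x)) = inv_into S g (log_deriv ?R ?D (g a))"
      using emb_log_deriv[of "g a" ?D] aS(2) az Dc gi gi[OF S(3)[OF aS(3)]] aS S(3) a(3) by simp
    then have "?D (g x) = log_deriv ?R ?D (g a)"
      using emb_inj Dc ld by (meson inj_onD)
    then show ?thesis using a(1) aS az xc by (auto simp: logarithmic_over_def is_log_def)
  qed
  moreover have "elementary_ext ?R ?D (g ` P) (g ` T)" using step.IH sub by auto
  ultimately show ?case unfolding gen by (blast intro: elementary_ext.step)
qed

text \<open>Base field and extension are copied along the same \<open>g\<close>, so the map between
  them is the identity and one formula gives both derivations. The hypothesis \<open>const\<close>
  becomes the clause on constants in \<open>log_ext\<close>.\<close>

lemma copy_polylog:
  fixes g :: "'u::field_char_0 \<Rightarrow> 'a" and n :: nat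
  assumes D: "derivation D" and P: "field_set P" "\<And>x. x \<in> P \<Longrightarrow> D x \<in> P"
    and S: "fin_tower D P S" "inj_on g S" and E: "E \<in> S" and f: "f \<in> P"
    and data: "\<And>i. i < n \<Longrightarrow> h i \<in> P \<and> h i \<noteq> 0 \<and> h i \<noteq> 1 \<and> l i \<in> S \<and> D (l i) = D (h i) / h i \<and>
      d i \<in> P \<and> D (d i) = 0 \<and> k i > 0"
    and const: "\<And>y. y \<in> gen (P \<union> l ` {..<n}) \<Longrightarrow> D y = 0 \<Longrightarrow> y \<in> P"
    and eq: "f = D E + (\<Sum>i<n. d i * (D (1 - h i) / (1 - h i)) * l i ^ k i)"
  shows "has_polylog_integral (copy g S P) (\<lambda>x. g (D (inv_into S g x))) (carrier (copy g S P)) (g f)"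
proof -
  let ?F = "copy g S P" and ?R = "copy g S S" and ?D = "\<lambda>x. g (D (inv_into S g x))"
  have FS: "field_set S" "\<And>y. y \<in> S \<Longrightarrow> D y \<in> S"
    using fin_tower_field_set[OF S(1) D P] by blast+
  have PS: "P \<subseteq> S" by (rule fin_tower_superset[OF S(1)])
  have gi: "inv_into S g (g y) = y" if "y \<in> S" for y using that S(2) by simp
  have gig: "inv_into S g ` g ` Z = Z" if "Z \<subseteq> S" for Z using that S(2) by (simp add: inv_into_image_cancel)
  have c: "carrier ?R = g ` S" "carrier ?F = g ` P" by (simp_all add: copy_def)
  interpret R: field_embedding ?R "inv_into S g" by (rule copy_embedding[OF S(2) order_refl FS(1)])
  have ops: "\<zero>\<^bsub>?R\<^esub> = g 0" "\<one>\<^bsub>?R\<^esub> = g 1" "\<zero>\<^bsub>?F\<^esub> = g 0" "\<one>\<^bsub>?F\<^esub> = g 1" by (simp_all add: copy_def)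
  have inS: "0 \<in> S" "1 \<in> S" using fs_0[OF FS(1)] fs_1[OF FS(1)] .
  have ginj: "g x = g y \<longleftrightarrow> x = y" if "x \<in> S" "y \<in> S" for x y using that S(2) by (auto dest: inj_onD)
  let ?B = "P \<union> l ` {..<n}"
  define L where "L = generate_field ?R (g ` ?B)"
  have BS: "?B \<subseteq> S" using data PS by auto
  have gB: "g ` ?B \<subseteq> carrier ?R" using BS c by auto
  have iL: "inv_into S g ` L = gen ?B" unfolding L_def using R.emb_generate_field[OF gB] gig[OF BS] by simp
  have Lc: "L \<subseteq> g ` S" unfolding L_def using R.generate_field_incl[OF gB] c by simp
  have gBL: "g ` ?B \<subseteq> L" unfolding L_def by (intro subsetI generate_field.incl)
  have Dc: "?D x \<in> carrier ?R" if "x \<in> carrier ?R" for x using that c gi FS(2) by auto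
  have eqI: "x = y" if "x \<in> carrier ?R" "y \<in> carrier ?R" "inv_into S g x = inv_into S g y" for x y
    using R.emb_inj that by (meson inj_onD)
  have ld: "log_deriv ?R ?D x \<in> carrier ?R \<and>
      inv_into S g (log_deriv ?R ?D x) = D (inv_into S g x) / inv_into S g x"
    if "x \<in> carrier ?R" "x \<noteq> \<zero>\<^bsub>?R\<^esub>" for x
  proof
    show "log_deriv ?R ?D x \<in> carrier ?R" using that Dc R.field_Units by (simp add: log_deriv_def)
    have "inv_into S g x \<in> S" using that(1) c by (metis inv_into_into)
    then show "inv_into S g (log_deriv ?R ?D x) = D (inv_into S g x) / inv_into S g x"
      using R.emb_log_deriv[OF that, of ?D] Dc[OF that(1)] gi FS(2) by simp
  qed
  have log: "is_log ?R ?D (g (h i)) (g (l i))" if i: "i < n" for i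
  proof -
    have m: "h i \<in> S" "l i \<in> S" "h i \<noteq> 0" "D (l i) = D (h i) / h i" using data[OF i] PS by auto
    then have z: "g (h i) \<noteq> \<zero>\<^bsub>?R\<^esub>" using ops ginj inS by simp
    have hc: "g (h i) \<in> carrier ?R" "g (l i) \<in> carrier ?R" using m c by auto
    have "?D (g (l i)) = log_deriv ?R ?D (g (h i))"
    proof (rule eqI[OF Dc[OF hc(2)]])
      show "log_deriv ?R ?D (g (h i)) \<in> carrier ?R" using ld[OF hc(1) z] by blast
      have "inv_into S g (?D (g (l i))) = D (l i)" using gi[OF m(2)] gi[OF FS(2)[OF m(2)]] by simp
      then show "inv_into S g (?D (g (l i))) = inv_into S g (log_deriv ?R ?D (g (h i)))"
        using ld[OF hc(1) z] m(4) gi[OF m(1)] by simp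
    qed
    then show ?thesis using hc z by (simp add: is_log_def)
  qed
  have H1: "differential_field ?R ?D" by (rule copy_differential_field[OF S(2) order_refl FS(1) D FS(2)])
  have H2: "differential_hom ?F ?D ?R ?D id"
    using PS by (auto simp: differential_hom_def ring_hom_def copy_def)
  have H3: "elementary_ext ?R ?D (id ` carrier ?F) (carrier ?R)"
    using copy_fin_tower[OF S(1) order_refl D P(2,1) S(2) FS] c by simp
  have H4: "log_ext ?R ?D (id ` carrier ?F) L"
    unfolding log_ext_def
  proof (intro conjI exI)
    show "finite (g ` l ` {..<n})" by simp
    show "\<forall>x\<in>g ` l ` {..<n}. logarithmic_over ?R ?D (id ` carrier ?F) x"
      using log data c by (auto simp: logarithmic_over_def)
    show "L = generate_field ?R (id ` carrier ?F \<union> g ` l ` {..<n})"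
      by (simp add: L_def c image_Un)
    show "constants_in ?R ?D L = constants_in ?R ?D (id ` carrier ?F)"
    proof
      show "constants_in ?R ?D (id ` carrier ?F) \<subseteq> constants_in ?R ?D L"
        using gBL c by (auto simp: constants_in_def)
      show "constants_in ?R ?D L \<subseteq> constants_in ?R ?D (id ` carrier ?F)"
      proof
        fix x assume "x \<in> constants_in ?R ?D L"
        then have x: "x \<in> L" "?D x = g 0" by (auto simp: constants_in_def ops)
        obtain y where y: "x = g y" "y \<in> S" using x(1) Lc by blast
        have "y \<in> gen ?B" using iL x(1) y gi by (metis imageI)
        moreover have "D y = 0" using x(2) y gi ginj[OF FS(2)[OF y(2)] inS(1)] by simp
        ultimately have "y \<in> P" by (rule const)
        then show "x \<in> constants_in ?R ?D (id ` carrier ?F)" using x y c by (auto simp: constants_in_def ops)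
      qed
    qed
  qed
  have H5: "g E \<in> carrier ?R" using E c by auto
  have H6: "\<forall>i<n. g (h i) \<in> carrier ?F - {\<zero>\<^bsub>?F\<^esub>, \<one>\<^bsub>?F\<^esub>} \<and> g (l i) \<in> L \<and>
      is_log ?R ?D (id (g (h i))) (g (l i)) \<and> g (d i) \<in> constants_in ?R ?D L \<and> k i > 0"
  proof (intro allI impI)
    fix i assume i: "i < n"
    note x = data[OF i]
    have "g (h i) \<in> carrier ?F" "g (h i) \<noteq> g 0" "g (h i) \<noteq> g 1" using x c PS ginj inS by auto
    moreover have "g (l i) \<in> L" "g (d i) \<in> L" using gBL x i by auto
    moreover have "?D (g (d i)) = g 0" using x gi PS by auto
    ultimately show "g (h i) \<in> carrier ?F - {\<zero>\<^bsub>?F\<^esub>, \<one>\<^bsub>?F\<^esub>} \<and> g (l i) \<in> L \<and>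
      is_log ?R ?D (id (g (h i))) (g (l i)) \<and> g (d i) \<in> constants_in ?R ?D L \<and> k i > 0"
      using log[OF i] x by (simp add: ops constants_in_def)
  qed
  have H7: "id (g f) = ?D (g E) \<oplus>\<^bsub>?R\<^esub> (\<Oplus>\<^bsub>?R\<^esub>i\<in>{..<n}. g (d i) \<otimes>\<^bsub>?R\<^esub>
      log_deriv ?R ?D (\<one>\<^bsub>?R\<^esub> \<ominus>\<^bsub>?R\<^esub> id (g (h i))) \<otimes>\<^bsub>?R\<^esub> (g (l i) [^]\<^bsub>?R\<^esub> k i))"
  proof -
    let ?t = "\<lambda>i. g (d i) \<otimes>\<^bsub>?R\<^esub> log_deriv ?R ?D (\<one>\<^bsub>?R\<^esub> \<ominus>\<^bsub>?R\<^esub> id (g (h i))) \<otimes>\<^bsub>?R\<^esub> (g (l i) [^]\<^bsub>?R\<^esub> k i)"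
    have t: "?t i \<in> carrier ?R \<and> inv_into S g (?t i) = d i * (D (1 - h i) / (1 - h i)) * l i ^ k i" if i: "i < n" for i
    proof -
      note x = data[OF i]
      have m: "g (d i) \<in> carrier ?R" "g (h i) \<in> carrier ?R" "g (l i) \<in> carrier ?R"
        "inv_into S g (g (d i)) = d i" "inv_into S g (g (h i)) = h i" "inv_into S g (g (l i)) = l i"
        using x PS c gi by auto
      have o: "\<one>\<^bsub>?R\<^esub> \<ominus>\<^bsub>?R\<^esub> g (h i) \<in> carrier ?R" using m by simp
      have io: "inv_into S g (\<one>\<^bsub>?R\<^esub> \<ominus>\<^bsub>?R\<^esub> g (h i)) = 1 - h i"
        using R.emb_minus[OF R.one_closed m(2)] R.emb_one m(5) by simp
      have "\<one>\<^bsub>?R\<^esub> \<ominus>\<^bsub>?R\<^esub> g (h i) \<noteq> \<zero>\<^bsub>?R\<^esub>"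
        using io R.emb_zero x by (metis eq_iff_diff_eq_0)
      from ld[OF o this] show ?thesis
        using m by (simp add: R.emb_mult R.emb_pow io)
    qed
    have "inv_into S g (\<Oplus>\<^bsub>?R\<^esub>i\<in>{..<n}. ?t i) = (\<Sum>i<n. d i * (D (1 - h i) / (1 - h i)) * l i ^ k i)"
      using t by (subst R.emb_finsum) auto
    moreover have fc: "(\<Oplus>\<^bsub>?R\<^esub>i\<in>{..<n}. ?t i) \<in> carrier ?R" using t by (intro R.finsum_closed) auto
    moreover have ec: "?D (g E) \<in> carrier ?R" "inv_into S g (?D (g E)) = D E"
      using E FS(2) c gi by auto
    ultimately have "inv_into S g (?D (g E) \<oplus>\<^bsub>?R\<^esub> (\<Oplus>\<^bsub>?R\<^esub>i\<in>{..<n}. ?t i)) = f"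
      using R.emb_add[OF ec(1) fc] eq by simp
    moreover have "g f \<in> carrier ?R" "inv_into S g (g f) = f" using f PS c gi by auto
    moreover have "?D (g E) \<oplus>\<^bsub>?R\<^esub> (\<Oplus>\<^bsub>?R\<^esub>i\<in>{..<n}. ?t i) \<in> carrier ?R" using ec(1) fc by simp
    ultimately have "g f = ?D (g E) \<oplus>\<^bsub>?R\<^esub> (\<Oplus>\<^bsub>?R\<^esub>i\<in>{..<n}. ?t i)" using eqI by simp
    then show ?thesis by simp
  qed
  show ?thesis
    unfolding has_polylog_integral_def
    by (rule exI[of _ ?R], rule exI[of _ ?D], rule exI[of _ id], rule exI[of _ L], rule exI[of _ "g E"],
        rule exI[of _ n], rule exI[of _ "\<lambda>i. g (h i)"], rule exI[of _ "\<lambda>i. g (l i)"],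
        rule exI[of _ "\<lambda>i. g (d i)"], rule exI[of _ k], intro conjI H1 H2 H3 H4 H5 H6 H7)
qed

text \<open>The theorem for an instance whose elementary extension \<open>M\<close> embeds into a
  larger algebraically closed type. \<open>M\<close> suffices, since it receives \<open>K\<close>
  through \<open>\<phi>\<close>.\<close>

lemma descent_from_embedding:
  fixes K M :: "'a ring" and D D' :: "'a \<Rightarrow> 'a" and F L :: "'a set" and \<theta> f E :: 'a and n :: nat
    and k :: "nat \<Rightarrow> nat" and \<iota> :: "'a \<Rightarrow> 'u::{alg_closed_field, field_char_0}"
  assumes K: "differential_field K D"
    and F: "differential_subfield F K D"
    and cF: "constants_in K D (carrier K) = constants_in K D F"
    and th: "exponential_over K D F \<theta>"
    and alg: "\<forall>x\<in>carrier K. algebraic_over K (generate_field K (insert \<theta> F)) x"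
    and f: "f \<in> F"
    and pK: "has_polylog_integral K D (carrier K) f"
    and M: "differential_field M D'" and hom: "differential_hom K D M D' \<phi>"
    and ext: "elementary_ext M D' (\<phi> ` carrier K) (carrier M)"
    and L: "log_ext M D' (\<phi> ` carrier K) L" and E: "E \<in> carrier M"
    and data: "\<forall>i<n. h i \<in> carrier K - {\<zero>\<^bsub>K\<^esub>, \<one>\<^bsub>K\<^esub>} \<and> l i \<in> L \<and> is_log M D' (\<phi> (h i)) (l i) \<and>
      d i \<in> constants_in M D' L \<and> k i > 0"
    and eq: "\<phi> f = D' E \<oplus>\<^bsub>M\<^esub>
          (\<Oplus>\<^bsub>M\<^esub>i\<in>{..<n}. d i \<otimes>\<^bsub>M\<^esub> log_deriv M D' (\<one>\<^bsub>M\<^esub> \<ominus>\<^bsub>M\<^esub> \<phi> (h i)) \<otimes>\<^bsub>M\<^esub> (l i [^]\<^bsub>M\<^esub> k i))"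
    and emb: "field_embedding M \<iota>" and large: "\<not> |UNIV :: 'u set| \<le>o |UNIV :: 'a set|"
  shows "\<exists>(F' :: 'a ring) D' \<psi>.
           differential_field F' D' \<and>
           differential_hom (K\<lparr>carrier := F\<rparr>) D F' D' \<psi> \<and>
           (\<forall>x\<in>carrier F'. algebraic_over F' (\<psi> ` F) x) \<and>
           has_polylog_integral F' D' (carrier F') (\<psi> f)"
proof -
  interpret K: differential_field K D by (rule K)
  interpret M: differential_field M D' by (rule M)
  interpret I: field_embedding M \<iota> by (rule emb)
  have Fsub: "subfield F K" and DF: "\<And>x. x \<in> F \<Longrightarrow> D x \<in> F" using F by (auto simp: differential_subfield_def)
  have FK: "F \<subseteq> carrier K" by (rule subfieldE(3)[OF Fsub])
  have phi: "\<phi> \<in> ring_hom K M" and phiD: "\<And>x. x \<in> carrier K \<Longrightarrow> \<phi> (D x) = D' (\<phi> x)"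
    using hom by (auto simp: differential_hom_def)
  note phic = ring_hom_closed[OF phi]
  define \<kappa> where "\<kappa> x = \<iota> (\<phi> x)" for x
  interpret J: field_embedding K \<kappa>
    by unfold_locales (auto simp: \<kappa>_def ring_hom_one[OF phi] ring_hom_add[OF phi] ring_hom_mult[OF phi]
        I.emb_one I.emb_add I.emb_mult phic)
  have phi_img: "subfield (\<phi> ` carrier K) M"
  proof -
    have pc: "\<phi> ` carrier K \<subseteq> carrier M" using phic by auto
    have "generate_field M (\<phi> ` carrier K) \<subseteq> \<phi> ` carrier K"
    proof
      fix y assume "y \<in> generate_field M (\<phi> ` carrier K)"
      then have y: "\<iota> y \<in> gen (\<iota> ` \<phi> ` carrier K)" "y \<in> carrier M"
        using I.emb_generate_field[OF pc] M.generate_field_in_carrier[OF pc] by auto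
      have "\<iota> ` \<phi> ` carrier K = \<kappa> ` carrier K" by (simp add: image_image \<kappa>_def)
      then have "\<iota> y \<in> \<kappa> ` carrier K" using y(1) gen_id[OF J.emb_carrier_field_set] by simp
      then obtain x where x: "x \<in> carrier K" "\<iota> y = \<iota> (\<phi> x)" by (auto simp: \<kappa>_def)
      then have "y = \<phi> x" using I.emb_inj y(2) phic by (meson inj_onD)
      then show "y \<in> \<phi> ` carrier K" using x(1) by blast
    qed
    then have "generate_field M (\<phi> ` carrier K) = \<phi> ` carrier K" using generate_field.incl[of _ "\<phi> ` carrier K" M] by (intro subset_antisym subsetI) auto
    then show ?thesis using M.generate_field_is_subfield[OF pc] by simp
  qed
  have inf: "infinite (UNIV :: 'a set)"
  proof
    assume "finite (UNIV :: 'a set)"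
    then have "finite (\<iota> ` carrier M)" using finite_subset[OF subset_UNIV] by blast
    moreover have "range (of_nat :: nat \<Rightarrow> 'u) \<subseteq> \<iota> ` carrier M"
      using fs_of_nat[OF I.emb_carrier_field_set] by auto
    ultimately have "finite (range (of_nat :: nat \<Rightarrow> 'u))" by (rule finite_subset[rotated])
    then show False using finite_imageD[OF _ inj_of_nat] by auto
  qed
  interpret U: large_field "UNIV :: 'a set" "TYPE('u)" by unfold_locales (rule inf large)+
  \<comment> \<open>The derivation of \<open>M\<close> on its image. It is then extended to all of
    \<open>'u\<close>, as \<open>cl\<close> and the redefinition of derivations require.\<close>
  define d0 where "d0 y = \<iota> (D' (inv_into (carrier M) \<iota> y))" for y
  have d0: "d0 (\<iota> x) = \<iota> (D' x)" if "x \<in> carrier M" for x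
    using I.emb_inj that by (simp add: d0_def)
  have "derivation_on (\<iota> ` carrier M) d0"
    unfolding derivation_on_def
  proof (intro ballI)
    fix x y assume "x \<in> \<iota> ` carrier M" "y \<in> \<iota> ` carrier M"
    then obtain a b where ab: "a \<in> carrier M" "b \<in> carrier M" "x = \<iota> a" "y = \<iota> b" by blast
    have "d0 (\<iota> (a \<oplus>\<^bsub>M\<^esub> b)) = \<iota> (D' a) + \<iota> (D' b)"
      unfolding d0[OF M.add.m_closed[OF ab(1,2)]] using ab by (simp add: M.D_add M.D_closed I.emb_add)
    moreover have "d0 (\<iota> (a \<otimes>\<^bsub>M\<^esub> b)) = \<iota> (D' a) * \<iota> b + \<iota> a * \<iota> (D' b)"
      unfolding d0[OF M.m_closed[OF ab(1,2)]] using ab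
      by (simp add: M.D_mult M.D_closed I.emb_add I.emb_mult)
    ultimately show "d0 (x + y) = d0 x + d0 y \<and> d0 (x * y) = d0 x * y + x * d0 y"
      using ab by (simp add: d0 I.emb_add I.emb_mult)
  qed
  then obtain DU where DU: "derivation DU" "\<And>y. y \<in> \<iota> ` carrier M \<Longrightarrow> DU y = d0 y"
    using derivation_extend[OF I.emb_carrier_field_set] by metis
  have DM: "DU (\<iota> x) = \<iota> (D' x)" if "x \<in> carrier M" for x using DU(2) d0 that by simp
  have DK: "DU (\<kappa> x) = \<kappa> (D x)" if "x \<in> carrier K" for x
    using DM[OF phic[OF that]] phiD[OF that] by (simp add: \<kappa>_def)
  define KU FU where "KU = \<kappa> ` carrier K" and "FU = \<kappa> ` F"
  have KU: "field_set KU" unfolding KU_def by (rule J.emb_carrier_field_set)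
  have FU: "field_set FU" unfolding FU_def by (rule J.emb_subfield[OF Fsub])
  have FKU: "FU \<subseteq> KU" using FK by (auto simp: FU_def KU_def)
  have DFU: "DU x \<in> FU" if "x \<in> FU" for x using that DK DF FK by (auto simp: FU_def)
  have DKU: "DU x \<in> KU" if "x \<in> KU" for x using that DK K.D_closed by (auto simp: KU_def)
  obtain u where u: "\<theta> \<in> carrier K" "\<theta> \<noteq> \<zero>\<^bsub>K\<^esub>" "u \<in> F" "log_deriv K D \<theta> = D u"
    using th by (auto simp: exponential_over_def)
  define t where "t = \<kappa> \<theta>"
  have t: "t \<in> KU" "t \<noteq> 0" "\<kappa> u \<in> FU" using u J.emb_eq_0_iff by (auto simp: t_def KU_def FU_def)
  have Dt: "DU t = t * DU (\<kappa> u)"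
  proof -
    have "\<kappa> (D \<theta>) / \<kappa> \<theta> = \<kappa> (D u)" using J.emb_log_deriv[of \<theta> D] u K.D_closed by simp
    then show ?thesis using DK u FK t(2) by (auto simp: t_def field_simps)
  qed
  have KUcl: "KU \<subseteq> cl (insert t FU)"
  proof
    fix y assume "y \<in> KU"
    then obtain x where x: "x \<in> carrier K" "y = \<kappa> x" by (auto simp: KU_def)
    have c: "insert \<theta> F \<subseteq> carrier K" using u FK by auto
    have "\<kappa> x \<in> cl (\<kappa> ` generate_field K (insert \<theta> F))"
      using J.emb_algebraic[OF K.generate_field_is_subfield[OF c] x(1)] alg x(1) by (simp add: algebraic_over_def)
    then show "y \<in> cl (insert t FU)" using J.emb_generate_field[OF c] x by (simp add: t_def FU_def)
  qed
  show ?thesis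
  proof (cases "t \<in> cl FU")
    case True
    have KF: "KU \<subseteq> cl FU" using KUcl True cl_minimal[of "insert t FU" FU] cl_superset[of FU] by auto
    have "algebraic_over K (id ` F) x" if "x \<in> carrier K" for x
      using J.emb_algebraic[OF Fsub that] KF that by (auto simp: algebraic_over_def KU_def FU_def)
    moreover have "differential_hom (K\<lparr>carrier := F\<rparr>) D K D id"
      using FK by (auto simp: differential_hom_def ring_hom_def)
    ultimately show ?thesis
      using K pK by (intro exI[of _ K] exI[of _ D] exI[of _ id]) simp
  next
    case False
    have hd: "h i \<in> carrier K" "h i \<noteq> \<zero>\<^bsub>K\<^esub>" "h i \<noteq> \<one>\<^bsub>K\<^esub>" "l i \<in> L" "is_log M D' (\<phi> (h i)) (l i)"
      "d i \<in> constants_in M D' L" "k i > 0" if "i < n" for i using data that by auto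
    have lc: "l i \<in> carrier M" "D' (l i) = log_deriv M D' (\<phi> (h i))" "\<phi> (h i) \<noteq> \<zero>\<^bsub>M\<^esub>" if "i < n" for i
      using hd(5)[OF that] by (auto simp: is_log_def)
    have lU: "DU (\<iota> (l i)) = DU (\<kappa> (h i)) / \<kappa> (h i)" if i: "i < n" for i
      using I.emb_log_deriv[of "\<phi> (h i)" D'] lc[OF i] phic[OF hd(1)[OF i]] M.D_closed
      by (simp add: DM \<kappa>_def)
    obtain S where S: "L = generate_field M (\<phi> ` carrier K \<union> S)" "\<forall>x\<in>S. logarithmic_over M D' (\<phi> ` carrier K) x"
      and cL: "constants_in M D' L = constants_in M D' (\<phi> ` carrier K)" using L by (auto simp: log_ext_def)
    have Sc: "\<phi> ` carrier K \<union> S \<subseteq> carrier M" using S(2) phic by (auto simp: logarithmic_over_def is_log_def)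
    have Lc: "L \<subseteq> carrier M" unfolding S(1) by (rule M.generate_field_incl[OF Sc])
    have iL: "\<iota> ` L = gen (\<iota> ` (\<phi> ` carrier K \<union> S))" unfolding S(1) by (rule I.emb_generate_field[OF Sc])
    have KL: "\<phi> ` carrier K \<subseteq> L" unfolding S(1) using generate_field.incl[of _ "\<phi> ` carrier K \<union> S" M] by auto
    \<comment> \<open>Constants of \<open>L\<close> come from \<open>K\<close> by
      \<open>log_ext\<close>, and those of \<open>K\<close> are in \<open>F\<close> by
      hypothesis.\<close>
    have constL: "\<exists>x\<in>F. D x = \<zero>\<^bsub>K\<^esub> \<and> z = \<phi> x" if z: "z \<in> L" "D' z = \<zero>\<^bsub>M\<^esub>" for z
    proof -
      have "z \<in> constants_in M D' (\<phi> ` carrier K)" using z cL by (auto simp: constants_in_def)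
      then obtain x where x: "x \<in> carrier K" "z = \<phi> x" by (auto simp: constants_in_def)
      have "\<kappa> (D x) = 0" using z(2) x phiD by (simp add: \<kappa>_def I.emb_zero)
      then have "D x = \<zero>\<^bsub>K\<^esub>" using J.emb_eq_0_iff[OF K.D_closed[OF x(1)]] by simp
      then have "x \<in> constants_in K D F" using x(1) cF by (auto simp: constants_in_def)
      then show ?thesis using x(2) by (auto simp: constants_in_def)
    qed
    define lu where "lu i = \<iota> (l i)" for i
    define du where "du i = \<iota> (d i)" for i
    define hu where "hu i = \<kappa> (h i)" for i
    have subL: "gen (KU \<union> lu ` {..<n}) \<subseteq> \<iota> ` L"
    proof (rule gen_least)
      show "field_set (\<iota> ` L)" unfolding iL by (rule gen_field_set)
      show "KU \<union> lu ` {..<n} \<subseteq> \<iota> ` L" using KL hd(4) by (auto simp: KU_def \<kappa>_def lu_def)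
    qed
    have const: "y \<in> FU" if y: "y \<in> gen (KU \<union> lu ` {..<n})" "DU y = 0" for y
    proof -
      obtain z where z: "z \<in> L" "y = \<iota> z" using y(1) subL by blast
      then have "\<iota> (D' z) = 0" using y(2) DM Lc by auto
      then have "D' z = \<zero>\<^bsub>M\<^esub>" using I.emb_eq_0_iff M.D_closed z(1) Lc by auto
      then show ?thesis using constL[OF z(1)] z(2) by (auto simp: FU_def \<kappa>_def)
    qed
    have dU: "du i \<in> FU \<and> DU (du i) = 0" if i: "i < n" for i
    proof -
      have "d i \<in> L" "D' (d i) = \<zero>\<^bsub>M\<^esub>" using hd(6)[OF i] by (auto simp: constants_in_def)
      from constL[OF this] obtain x where "x \<in> F" "D x = \<zero>\<^bsub>K\<^esub>" "d i = \<phi> x" by blast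
      then show ?thesis using DK FK J.emb_zero by (auto simp: du_def FU_def \<kappa>_def)
    qed
    define N where "N = cl (KU \<union> lu ` {..<n})"
    have KN: "\<iota> ` \<phi> ` carrier K \<subseteq> N"
      using cl_superset[of "KU \<union> lu ` {..<n}"] by (auto simp: N_def KU_def \<kappa>_def)
    have "cl N = N" by (simp add: N_def)
    from I.elementary_ext_tower[OF M.D_closed DM phi_img KN this ext]
    obtain T where T: "elem_tower DU N T" "\<iota> ` carrier M \<subseteq> T" by blast
    have hU: "hu i \<in> KU \<and> hu i \<noteq> 0 \<and> hu i \<noteq> 1" if i: "i < n" for i
    proof -
      have "\<kappa> (h i) \<noteq> \<kappa> \<one>\<^bsub>K\<^esub>" using J.emb_inj hd(1,3)[OF i] by (metis inj_onD K.one_closed)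
      then show ?thesis using hd(1,2)[OF i] J.emb_eq_0_iff J.emb_one by (auto simp: hu_def KU_def)
    qed
    have fU: "\<kappa> f \<in> FU" using f by (simp add: FU_def)
    have eqU: "\<kappa> f = DU (\<iota> E) + (\<Sum>i<n. du i * (DU (1 - hu i) / (1 - hu i)) * lu i ^ k i)"
    proof -
      let ?t = "\<lambda>i. d i \<otimes>\<^bsub>M\<^esub> log_deriv M D' (\<one>\<^bsub>M\<^esub> \<ominus>\<^bsub>M\<^esub> \<phi> (h i)) \<otimes>\<^bsub>M\<^esub> (l i [^]\<^bsub>M\<^esub> k i)"
      have t: "?t i \<in> carrier M \<and> \<iota> (?t i) = du i * (DU (1 - hu i) / (1 - hu i)) * lu i ^ k i" if i: "i < n" for i
      proof -
        have m: "d i \<in> carrier M" "\<phi> (h i) \<in> carrier M" "l i \<in> carrier M"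
          using hd(6)[OF i] Lc phic hd(1)[OF i] lc[OF i] by (auto simp: constants_in_def)
        have o: "\<one>\<^bsub>M\<^esub> \<ominus>\<^bsub>M\<^esub> \<phi> (h i) \<in> carrier M" using m by simp
        have io: "\<iota> (\<one>\<^bsub>M\<^esub> \<ominus>\<^bsub>M\<^esub> \<phi> (h i)) = 1 - hu i"
          using I.emb_minus[OF M.one_closed m(2)] I.emb_one by (simp add: hu_def \<kappa>_def)
        have nz: "\<one>\<^bsub>M\<^esub> \<ominus>\<^bsub>M\<^esub> \<phi> (h i) \<noteq> \<zero>\<^bsub>M\<^esub>"
          using io I.emb_zero hU[OF i] by (metis eq_iff_diff_eq_0)
        have "log_deriv M D' (\<one>\<^bsub>M\<^esub> \<ominus>\<^bsub>M\<^esub> \<phi> (h i)) \<in> carrier M"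
          using o nz M.D_closed M.field_Units by (simp add: log_deriv_def)
        moreover have "\<iota> (log_deriv M D' (\<one>\<^bsub>M\<^esub> \<ominus>\<^bsub>M\<^esub> \<phi> (h i))) = DU (1 - hu i) / (1 - hu i)"
          using I.emb_log_deriv[where D = D', OF o nz M.D_closed[OF o]] DM[OF o] io by simp
        ultimately show ?thesis using m by (simp add: I.emb_mult I.emb_pow du_def lu_def)
      qed
      have fc: "(\<Oplus>\<^bsub>M\<^esub>i\<in>{..<n}. ?t i) \<in> carrier M" using t by (intro M.finsum_closed) auto
      have "\<iota> (\<Oplus>\<^bsub>M\<^esub>i\<in>{..<n}. ?t i) = (\<Sum>i<n. du i * (DU (1 - hu i) / (1 - hu i)) * lu i ^ k i)"
        using t by (subst I.emb_finsum) auto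
      then show ?thesis
        unfolding \<kappa>_def eq using I.emb_add[OF M.D_closed[OF E] fc] DM[OF E] by simp
    qed
    have sFU: "U.small FU" unfolding U.small_def FU_def by (rule card_of_image[THEN ordLeq_transitive]) (rule card_of_mono1, simp)
    have ET: "\<iota> E \<in> T" using T(2) E by auto
    have lU': "DU (lu i) = DU (hu i) / hu i" if "i < n" for i using lU[OF that] by (simp add: lu_def hu_def)
    show ?thesis
    proof (rule U.polylog_descent[OF DU(1) FU DFU sFU KU FKU DKU KUcl t(1,2) Dt t(3) False fU hU lU' const dU
          T(1)[unfolded N_def] ET eqU])
    fix D2 Q Q1 E' h' l' d' assume Q: "derivation D2" "log_tower D2 (cl FU) Q" "\<And>y. y \<in> cl FU \<Longrightarrow> D2 y = DU y"
      "E' \<in> Q" "cl Q1 = Q1" "cl FU \<subseteq> Q1" "Q1 \<subseteq> Q" "\<And>y. y \<in> Q1 \<Longrightarrow> D2 y = 0 \<Longrightarrow> y \<in> cl FU"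
      "\<And>i. i < n \<Longrightarrow> h' i \<in> cl FU \<and> h' i \<noteq> 0 \<and> h' i \<noteq> 1 \<and> l' i \<in> Q1 \<and> D2 (l' i) = D2 (h' i) / h' i \<and>
        d' i \<in> cl FU \<and> D2 (d' i) = 0"
      "\<kappa> f = D2 E' + (\<Sum>i<n. d' i * (D2 (1 - h' i) / (1 - h' i)) * l' i ^ k i)"
    define P where "P = cl FU"
    have P: "field_set P" "\<And>x. x \<in> P \<Longrightarrow> D2 x \<in> P"
    proof -
      show "field_set P" unfolding P_def by (rule field_set_cl)
      show "D2 x \<in> P" if "x \<in> P" for x
        using that Q(3) cl_derivation_closed[OF DU(1), of FU x] DFU cl_superset[of FU] by (auto simp: P_def)
    qed
    have sP: "U.small P" unfolding P_def by (rule U.small_cl[OF FU sFU])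
    \<comment> \<open>\<open>Q\<close> need not be finitely generated over \<open>P\<close>; only
      \<open>E'\<close> and the logarithms \<open>l'\<close> have to be kept.\<close>
    have "finite (insert E' (l' ` {..<n}))" "insert E' (l' ` {..<n}) \<subseteq> Q" using Q(4,7,9) by auto
    from log_tower_finite[OF Q(2)[folded P_def] this]
    obtain S' where S': "fin_tower D2 P S'" "insert E' (l' ` {..<n}) \<subseteq> S'" by blast
    have FS': "field_set S'" using fin_tower_field_set[OF S'(1) Q(1) P] by blast
    have PS': "P \<subseteq> S'" by (rule fin_tower_superset[OF S'(1)])
    have "|S'| \<le>o |UNIV :: 'a set|" using U.fin_tower_small[OF S'(1) Q(1) P sP] by (simp add: U.small_def)
    \<comment> \<open>Smallness gives an injection of \<open>S'\<close> into the original type,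
      where the answer has to live.\<close>
    then obtain g :: "'u \<Rightarrow> 'a" where g: "inj_on g S'"
      unfolding card_of_ordLeq[symmetric] by auto
    let ?F = "copy g S' P" and ?D = "\<lambda>x. g (D2 (inv_into S' g x))"
    have gi: "inv_into S' g (g y) = y" if "y \<in> P" for y using that g PS' by auto
    define \<psi> where "\<psi> x = g (\<kappa> x)" for x
    have FP: "\<kappa> x \<in> P" if "x \<in> F" for x using that cl_superset[of FU] by (auto simp: P_def FU_def)
    interpret C: field_embedding ?F "inv_into S' g" by (rule copy_embedding[OF g PS' P(1)])
    have "differential_field ?F ?D" by (rule copy_differential_field[OF g PS' P(1) Q(1) P(2)])
    moreover have "differential_hom (K\<lparr>carrier := F\<rparr>) D ?F ?D \<psi>"
    proof -
      have "\<psi> (D x) = ?D (\<psi> x)" if "x \<in> F" for x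
        using that FP Q(3)[of "\<kappa> x"] DK FK gi by (auto simp: \<psi>_def P_def)
      moreover have "\<psi> \<in> ring_hom (K\<lparr>carrier := F\<rparr>) ?F"
        using FP FK gi J.emb_add J.emb_mult J.emb_one by (auto simp: ring_hom_def copy_def \<psi>_def subset_iff)
      ultimately show ?thesis by (simp add: differential_hom_def)
    qed
    moreover have "\<forall>x\<in>carrier ?F. algebraic_over ?F (\<psi> ` F) x"
    proof
      fix x assume x: "x \<in> carrier ?F"
      then obtain y where y: "x = g y" "y \<in> P" by (auto simp: copy_def)
      have pc: "\<psi> ` F \<subseteq> carrier ?F" using FP by (auto simp: copy_def \<psi>_def)
      have ip: "inv_into S' g ` \<psi> ` F = FU" using FP gi by (auto simp: \<psi>_def FU_def image_image)
      have "generate_field ?F (\<psi> ` F) \<subseteq> \<psi> ` F"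
      proof
        fix z assume z: "z \<in> generate_field ?F (\<psi> ` F)"
        then have "inv_into S' g z \<in> FU" using C.emb_generate_field[OF pc] ip gen_id[OF FU] by auto
        then obtain w where w: "w \<in> F" "inv_into S' g z = \<kappa> w" by (auto simp: FU_def)
        then have "inv_into S' g z = inv_into S' g (\<psi> w)" using gi FP by (simp add: \<psi>_def)
        then have "z = \<psi> w"
          using C.emb_inj C.generate_field_in_carrier[OF pc z] pc w(1) by (meson image_subset_iff inj_onD)
        then show "z \<in> \<psi> ` F" using w(1) by blast
      qed
      then have "generate_field ?F (\<psi> ` F) = \<psi> ` F"
        using generate_field.incl[of _ "\<psi> ` F" ?F] by (intro subset_antisym subsetI) auto
      then have "subfield (\<psi> ` F) ?F" using C.generate_field_is_subfield[OF pc] by simp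
      from C.emb_algebraic[OF this x] show "algebraic_over ?F (\<psi> ` F) x"
        using x y gi ip by (simp add: algebraic_over_def P_def)
    qed
    moreover have "has_polylog_integral ?F ?D (carrier ?F) (g (\<kappa> f))"
    proof (rule copy_polylog[OF Q(1) P S'(1) g _ _ _ _ Q(10)])
      show "E' \<in> S'" using S'(2) by simp
      show "\<kappa> f \<in> P" by (rule FP[OF f])
      show "h' i \<in> P \<and> h' i \<noteq> 0 \<and> h' i \<noteq> 1 \<and> l' i \<in> S' \<and> D2 (l' i) = D2 (h' i) / h' i \<and> d' i \<in> P \<and>
        D2 (d' i) = 0 \<and> 0 < k i" if "i < n" for i
        using Q(9)[OF that] S'(2) hd(7)[OF that] that by (auto simp: P_def)
      show "y \<in> P" if "y \<in> gen (P \<union> l' ` {..<n})" "D2 y = 0" for y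
      proof -
        have "gen (P \<union> l' ` {..<n}) \<subseteq> Q1"
          using Q(6,9) by (intro gen_least field_set_closed[OF Q(5)]) (auto simp: P_def)
        then show ?thesis using that Q(8) by (auto simp: P_def)
      qed
    qed
    ultimately show ?thesis
      by (intro exI[of _ ?F] exI[of _ ?D] exI[of _ \<psi>] conjI) (simp_all add: \<psi>_def)
    qed
  qed
qed

section \<open>A large algebraically closed field containing a given one\<close>

definition algebraic_descent :: "'a ring \<Rightarrow> ('a \<Rightarrow> 'a) \<Rightarrow> 'a set \<Rightarrow> 'a \<Rightarrow> bool" where
  "algebraic_descent K D F f \<longleftrightarrow> (\<exists>(F' :: 'a ring) D' \<psi>.
           differential_field F' D' \<and>
           differential_hom (K\<lparr>carrier := F\<rparr>) D F' D' \<psi> \<and>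
           (\<forall>x\<in>carrier F'. algebraic_over F' (\<psi> ` F) x) \<and>
           has_polylog_integral F' D' (carrier F') (\<psi> f))"

text \<open>A property of \<open>M\<close>, because this is the field to be embedded; the whole rest
  of a failing instance is quantified inside.\<close>

definition descent_counterexample :: "'a ring \<Rightarrow> bool" where
  "descent_counterexample M \<longleftrightarrow> (\<exists>(K :: 'a ring) D F \<theta> f D' \<phi> L E (n::nat) h l d (k :: nat \<Rightarrow> nat).
     differential_field K D \<and> differential_subfield F K D \<and>
     constants_in K D (carrier K) = constants_in K D F \<and> exponential_over K D F \<theta> \<and>
     (\<forall>x\<in>carrier K. algebraic_over K (generate_field K (insert \<theta> F)) x) \<and> f \<in> F \<and>
     has_polylog_integral K D (carrier K) f \<and>
     differential_field M D' \<and> differential_hom K D M D' \<phi> \<and>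
     elementary_ext M D' (\<phi> ` carrier K) (carrier M) \<and>
     log_ext M D' (\<phi> ` carrier K) L \<and> E \<in> carrier M \<and>
     (\<forall>i<n. h i \<in> carrier K - {\<zero>\<^bsub>K\<^esub>, \<one>\<^bsub>K\<^esub>} \<and> l i \<in> L \<and> is_log M D' (\<phi> (h i)) (l i) \<and>
        d i \<in> constants_in M D' L \<and> k i > 0) \<and>
     \<phi> f = D' E \<oplus>\<^bsub>M\<^esub>
       (\<Oplus>\<^bsub>M\<^esub>i\<in>{..<n}. d i \<otimes>\<^bsub>M\<^esub> log_deriv M D' (\<one>\<^bsub>M\<^esub> \<ominus>\<^bsub>M\<^esub> \<phi> (h i)) \<otimes>\<^bsub>M\<^esub> (l i [^]\<^bsub>M\<^esub> k i)) \<and>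
     \<not> algebraic_descent K D F f)"

definition transport_ring :: "('a \<Rightarrow> 'b) \<Rightarrow> 'a ring \<Rightarrow> 'b ring" where
  "transport_ring g R = \<lparr>carrier = g ` carrier R, monoid.mult = (\<lambda>x y. g (the_inv g x \<otimes>\<^bsub>R\<^esub> the_inv g y)),
     one = g \<one>\<^bsub>R\<^esub>, ring.zero = g \<zero>\<^bsub>R\<^esub>, add = (\<lambda>x y. g (the_inv g x \<oplus>\<^bsub>R\<^esub> the_inv g y))\<rparr>"

definition char0_field :: "'a ring \<Rightarrow> bool" where
  "char0_field R \<longleftrightarrow> field R \<and> (\<forall>n::nat. n > 0 \<longrightarrow> [n] \<cdot>\<^bsub>R\<^esub> \<one>\<^bsub>R\<^esub> \<noteq> \<zero>\<^bsub>R\<^esub>)"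

lemma descent_counterexample_char0_field:
  assumes "descent_counterexample M" shows "char0_field M"
proof -
  have "\<exists>D'. differential_field M D'"
    using assms unfolding descent_counterexample_def by (elim exE conjE) (rule exI)
  then show ?thesis by (auto simp: char0_field_def differential_field_def differential_field_axioms_def)
qed

lemma char0_field_transport:
  assumes R: "char0_field R" and g: "inj g"
  shows "char0_field (transport_ring g R)"
proof -
  interpret R: field R using R by (simp add: char0_field_def)
  have "g \<in> ring_iso R (transport_ring g R)"
    using g by (auto simp: ring_iso_def ring_hom_def transport_ring_def bij_betw_def the_inv_f_f intro: inj_on_subset)
  from R.ring_iso_imp_img_field[OF this] have f: "field (transport_ring g R)"
    by (simp add: transport_ring_def)
  interpret T: field "transport_ring g R" by (rule f)
  have "[n] \<cdot>\<^bsub>transport_ring g R\<^esub> \<one>\<^bsub>transport_ring g R\<^esub> = g ([n] \<cdot>\<^bsub>R\<^esub> \<one>\<^bsub>R\<^esub>)" for n :: nat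
    using g by (induction n) (simp_all add: T.add.nat_pow_Suc R.add.nat_pow_Suc, simp_all add: transport_ring_def the_inv_f_f)
  then show ?thesis
    using R f g by (auto simp: char0_field_def transport_ring_def dest: injD)
qed

lemma char0_field_type: "char0_field (ring_of_type_algebra :: 'a::field_char_0 ring)"
proof -
  let ?R = "ring_of_type_algebra :: 'a ring"
  interpret field ?R by (rule field_from_type_algebra)
  have "[n] \<cdot>\<^bsub>?R\<^esub> \<one>\<^bsub>?R\<^esub> = of_nat n" for n :: nat
    by (induction n) (simp_all add: add.nat_pow_Suc, simp_all add: ring_of_type_algebra_def)
  then show ?thesis using field_axioms by (simp add: char0_field_def) (simp add: ring_of_type_algebra_def)
qed

text \<open>HOL types cannot depend on the field at hand, so the type of coefficients is built from a
  counterexample to the theorem if there is one (and from the rationals otherwise). This is enough: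
  an embedding of that one counterexample into a large algebraically closed field refutes it.\<close>
definition coeff_ring :: "('a + rat) ring" where
  "coeff_ring = (if \<exists>M :: 'a ring. descent_counterexample M
     then transport_ring Inl (SOME M :: 'a ring. descent_counterexample M)
     else transport_ring Inr ring_of_type_algebra)"

lemma char0_field_coeff_ring: "char0_field (coeff_ring :: ('a + rat) ring)"
proof (cases "\<exists>M :: 'a ring. descent_counterexample M")
  case True
  then have "char0_field (SOME M :: 'a ring. descent_counterexample M)"
    by (rule descent_counterexample_char0_field[OF someI_ex])
  then show ?thesis using True by (simp add: coeff_ring_def char0_field_transport)
qed (simp add: coeff_ring_def char0_field_transport char0_field_type)

lemma field_coeff_ring: "field (coeff_ring :: ('a + rat) ring)"
  by (rule char0_field_coeff_ring[unfolded char0_field_def, THEN conjunct1])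

interpretation coeff_ring: cring "coeff_ring :: ('a + rat) ring"
  by (rule fieldE(1)[OF field_coeff_ring])

text \<open>The summand \<open>rat\<close> makes room for a field of characteristic 0 even if
  \<open>'a\<close> is finite.\<close>

typedef 'a coeff_field = "carrier (coeff_ring :: ('a + rat) ring)"
  using coeff_ring.zero_closed by blast

setup_lifting type_definition_coeff_field

instantiation coeff_field :: (type) field
begin

lift_definition zero_coeff_field :: "'a coeff_field" is "\<zero>\<^bsub>coeff_ring\<^esub>" by simp
lift_definition one_coeff_field :: "'a coeff_field" is "\<one>\<^bsub>coeff_ring\<^esub>" by simp
lift_definition plus_coeff_field :: "'a coeff_field \<Rightarrow> 'a coeff_field \<Rightarrow> 'a coeff_field"
  is "\<lambda>x y. x \<oplus>\<^bsub>coeff_ring\<^esub> y" by simp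
lift_definition minus_coeff_field :: "'a coeff_field \<Rightarrow> 'a coeff_field \<Rightarrow> 'a coeff_field"
  is "\<lambda>x y. x \<ominus>\<^bsub>coeff_ring\<^esub> y" by simp
lift_definition uminus_coeff_field :: "'a coeff_field \<Rightarrow> 'a coeff_field"
  is "\<lambda>x. \<ominus>\<^bsub>coeff_ring\<^esub> x" by simp
lift_definition times_coeff_field :: "'a coeff_field \<Rightarrow> 'a coeff_field \<Rightarrow> 'a coeff_field"
  is "\<lambda>x y. x \<otimes>\<^bsub>coeff_ring\<^esub> y" by simp
lift_definition inverse_coeff_field :: "'a coeff_field \<Rightarrow> 'a coeff_field"
  is "\<lambda>x. if x = \<zero>\<^bsub>coeff_ring\<^esub> then \<zero>\<^bsub>coeff_ring\<^esub> else inv\<^bsub>coeff_ring\<^esub> x"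
  using field.field_Units[OF field_coeff_ring] by auto

definition divide_coeff_field :: "'a coeff_field \<Rightarrow> 'a coeff_field \<Rightarrow> 'a coeff_field"
  where "divide_coeff_field x y = x * inverse y"

instance
proof
  fix a b c :: "'a coeff_field"
  show "a + b + c = a + (b + c)" by transfer (rule coeff_ring.a_assoc)
  show "a + b = b + a" by transfer (rule coeff_ring.a_comm)
  show "0 + a = a" by transfer (rule coeff_ring.l_zero)
  show "- a + a = 0" by transfer (rule coeff_ring.l_neg)
  show "a - b = a + - b" by transfer (simp add: coeff_ring.minus_eq)
  show "a * b * c = a * (b * c)" by transfer (rule coeff_ring.m_assoc)
  show "a * b = b * a" by transfer (rule coeff_ring.m_comm)
  show "1 * a = a" by transfer (rule coeff_ring.l_one)
  show "(a + b) * c = a * c + b * c" by transfer (rule coeff_ring.l_distr)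
  show "(0::'a coeff_field) \<noteq> 1" by transfer (use fieldE(2)[OF field_coeff_ring] in metis)
  show "a \<noteq> 0 \<Longrightarrow> inverse a * a = 1" by transfer (simp add: field.field_Units[OF field_coeff_ring] coeff_ring.Units_l_inv)
  show "a div b = a * inverse b" by (rule divide_coeff_field_def)
  show "inverse (0::'a coeff_field) = 0" by transfer simp
qed

end

lemma inj_of_natI:
  assumes "\<And>n. n > 0 \<Longrightarrow> of_nat n \<noteq> (0 :: 'a::ring_1)"
  shows "inj (of_nat :: nat \<Rightarrow> 'a)"
proof (rule linorder_injI)
  fix m n :: nat assume "m < n"
  then show "(of_nat m :: 'a) \<noteq> of_nat n" using assms[of "n - m"] by (simp add: of_nat_diff)
qed

instance coeff_field :: (type) field_char_0
proof (intro_classes, rule inj_of_natI)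
  fix n :: nat assume n: "n > 0"
  have "Rep_coeff_field (of_nat m :: 'a coeff_field) = [m] \<cdot>\<^bsub>coeff_ring\<^esub> \<one>\<^bsub>coeff_ring\<^esub>" for m
    by (induction m) (simp_all add: zero_coeff_field.rep_eq plus_coeff_field.rep_eq one_coeff_field.rep_eq
        coeff_ring.a_comm coeff_ring.add.nat_pow_Suc)
  then show "of_nat n \<noteq> (0 :: 'a coeff_field)"
    using n char0_field_coeff_ring by (metis char0_field_def zero_coeff_field.rep_eq)
qed

instance fract :: ("{idom, ring_char_0}") field_char_0
proof (intro_classes, rule inj_of_natI)
  fix n :: nat assume "n > 0"
  moreover have "(of_nat m :: 'a fract) = to_fract (of_nat m)" for m by (induction m) simp_all
  ultimately show "of_nat n \<noteq> (0 :: 'a fract)" by simp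
qed

text \<open>One indeterminate for each subset of \<open>'a\<close>, so that by Cantor's theorem the
  resulting field cannot be injected into \<open>'a\<close>.\<close>

typedef 'a indet = "UNIV :: 'a set set" by simp

text \<open>An arbitrary well-order. It orders the monomials, and leading monomials show that the
  polynomial ring is a domain, so that it has a field of fractions.\<close>

instantiation indet :: (type) linorder
begin

definition less_eq_indet :: "'a indet \<Rightarrow> 'a indet \<Rightarrow> bool"
  where "less_eq_indet x y \<longleftrightarrow> (x, y) \<in> (SOME r. well_order_on (UNIV :: 'a indet set) r)"

definition less_indet :: "'a indet \<Rightarrow> 'a indet \<Rightarrow> bool" where "less_indet x y \<longleftrightarrow> x \<le> y \<and> x \<noteq> (y :: 'a indet)"

instance
proof -
  let ?r = "SOME r. well_order_on (UNIV :: 'a indet set) r"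
  have "well_order_on UNIV ?r" by (rule someI_ex[OF well_order_on])
  then have r: "refl_on UNIV ?r" "trans ?r" "antisym ?r" "total_on UNIV ?r"
    by (simp_all add: well_order_on_def linear_order_on_def partial_order_on_def preorder_on_def)
  show "OFCLASS('a indet, linorder_class)"
  proof
    fix x y z :: "'a indet"
    show "(x < y) = (x \<le> y \<and> \<not> y \<le> x)"
      using r(3) by (auto simp: less_eq_indet_def less_indet_def antisym_def)
    show "x \<le> x" using r(1) by (simp add: less_eq_indet_def refl_on_def)
    show "x \<le> y \<Longrightarrow> y \<le> z \<Longrightarrow> x \<le> z" using r(2) unfolding less_eq_indet_def trans_def by blast
    show "x \<le> y \<Longrightarrow> y \<le> x \<Longrightarrow> x = y" using r(3) unfolding less_eq_indet_def antisym_def by blast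
    show "x \<le> y \<or> y \<le> x" using r(1,4) unfolding less_eq_indet_def total_on_def refl_on_def by (metis UNIV_I)
  qed
qed

end

type_synonym 'a universe = "((('a indet \<Rightarrow>\<^sub>0 nat) \<Rightarrow>\<^sub>0 'a coeff_field) fract) alg_closure"

definition indet_elem :: "'a set \<Rightarrow> 'a universe" where
  "indet_elem S = to_ac (to_fract (Poly_Mapping.single (Poly_Mapping.single (Abs_indet S) 1) 1))"

definition coeff_emb :: "'a \<Rightarrow> 'a universe" where
  "coeff_emb x = to_ac (to_fract (Poly_Mapping.single 0 (Abs_coeff_field (Inl x))))"

lemma inj_indet_elem: "inj indet_elem"
proof (rule injI)
  fix S T :: "'a set" assume "indet_elem S = indet_elem T"
  then have "Poly_Mapping.single (Poly_Mapping.single (Abs_indet S) (1::nat)) (1 :: 'a coeff_field)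
      = Poly_Mapping.single (Poly_Mapping.single (Abs_indet T) 1) 1" by (simp add: indet_elem_def)
  then have "Poly_Mapping.single (Abs_indet S) (1::nat) = Poly_Mapping.single (Abs_indet T) 1"
    by (metis lookup_single_eq lookup_single_not_eq zero_neq_one)
  then have "Abs_indet S = Abs_indet T" by (metis lookup_single_eq lookup_single_not_eq zero_neq_one)
  then show "S = T" by (simp add: Abs_indet_inject)
qed

lemma universe_large: "\<not> |UNIV :: 'a universe set| \<le>o |UNIV :: 'a set|"
proof
  assume "|UNIV :: 'a universe set| \<le>o |UNIV :: 'a set|"
  then obtain g :: "'a universe \<Rightarrow> 'a" where "inj g" unfolding card_of_ordLeq[symmetric] by auto
  then have "inj (g \<circ> indet_elem)" using inj_indet_elem by (metis inj_compose)
  then show False using Cantors_theorem[of "UNIV :: 'a set"] by (metis Pow_UNIV inj_imp_surj_inv)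
qed

lemma coeff_emb_embedding:
  assumes ex: "\<exists>M :: 'a ring. descent_counterexample M"
  shows "field_embedding (SOME M :: 'a ring. descent_counterexample M) coeff_emb"
proof -
  define M where "M = (SOME M :: 'a ring. descent_counterexample M)"
  have "char0_field M"
    unfolding M_def by (rule descent_counterexample_char0_field[OF someI_ex[OF ex]])
  then interpret M: field M by (simp add: char0_field_def)
  have R: "coeff_ring = transport_ring Inl M" using ex by (simp add: coeff_ring_def M_def)
  have c: "Inl x \<in> carrier (coeff_ring :: ('a + rat) ring)" if "x \<in> carrier M" for x
    using that by (simp add: R transport_ring_def the_inv_f_f)
  have "field_embedding M coeff_emb"
  proof
    fix x y assume x: "x \<in> carrier M" and y: "y \<in> carrier M"
    have "Abs_coeff_field (Inl (x \<oplus>\<^bsub>M\<^esub> y)) = Abs_coeff_field (Inl x) + Abs_coeff_field (Inl y)"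
      using c x y by (simp add: plus_coeff_field.abs_eq eq_onp_def) (simp add: R transport_ring_def the_inv_f_f)
    then show "coeff_emb (x \<oplus>\<^bsub>M\<^esub> y) = coeff_emb x + coeff_emb y"
      by (simp add: coeff_emb_def single_add)
    have "Abs_coeff_field (Inl (x \<otimes>\<^bsub>M\<^esub> y)) = Abs_coeff_field (Inl x) * Abs_coeff_field (Inl y)"
      using c x y by (simp add: times_coeff_field.abs_eq eq_onp_def) (simp add: R transport_ring_def the_inv_f_f)
    then show "coeff_emb (x \<otimes>\<^bsub>M\<^esub> y) = coeff_emb x * coeff_emb y"
      by (simp add: coeff_emb_def mult_single flip: to_ac_mult to_fract_mult)
  next
    have "Abs_coeff_field (Inl \<one>\<^bsub>M\<^esub>) = (1 :: 'a coeff_field)"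
      by (simp add: one_coeff_field_def) (simp add: R transport_ring_def the_inv_f_f)
    then show "coeff_emb \<one>\<^bsub>M\<^esub> = 1" by (simp add: coeff_emb_def)
  qed
  then show ?thesis by (simp add: M_def)
qed

text \<open>The coefficient field was built from the counterexample picked by \<open>SOME\<close>.
  So exactly this one embeds into \<open>universe\<close>, and \<open>descent_from_embedding\<close>
  refutes it.\<close>

lemma no_descent_counterexample: "\<not> descent_counterexample (M :: 'a ring)"
proof
  assume "descent_counterexample M"
  then have ex: "\<exists>M :: 'a ring. descent_counterexample M" by blast
  define M0 where "M0 = (SOME M :: 'a ring. descent_counterexample M)"
  have "descent_counterexample M0" unfolding M0_def by (rule someI_ex[OF ex])
  moreover have emb: "field_embedding M0 (coeff_emb :: 'a \<Rightarrow> 'a universe)"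
    unfolding M0_def by (rule coeff_emb_embedding[OF ex])
  ultimately show False
    unfolding descent_counterexample_def
    by (elim exE conjE)
      (erule notE, unfold algebraic_descent_def,
        rule descent_from_embedding[OF _ _ _ _ _ _ _ _ _ _ _ _ _ _ emb universe_large]; assumption)
qed

theorem theorem3p1:
  fixes K :: "'a ring" and D :: "'a \<Rightarrow> 'a" and F :: "'a set" and \<theta> f :: 'a
  assumes "differential_field K D"
    and "differential_subfield F K D"
    and "constants_in K D (carrier K) = constants_in K D F"
    and "exponential_over K D F \<theta>"
    and "\<forall>x\<in>carrier K. algebraic_over K (generate_field K (insert \<theta> F)) x"
    and "f \<in> F"
    and "has_polylog_integral K D (carrier K) f"
  shows "\<exists>(F' :: 'a ring) D' \<psi>.
           differential_field F' D' \<and>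
           differential_hom (K\<lparr>carrier := F\<rparr>) D F' D' \<psi> \<and>
           (\<forall>x\<in>carrier F'. algebraic_over F' (\<psi> ` F) x) \<and>
           has_polylog_integral F' D' (carrier F') (\<psi> f)"
proof (rule ccontr)
  assume "\<not> ?thesis"
  then have nd: "\<not> algebraic_descent K D F f" by (simp add: algebraic_descent_def)
  obtain M :: "'a ring" and D' \<phi> L E and n :: nat and h l d and k :: "nat \<Rightarrow> nat" where
    "differential_field M D' \<and> differential_hom K D M D' \<phi> \<and>
        elementary_ext M D' (\<phi> ` carrier K) (carrier M) \<and>
        log_ext M D' (\<phi> ` carrier K) L \<and>
        E \<in> carrier M \<and>
        (\<forall>i<n. h i \<in> carrier K - {\<zero>\<^bsub>K\<^esub>, \<one>\<^bsub>K\<^esub>} \<and>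
               l i \<in> L \<and> is_log M D' (\<phi> (h i)) (l i) \<and>
               d i \<in> constants_in M D' L \<and> k i > 0) \<and>
        \<phi> f = D' E \<oplus>\<^bsub>M\<^esub>
          (\<Oplus>\<^bsub>M\<^esub>i\<in>{..<n}. d i \<otimes>\<^bsub>M\<^esub> log_deriv M D' (\<one>\<^bsub>M\<^esub> \<ominus>\<^bsub>M\<^esub> \<phi> (h i)) \<otimes>\<^bsub>M\<^esub> (l i [^]\<^bsub>M\<^esub> k i))"
    using assms(7) unfolding has_polylog_integral_def by (elim exE) (rule that, assumption)
  then have "descent_counterexample M"
    unfolding descent_counterexample_def
    by (intro exI[of _ K] exI[of _ D] exI[of _ F] exI[of _ \<theta>] exI[of _ f] exI[of _ D'] exI[of _ \<phi>]
        exI[of _ L] exI[of _ E] exI[of _ n] exI[of _ h] exI[of _ l] exI[of _ d] exI[of _ k])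
      (use assms nd in simp)
  then show False using no_descent_counterexample by blast
qed

end
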